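(* Let $\mathcal{E}$ be an idempotent complete exact category. Then $\operatorname{mod}_{\mathsf{adm}}(\mathcal{E})$ is the smallest resolving subcategory of $\mathcal{P}^2(\mathcal{E})$ containing $\operatorname{eff}(\mathcal{E})$.
   Context: All categories are essentially small and additive; subcategories are full and closed under isomorphisms. Exact categories are in the sense of Quillen, with conflations, inflations and deflations. A morphism is admissible if it is a composite $m\circ p$ with $p$ a deflation and $m$ an inflation. $\operatorname{Mod}(\mathcal{E})$ is the category of additive contravariant functors $\mathcal{E}\to\mathsf{Ab}$, $\Upsilon(X)=\operatorname{Hom}_{\mathcal{E}}(-,X)$. $\operatorname{mod}_{\mathsf{adm}}(\mathcal{E})$ (resp. $\operatorname{eff}(\mathcal{E})$) is the full subcategory of $\operatorname{Mod}(\mathcal{E})$ of functors $F$ with an exact sequence $\Upsilon(X)\xrightarrow{\Upsilon(f)}\Upsilon(Y)\to F\to 0$ with $f$ an admissible morphism (resp. a deflation) in $\mathcal{E}$. $\mathcal{P}^2(\mathcal{E})$ is the full subcategory of functors $F$ admitting an exact sequence $0\to\Upsilon(X)\to\Upsilon(Y)\to\Upsilon(Z)\to F\to 0$; it is closed under extensions and kernels of epimorphisms in $\operatorname{Mod}(\mathcal{E})$ and carries the exact structure inherited from $\operatorname{Mod}(\mathcal{E})$. A subcategory $\mathcal{X}$ of an exact category $\mathcal{D}$ is resolving if it is closed under extensions, direct summands and kernels of deflations, and is generating, i.e. every $D\in\mathcal{D}$ admits a deflation $X\twoheadrightarrow D$ with $X\in\mathcal{X}$. *)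

theory Defs
  imports "HOL-Algebra.Coset" "HOL-Library.FuncSet"
begin

section \<open>Additive categories\<close>

text \<open>
  Every arrow has a unique domain and codomain, so hom-sets are disjoint. The operations are total
  functions whose values outside the intended arguments are irrelevant.
\<close>

record ('o, 'm) cat =
  Ob :: "'o set"
  Arr :: "'m set"
  Dom :: "'m \<Rightarrow> 'o"
  Cod :: "'m \<Rightarrow> 'o"
  Ident :: "'o \<Rightarrow> 'm"
  Comp :: "'m \<Rightarrow> 'm \<Rightarrow> 'm" (infixr "\<cdot>\<index>" 75)
  Add :: "'m \<Rightarrow> 'm \<Rightarrow> 'm"
  Zero :: "'o \<Rightarrow> 'o \<Rightarrow> 'm"

definition Hom :: "('o, 'm, 'z) cat_scheme \<Rightarrow> 'o \<Rightarrow> 'o \<Rightarrow> 'm set" where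
  "Hom C X Y = {f \<in> Arr C. Dom C f = X \<and> Cod C f = Y}"

definition hom_group :: "('o, 'm, 'z) cat_scheme \<Rightarrow> 'o \<Rightarrow> 'o \<Rightarrow> 'm monoid" where
  "hom_group C X Y = \<lparr>carrier = Hom C X Y, mult = Add C, one = Zero C X Y\<rparr>"

locale preadditive_category =
  fixes C :: "('o, 'm, 'z) cat_scheme" (structure)
  assumes Dom_Ob: "f \<in> Arr C \<Longrightarrow> Dom C f \<in> Ob C"
    and Cod_Ob: "f \<in> Arr C \<Longrightarrow> Cod C f \<in> Ob C"
    and Ident_Hom: "X \<in> Ob C \<Longrightarrow> Ident C X \<in> Hom C X X"
    and Comp_Hom: "f \<in> Hom C X Y \<Longrightarrow> g \<in> Hom C Y Z \<Longrightarrow> g \<cdot> f \<in> Hom C X Z"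
    and Comp_Ident: "f \<in> Hom C X Y \<Longrightarrow> f \<cdot> Ident C X = f"
    and Ident_Comp: "f \<in> Hom C X Y \<Longrightarrow> Ident C Y \<cdot> f = f"
    and Comp_assoc: "f \<in> Hom C W X \<Longrightarrow> g \<in> Hom C X Y \<Longrightarrow> h \<in> Hom C Y Z \<Longrightarrow>
      h \<cdot> (g \<cdot> f) = (h \<cdot> g) \<cdot> f"
    and hom_group: "X \<in> Ob C \<Longrightarrow> Y \<in> Ob C \<Longrightarrow> comm_group (hom_group C X Y)"
    and Comp_Add: "f \<in> Hom C X Y \<Longrightarrow> f' \<in> Hom C X Y \<Longrightarrow> g \<in> Hom C Y Z \<Longrightarrow>
      g \<cdot> Add C f f' = Add C (g \<cdot> f) (g \<cdot> f')"
    and Add_Comp: "f \<in> Hom C X Y \<Longrightarrow> g \<in> Hom C Y Z \<Longrightarrow> g' \<in> Hom C Y Z \<Longrightarrow>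
      Add C g g' \<cdot> f = Add C (g \<cdot> f) (g' \<cdot> f)"

definition zero_object :: "('o, 'm, 'z) cat_scheme \<Rightarrow> 'o \<Rightarrow> bool" where
  "zero_object C Z \<longleftrightarrow> Z \<in> Ob C \<and>
    (\<forall>X\<in>Ob C. (\<exists>!f. f \<in> Hom C X Z) \<and> (\<exists>!f. f \<in> Hom C Z X))"

definition biproduct :: "('o, 'm, 'z) cat_scheme \<Rightarrow> 'o \<Rightarrow> 'o \<Rightarrow> 'o \<Rightarrow> bool" where
  "biproduct C A B S \<longleftrightarrow> A \<in> Ob C \<and> B \<in> Ob C \<and> S \<in> Ob C \<and>
    (\<exists>i \<in> Hom C A S. \<exists>j \<in> Hom C B S. \<exists>p \<in> Hom C S A. \<exists>q \<in> Hom C S B.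
      p \<cdot>\<^bsub>C\<^esub> i = Ident C A \<and> q \<cdot>\<^bsub>C\<^esub> j = Ident C B \<and>
      p \<cdot>\<^bsub>C\<^esub> j = Zero C B A \<and> q \<cdot>\<^bsub>C\<^esub> i = Zero C A B \<and>
      Add C (i \<cdot>\<^bsub>C\<^esub> p) (j \<cdot>\<^bsub>C\<^esub> q) = Ident C S)"

locale additive_category = preadditive_category +
  assumes has_zero_object: "\<exists>Z. zero_object C Z"
    and has_biproducts: "A \<in> Ob C \<Longrightarrow> B \<in> Ob C \<Longrightarrow> \<exists>S. biproduct C A B S"

definition isomorphism :: "('o, 'm, 'z) cat_scheme \<Rightarrow> 'o \<Rightarrow> 'o \<Rightarrow> 'm \<Rightarrow> bool" where
  "isomorphism C X Y f \<longleftrightarrow> f \<in> Hom C X Y \<and>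
    (\<exists>g \<in> Hom C Y X. g \<cdot>\<^bsub>C\<^esub> f = Ident C X \<and> f \<cdot>\<^bsub>C\<^esub> g = Ident C Y)"

definition isomorphic :: "('o, 'm, 'z) cat_scheme \<Rightarrow> 'o \<Rightarrow> 'o \<Rightarrow> bool" where
  "isomorphic C X Y \<longleftrightarrow> (\<exists>f. isomorphism C X Y f)"

definition idempotent_complete :: "('o, 'm, 'z) cat_scheme \<Rightarrow> bool" where
  "idempotent_complete C \<longleftrightarrow>
    (\<forall>X\<in>Ob C. \<forall>e \<in> Hom C X X. e \<cdot>\<^bsub>C\<^esub> e = e \<longrightarrow>
      (\<exists>Y\<in>Ob C. \<exists>r \<in> Hom C X Y. \<exists>s \<in> Hom C Y X.
        s \<cdot>\<^bsub>C\<^esub> r = e \<and> r \<cdot>\<^bsub>C\<^esub> s = Ident C Y))"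


section \<open>Exact categories in the sense of Quillen\<close>

definition is_kernel :: "('o, 'm, 'z) cat_scheme \<Rightarrow> 'm \<Rightarrow> 'm \<Rightarrow> bool" where
  "is_kernel C i p \<longleftrightarrow> i \<in> Arr C \<and> p \<in> Arr C \<and> Cod C i = Dom C p \<and>
    p \<cdot>\<^bsub>C\<^esub> i = Zero C (Dom C i) (Cod C p) \<and>
    (\<forall>W\<in>Ob C. \<forall>f \<in> Hom C W (Dom C p). p \<cdot>\<^bsub>C\<^esub> f = Zero C W (Cod C p) \<longrightarrow>
      (\<exists>!g. g \<in> Hom C W (Dom C i) \<and> i \<cdot>\<^bsub>C\<^esub> g = f))"

definition is_cokernel :: "('o, 'm, 'z) cat_scheme \<Rightarrow> 'm \<Rightarrow> 'm \<Rightarrow> bool" where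
  "is_cokernel C p i \<longleftrightarrow> i \<in> Arr C \<and> p \<in> Arr C \<and> Cod C i = Dom C p \<and>
    p \<cdot>\<^bsub>C\<^esub> i = Zero C (Dom C i) (Cod C p) \<and>
    (\<forall>W\<in>Ob C. \<forall>f \<in> Hom C (Cod C i) W. f \<cdot>\<^bsub>C\<^esub> i = Zero C (Dom C i) W \<longrightarrow>
      (\<exists>!g. g \<in> Hom C (Cod C p) W \<and> g \<cdot>\<^bsub>C\<^esub> p = f))"

definition is_pushout ::
    "('o, 'm, 'z) cat_scheme \<Rightarrow> 'm \<Rightarrow> 'm \<Rightarrow> 'm \<Rightarrow> 'm \<Rightarrow> bool" where
  "is_pushout C f g f' g' \<longleftrightarrow>
    f \<in> Arr C \<and> g \<in> Arr C \<and> f' \<in> Arr C \<and> g' \<in> Arr C \<and>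
    Dom C f = Dom C g \<and> Dom C g' = Cod C f \<and> Dom C f' = Cod C g \<and> Cod C f' = Cod C g' \<and>
    g' \<cdot>\<^bsub>C\<^esub> f = f' \<cdot>\<^bsub>C\<^esub> g \<and>
    (\<forall>W\<in>Ob C. \<forall>a \<in> Hom C (Cod C f) W. \<forall>b \<in> Hom C (Cod C g) W.
      a \<cdot>\<^bsub>C\<^esub> f = b \<cdot>\<^bsub>C\<^esub> g \<longrightarrow>
      (\<exists>!h. h \<in> Hom C (Cod C f') W \<and> h \<cdot>\<^bsub>C\<^esub> g' = a \<and> h \<cdot>\<^bsub>C\<^esub> f' = b))"

definition is_pullback ::
    "('o, 'm, 'z) cat_scheme \<Rightarrow> 'm \<Rightarrow> 'm \<Rightarrow> 'm \<Rightarrow> 'm \<Rightarrow> bool" where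
  "is_pullback C f g f' g' \<longleftrightarrow>
    f \<in> Arr C \<and> g \<in> Arr C \<and> f' \<in> Arr C \<and> g' \<in> Arr C \<and>
    Cod C f = Cod C g \<and> Cod C g' = Dom C f \<and> Cod C f' = Dom C g \<and> Dom C f' = Dom C g' \<and>
    f \<cdot>\<^bsub>C\<^esub> g' = g \<cdot>\<^bsub>C\<^esub> f' \<and>
    (\<forall>W\<in>Ob C. \<forall>a \<in> Hom C W (Dom C f). \<forall>b \<in> Hom C W (Dom C g).
      f \<cdot>\<^bsub>C\<^esub> a = g \<cdot>\<^bsub>C\<^esub> b \<longrightarrow>
      (\<exists>!h. h \<in> Hom C W (Dom C f') \<and> g' \<cdot>\<^bsub>C\<^esub> h = a \<and> f' \<cdot>\<^bsub>C\<^esub> h = b))"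

record ('o, 'm) exact_cat = "('o, 'm) cat" +
  Conflations :: "('m \<times> 'm) set"

definition inflation :: "('o, 'm, 'z) exact_cat_scheme \<Rightarrow> 'm \<Rightarrow> bool" where
  "inflation E i \<longleftrightarrow> (\<exists>p. (i, p) \<in> Conflations E)"

definition deflation :: "('o, 'm, 'z) exact_cat_scheme \<Rightarrow> 'm \<Rightarrow> bool" where
  "deflation E p \<longleftrightarrow> (\<exists>i. (i, p) \<in> Conflations E)"

definition admissible :: "('o, 'm, 'z) exact_cat_scheme \<Rightarrow> 'm \<Rightarrow> bool" where
  "admissible E f \<longleftrightarrow>
    (\<exists>p m. deflation E p \<and> inflation E m \<and> Cod E p = Dom E m \<and> f = m \<cdot>\<^bsub>E\<^esub> p)"

locale exact_category = additive_category E
  for E :: "('o, 'm, 'z) exact_cat_scheme" (structure) +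
  assumes kernel_cokernel_pair:
      "(i, p) \<in> Conflations E \<Longrightarrow> is_kernel E i p \<and> is_cokernel E p i"
    and Conflations_iso:
      "(i, p) \<in> Conflations E \<Longrightarrow> i' \<in> Hom E A' B' \<Longrightarrow> p' \<in> Hom E B' C' \<Longrightarrow>
       isomorphism E (Dom E i) A' a \<Longrightarrow> isomorphism E (Cod E i) B' b \<Longrightarrow>
       isomorphism E (Cod E p) C' c \<Longrightarrow> b \<cdot> i = i' \<cdot> a \<Longrightarrow> c \<cdot> p = p' \<cdot> b \<Longrightarrow>
       (i', p') \<in> Conflations E"
    and inflation_Ident: "X \<in> Ob E \<Longrightarrow> inflation E (Ident E X)"
    and deflation_Ident: "X \<in> Ob E \<Longrightarrow> deflation E (Ident E X)"
    and inflation_Comp: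
      "inflation E f \<Longrightarrow> inflation E g \<Longrightarrow> Cod E f = Dom E g \<Longrightarrow> inflation E (g \<cdot> f)"
    and deflation_Comp:
      "deflation E f \<Longrightarrow> deflation E g \<Longrightarrow> Cod E f = Dom E g \<Longrightarrow> deflation E (g \<cdot> f)"
    and inflation_pushout:
      "inflation E f \<Longrightarrow> g \<in> Arr E \<Longrightarrow> Dom E f = Dom E g \<Longrightarrow>
       \<exists>f' g'. is_pushout E f g f' g' \<and> inflation E f'"
    and deflation_pullback:
      "deflation E f \<Longrightarrow> g \<in> Arr E \<Longrightarrow> Cod E f = Cod E g \<Longrightarrow>
       \<exists>f' g'. is_pullback E f g f' g' \<and> deflation E f'"

definition full_exact_subcat :: "('o, 'm) exact_cat \<Rightarrow> 'o set \<Rightarrow> ('o, 'm) exact_cat" where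
  "full_exact_subcat D S = D\<lparr>Ob := S,
     Arr := {f \<in> Arr D. Dom D f \<in> S \<and> Cod D f \<in> S},
     Conflations := {(i, p) \<in> Conflations D. Dom D i \<in> S \<and> Cod D i \<in> S \<and> Cod D p \<in> S}\<rparr>"

text \<open>
  Subcategories are full and closed under isomorphisms, so they are given by sets of objects.
  Such a subcategory is automatically additive if it is resolving: it contains a zero object by
  the generation property and closure under direct summands, and biproducts are extensions.
\<close>

definition resolving :: "('o, 'm, 'z) exact_cat_scheme \<Rightarrow> 'o set \<Rightarrow> bool" where
  "resolving D S \<longleftrightarrow> S \<subseteq> Ob D \<and>
    (\<forall>X\<in>S. \<forall>Y\<in>Ob D. isomorphic D X Y \<longrightarrow> Y \<in> S) \<and>
    (\<forall>(i, p)\<in>Conflations D. Dom D i \<in> S \<longrightarrow> Cod D p \<in> S \<longrightarrow> Cod D i \<in> S) \<and>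
    (\<forall>A B. \<forall>X\<in>S. biproduct D A B X \<longrightarrow> A \<in> S) \<and>
    (\<forall>(i, p)\<in>Conflations D. Dom D p \<in> S \<longrightarrow> Cod D p \<in> S \<longrightarrow> Dom D i \<in> S) \<and>
    (\<forall>Y\<in>Ob D. \<exists>p. deflation D p \<and> Dom D p \<in> S \<and> Cod D p = Y)"


section \<open>The category of additive contravariant functors to abelian groups\<close>

text \<open>
  Abelian groups are written multiplicatively, as in \<open>comm_group\<close>; their carriers are subsets of
  an arbitrary type \<open>'u\<close>.
\<close>

record ('o, 'm, 'u) presheaf =
  FOb :: "'o \<Rightarrow> 'u monoid"
  FArr :: "'m \<Rightarrow> 'u \<Rightarrow> 'u"

definition additive_functors ::
    "('o, 'm, 'z) cat_scheme \<Rightarrow> ('o, 'm, 'u) presheaf set" where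
  "additive_functors E = {F.
    (\<forall>X\<in>Ob E. comm_group (FOb F X)) \<and>
    (\<forall>X\<in>Ob E. \<forall>Y\<in>Ob E. \<forall>f \<in> Hom E X Y. FArr F f \<in> hom (FOb F Y) (FOb F X)) \<and>
    (\<forall>X\<in>Ob E. \<forall>x \<in> carrier (FOb F X). FArr F (Ident E X) x = x) \<and>
    (\<forall>X\<in>Ob E. \<forall>Y\<in>Ob E. \<forall>Z\<in>Ob E. \<forall>f \<in> Hom E X Y. \<forall>g \<in> Hom E Y Z. \<forall>x \<in> carrier (FOb F Z).
      FArr F (g \<cdot>\<^bsub>E\<^esub> f) x = FArr F f (FArr F g x)) \<and>
    (\<forall>X\<in>Ob E. \<forall>Y\<in>Ob E. \<forall>f \<in> Hom E X Y. \<forall>g \<in> Hom E X Y. \<forall>x \<in> carrier (FOb F Y).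
      FArr F (Add E f g) x = FArr F f x \<otimes>\<^bsub>FOb F X\<^esub> FArr F g x)}"

text \<open>Source and target may take values in different types, as needed for \<open>\<Upsilon>(X) \<rightarrow> F\<close>.\<close>

definition natural :: "('o, 'm, 'z) cat_scheme \<Rightarrow> ('o, 'm, 'u) presheaf \<Rightarrow>
    ('o, 'm, 'v) presheaf \<Rightarrow> ('o \<Rightarrow> 'u \<Rightarrow> 'v) \<Rightarrow> bool" where
  "natural E F G \<tau> \<longleftrightarrow>
    (\<forall>X\<in>Ob E. \<tau> X \<in> hom (FOb F X) (FOb G X)) \<and>
    (\<forall>X\<in>Ob E. \<forall>Y\<in>Ob E. \<forall>f \<in> Hom E X Y. \<forall>x \<in> carrier (FOb F Y).
      \<tau> X (FArr F f x) = FArr G f (\<tau> Y x))"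

text \<open>Exactness of sequences of functors is tested objectwise.\<close>

definition exact_at :: "('o, 'm, 'z) cat_scheme \<Rightarrow> ('o, 'm, 'u) presheaf \<Rightarrow>
    ('o \<Rightarrow> 'u \<Rightarrow> 'v) \<Rightarrow> ('o, 'm, 'v) presheaf \<Rightarrow> ('o \<Rightarrow> 'v \<Rightarrow> 'w) \<Rightarrow>
    ('o, 'm, 'w) presheaf \<Rightarrow> bool" where
  "exact_at E F \<sigma> G \<tau> H \<longleftrightarrow>
    (\<forall>X\<in>Ob E. \<sigma> X ` carrier (FOb F X) = kernel (FOb G X) (FOb H X) (\<tau> X))"

definition monic :: "('o, 'm, 'z) cat_scheme \<Rightarrow> ('o, 'm, 'u) presheaf \<Rightarrow>
    ('o \<Rightarrow> 'u \<Rightarrow> 'v) \<Rightarrow> bool" where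
  "monic E F \<tau> \<longleftrightarrow> (\<forall>X\<in>Ob E. inj_on (\<tau> X) (carrier (FOb F X)))"

definition epic :: "('o, 'm, 'z) cat_scheme \<Rightarrow> ('o, 'm, 'u) presheaf \<Rightarrow>
    ('o \<Rightarrow> 'u \<Rightarrow> 'v) \<Rightarrow> ('o, 'm, 'v) presheaf \<Rightarrow> bool" where
  "epic E F \<tau> G \<longleftrightarrow> (\<forall>X\<in>Ob E. \<tau> X ` carrier (FOb F X) = carrier (FOb G X))"

definition mor :: "('o, 'm, 'z) cat_scheme \<Rightarrow> ('o, 'm, 'u) presheaf \<Rightarrow>
    ('o, 'm, 'u) presheaf \<Rightarrow> ('o \<Rightarrow> 'u \<Rightarrow> 'u) \<Rightarrow>
    ('o, 'm, 'u) presheaf \<times> ('o \<Rightarrow> 'u \<Rightarrow> 'u) \<times> ('o, 'm, 'u) presheaf" where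
  "mor E F G \<tau> = (F, \<lambda>X\<in>Ob E. \<lambda>x\<in>carrier (FOb F X). \<tau> X x, G)"

text \<open>
  The arrows of \<open>Mod_cat E\<close> are the triples \<open>mor E F G \<tau>\<close> with \<open>\<tau>\<close> natural. The components
  are made extensional, so that equality of arrows is equality of natural transformations.
\<close>

definition Mod_cat ::
    "('o, 'm, 'z) cat_scheme \<Rightarrow>
     (('o, 'm, 'u) presheaf,
      ('o, 'm, 'u) presheaf \<times> ('o \<Rightarrow> 'u \<Rightarrow> 'u) \<times> ('o, 'm, 'u) presheaf) exact_cat" where
  "Mod_cat E = \<lparr>
    Ob = additive_functors E,
    Arr = {mor E F G \<tau> | F G \<tau>.
      F \<in> additive_functors E \<and> G \<in> additive_functors E \<and> natural E F G \<tau>},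
    Dom = (\<lambda>(F, \<tau>, G). F),
    Cod = (\<lambda>(F, \<tau>, G). G),
    Ident = (\<lambda>F. mor E F F (\<lambda>X x. x)),
    Comp = (\<lambda>(G', \<tau>, H) (F, \<sigma>, G). mor E F H (\<lambda>X x. \<tau> X (\<sigma> X x))),
    Add = (\<lambda>(F, \<sigma>, G) (F', \<tau>, G'). mor E F G (\<lambda>X x. \<sigma> X x \<otimes>\<^bsub>FOb G X\<^esub> \<tau> X x)),
    Zero = (\<lambda>F G. mor E F G (\<lambda>X x. \<one>\<^bsub>FOb G X\<^esub>)),
    Conflations = {(mor E F G \<sigma>, mor E G H \<tau>) | F G H \<sigma> \<tau>.
      F \<in> additive_functors E \<and> G \<in> additive_functors E \<and> H \<in> additive_functors E \<and>
      natural E F G \<sigma> \<and> natural E G H \<tau> \<and>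
      monic E F \<sigma> \<and> exact_at E F \<sigma> G \<tau> H \<and> epic E G \<tau> H}\<rparr>"

definition Yo :: "('o, 'm, 'z) cat_scheme \<Rightarrow> 'o \<Rightarrow> ('o, 'm, 'm) presheaf" ("\<Upsilon>") where
  "\<Upsilon> E X = \<lparr>FOb = (\<lambda>W. hom_group E W X), FArr = (\<lambda>f g. g \<cdot>\<^bsub>E\<^esub> f)\<rparr>"

definition Yo_map :: "('o, 'm, 'z) cat_scheme \<Rightarrow> 'm \<Rightarrow> 'o \<Rightarrow> 'm \<Rightarrow> 'm" where
  "Yo_map E f = (\<lambda>W g. f \<cdot>\<^bsub>E\<^esub> g)"

definition presented_by ::
    "('o, 'm, 'z) cat_scheme \<Rightarrow> 'm \<Rightarrow> ('o, 'm, 'u) presheaf \<Rightarrow> bool" where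
  "presented_by E f F \<longleftrightarrow> f \<in> Arr E \<and>
    (\<exists>\<pi>. natural E (\<Upsilon> E (Cod E f)) F \<pi> \<and>
      exact_at E (\<Upsilon> E (Dom E f)) (Yo_map E f) (\<Upsilon> E (Cod E f)) \<pi> F \<and>
      epic E (\<Upsilon> E (Cod E f)) \<pi> F)"

definition mod_adm :: "('o, 'm, 'z) exact_cat_scheme \<Rightarrow> ('o, 'm, 'u) presheaf set" where
  "mod_adm E = {F \<in> additive_functors E. \<exists>f. admissible E f \<and> presented_by E f F}"

definition eff :: "('o, 'm, 'z) exact_cat_scheme \<Rightarrow> ('o, 'm, 'u) presheaf set" where
  "eff E = {F \<in> additive_functors E. \<exists>f. deflation E f \<and> presented_by E f F}"

definition P2_objects :: "('o, 'm, 'z) cat_scheme \<Rightarrow> ('o, 'm, 'u) presheaf set" where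
  "P2_objects E = {F \<in> additive_functors E.
    \<exists>X\<in>Ob E. \<exists>Y\<in>Ob E. \<exists>Z\<in>Ob E. \<exists>\<alpha> \<beta> \<pi>.
      natural E (\<Upsilon> E X) (\<Upsilon> E Y) \<alpha> \<and> natural E (\<Upsilon> E Y) (\<Upsilon> E Z) \<beta> \<and>
      natural E (\<Upsilon> E Z) F \<pi> \<and>
      monic E (\<Upsilon> E X) \<alpha> \<and>
      exact_at E (\<Upsilon> E X) \<alpha> (\<Upsilon> E Y) \<beta> (\<Upsilon> E Z) \<and>
      exact_at E (\<Upsilon> E Y) \<beta> (\<Upsilon> E Z) \<pi> F \<and>
      epic E (\<Upsilon> E Z) \<pi> F}"

definition P2 ::
    "('o, 'm, 'z) cat_scheme \<Rightarrow>
     (('o, 'm, 'u) presheaf,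
      ('o, 'm, 'u) presheaf \<times> ('o \<Rightarrow> 'u \<Rightarrow> 'u) \<times> ('o, 'm, 'u) presheaf) exact_cat" where
  "P2 E = full_exact_subcat (Mod_cat E) (P2_objects E)"

text \<open>
  The type \<open>'u\<close> is large enough for \<open>E\<close> if every hom-set embeds into it. Then every
  representable functor, and hence every quotient of one, is isomorphic to a functor with values
  in subsets of \<open>'u\<close>. Without this, \<open>Mod_cat E\<close> would lack representable functors for reasons of size.
\<close>

definition homs_embed_in :: "('o, 'm, 'z) cat_scheme \<Rightarrow> 'u itself \<Rightarrow> bool" where
  "homs_embed_in E (_ :: 'u itself) \<longleftrightarrow>
    (\<forall>X\<in>Ob E. \<forall>Y\<in>Ob E. \<exists>\<iota> :: 'm \<Rightarrow> 'u. inj_on \<iota> (Hom E X Y))"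

end

theory Submission
  imports Defs
begin

text \<open>
  Deflations generate a Grothendieck topology on \<open>\<E>\<close> for which representable functors are sheaves. A
  finitely presented functor \<open>F\<close> lies in \<open>mod\<^sub>a\<^sub>d\<^sub>m(\<E>)\<close> if and only if there is a map \<open>F \<rightarrow> \<Upsilon>(Z)\<close> with
  locally effaceable kernel and cokernel, that is, if its sheafification is representable; over an
  idempotent complete \<open>\<E>\<close> every presentation of \<open>F\<close> is then by an admissible morphism, because \<open>g\<close> is a
  deflation whenever \<open>g f\<close> is. Closure under summands, kernels and extensions becomes closure of
  representable sheaves under split idempotents, kernels of deflations and pushouts of conflations.
\<close>

section \<open>Additive and exact categories\<close>

text \<open>Membership in \<open>mod_adm E\<close> only asserts that some presentation is
  admissible, and a summand, a kernel or an extension arrives with a presentation about which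
  nothing is known. The criterion \<open>locally_iso\<close> mentions no presentation, and this is
  what makes the closure properties accessible. The category of sheaves is never formed: a functor
  is compared with one representable functor, exactness arguments become choices of sections over
  deflations, and equations found there are carried back by cancelling deflations, which are epic.
  The second constraint is size. \<open>\<Upsilon> E Z\<close> takes values in \<open>'m\<close>,
  whereas the objects of \<open>Mod_cat E\<close> take values in \<open>'u\<close>, so representable
  functors enter the category as copies, built as cokernels out of chosen coset representatives.
  Being resolving also asks for covers inside \<open>P2 E\<close>: the kernel of a cover must itself
  have a resolution of length two, and it does because the resolution of the covered functor,
  shifted by one step, begins with a monic arrow.\<close>

lemma Hom_iff: "f \<in> Hom C X Y \<longleftrightarrow> f \<in> Arr C \<and> Dom C f = X \<and> Cod C f = Y"
  by (auto simp: Hom_def)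

definition Sub :: "('o, 'm, 'z) cat_scheme \<Rightarrow> 'm \<Rightarrow> 'm \<Rightarrow> 'm" where
  "Sub C f g = Add C f (inv\<^bsub>hom_group C (Dom C f) (Cod C f)\<^esub> g)"

section \<open>Arithmetic of hom-groups\<close>

context preadditive_category
begin

lemma Hom_Ob:
  assumes "f \<in> Hom C X Y"
  shows "X \<in> Ob C" "Y \<in> Ob C"
  using assms Dom_Ob Cod_Ob by (auto simp: Hom_def)

lemma Zero_Hom: "X \<in> Ob C \<Longrightarrow> Y \<in> Ob C \<Longrightarrow> Zero C X Y \<in> Hom C X Y"
  using group.is_monoid[THEN monoid.one_closed] hom_group[unfolded comm_group_def]
  by (fastforce simp: hom_group_def)

lemma Add_Hom:
  assumes "f \<in> Hom C X Y" "g \<in> Hom C X Y"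
  shows "Add C f g \<in> Hom C X Y"
proof -
  interpret comm_group "hom_group C X Y" using hom_group Hom_Ob[OF assms(1)] by blast
  show ?thesis using m_closed assms by (simp add: hom_group_def)
qed

lemma Add_cancel:
  assumes "f \<in> Hom C X Y" "g \<in> Hom C X Y" "h \<in> Hom C X Y" "Add C f h = Add C g h"
  shows "f = g"
proof -
  interpret comm_group "hom_group C X Y" using hom_group Hom_Ob[OF assms(1)] by blast
  show ?thesis using right_cancel[of h f g] assms by (simp add: hom_group_def)
qed

lemma Add_Zero:
  assumes "f \<in> Hom C X Y"
  shows "Add C f (Zero C X Y) = f" "Add C (Zero C X Y) f = f"
proof -
  interpret comm_group "hom_group C X Y" using hom_group Hom_Ob[OF assms(1)] by blast
  show "Add C f (Zero C X Y) = f" "Add C (Zero C X Y) f = f"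
    using r_one[of f] l_one[of f] assms by (simp_all add: hom_group_def)
qed

lemma Add_commute:
  assumes "f \<in> Hom C X Y" "g \<in> Hom C X Y"
  shows "Add C f g = Add C g f"
proof -
  interpret comm_group "hom_group C X Y" using hom_group Hom_Ob[OF assms(1)] by blast
  show ?thesis using m_comm[of f g] assms by (simp add: hom_group_def)
qed

lemma Comp_Zero:
  assumes "g \<in> Hom C Y Z" "X \<in> Ob C"
  shows "g \<cdot> Zero C X Y = Zero C X Z"
proof -
  have Y: "Y \<in> Ob C" "Z \<in> Ob C" using Hom_Ob assms by auto
  let ?z = "Zero C X Y"
  have z: "?z \<in> Hom C X Y" using Zero_Hom assms Y by simp
  have gz: "g \<cdot> ?z \<in> Hom C X Z" using Comp_Hom z assms by simp
  have "Add C (g \<cdot> ?z) (g \<cdot> ?z) = Add C (Zero C X Z) (g \<cdot> ?z)"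
    using Comp_Add[OF z z assms(1)] Add_Zero[OF z] Add_Zero[OF gz] by simp
  then show ?thesis using Add_cancel gz Zero_Hom assms(2) Y by blast
qed

lemma Zero_Comp:
  assumes "f \<in> Hom C X Y" "Z \<in> Ob C"
  shows "Zero C Y Z \<cdot> f = Zero C X Z"
proof -
  have Y: "X \<in> Ob C" "Y \<in> Ob C" using Hom_Ob assms by auto
  let ?z = "Zero C Y Z"
  have z: "?z \<in> Hom C Y Z" using Zero_Hom assms Y by simp
  have gz: "?z \<cdot> f \<in> Hom C X Z" using Comp_Hom z assms by simp
  have "Add C (?z \<cdot> f) (?z \<cdot> f) = Add C (Zero C X Z) (?z \<cdot> f)"
    using Add_Comp[OF assms(1) z z] Add_Zero[OF z] Add_Zero[OF gz] by simp
  then show ?thesis using Add_cancel gz Zero_Hom assms(2) Y by blast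
qed

lemma Sub_props:
  assumes "f \<in> Hom C X Y" "g \<in> Hom C X Y"
  shows Sub_Hom: "Sub C f g \<in> Hom C X Y"
    and Sub_Add: "Add C (Sub C f g) g = f"
proof -
  interpret comm_group "hom_group C X Y" using hom_group Hom_Ob[OF assms(1)] by blast
  have s: "Sub C f g = f \<otimes>\<^bsub>hom_group C X Y\<^esub> inv\<^bsub>hom_group C X Y\<^esub> g"
    using assms by (simp add: Sub_def hom_group_def Hom_iff)
  have c: "f \<in> carrier (hom_group C X Y)" "g \<in> carrier (hom_group C X Y)"
    using assms by (simp_all add: hom_group_def)
  show "Sub C f g \<in> Hom C X Y"
    using c s m_closed[OF c(1) inv_closed[OF c(2)]] by (simp add: hom_group_def)
  have "Sub C f g \<otimes>\<^bsub>hom_group C X Y\<^esub> g = f"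
    using c by (simp add: s m_assoc)
  then show "Add C (Sub C f g) g = f" by (simp add: hom_group_def)
qed

lemma Sub_eq_Zero:
  assumes "f \<in> Hom C X Y" "g \<in> Hom C X Y"
  shows "Sub C f g = Zero C X Y \<longleftrightarrow> f = g"
proof
  assume "Sub C f g = Zero C X Y"
  then show "f = g" using Sub_Add[OF assms] Add_Zero(2)[OF assms(2)] by simp
next
  assume eq: "f = g"
  have "Add C (Sub C f g) g = Add C (Zero C X Y) g"
    using Sub_Add[OF assms] Add_Zero(2)[OF assms(2)] eq by simp
  then show "Sub C f g = Zero C X Y"
    using Add_cancel[OF Sub_Hom[OF assms] Zero_Hom assms(2)] Hom_Ob[OF assms(1)] by simp
qed

lemma Sub_self: "f \<in> Hom C X Y \<Longrightarrow> Sub C f f = Zero C X Y"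
  using Sub_eq_Zero by blast

lemma Sub_Zero:
  assumes "f \<in> Hom C X Y"
  shows "Sub C f (Zero C X Y) = f"
proof -
  have z: "Zero C X Y \<in> Hom C X Y" using Zero_Hom Hom_Ob assms by blast
  show ?thesis using Sub_Add[OF assms z] Add_Zero(1)[OF Sub_Hom[OF assms z]] by simp
qed

lemma Comp_Sub:
  assumes "f \<in> Hom C X Y" "f' \<in> Hom C X Y" "g \<in> Hom C Y Z"
  shows "g \<cdot> Sub C f f' = Sub C (g \<cdot> f) (g \<cdot> f')"
proof -
  have "Add C (g \<cdot> Sub C f f') (g \<cdot> f') = Add C (Sub C (g \<cdot> f) (g \<cdot> f')) (g \<cdot> f')"
    using Comp_Add[OF Sub_Hom assms(2,3), of f f'] Sub_Add Comp_Hom assms by metis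
  then show ?thesis using Add_cancel Comp_Hom Sub_Hom assms by metis
qed

lemma Sub_Comp:
  assumes "f \<in> Hom C X Y" "g \<in> Hom C Y Z" "g' \<in> Hom C Y Z"
  shows "Sub C g g' \<cdot> f = Sub C (g \<cdot> f) (g' \<cdot> f)"
proof -
  have "Add C (Sub C g g' \<cdot> f) (g' \<cdot> f) = Add C (Sub C (g \<cdot> f) (g' \<cdot> f)) (g' \<cdot> f)"
    using Add_Comp[OF assms(1) Sub_Hom assms(3), of g g'] Sub_Add Comp_Hom assms by metis
  then show ?thesis using Add_cancel Comp_Hom Sub_Hom assms by metis
qed

text \<open>Associativity is available only for arrows with matching endpoints, so an equation
  between composites cannot simply be rewritten inside a longer composite. The four rules from here
  on do the rebracketing and the replacement in one go.\<close>

lemma comp_left1: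
  assumes "f \<in> Hom C W X" "g \<in> Hom C X Y" "h \<in> Hom C Y Z" "h \<cdot> g = k"
  shows "h \<cdot> (g \<cdot> f) = k \<cdot> f"
  using Comp_assoc[OF assms(1-3)] assms(4) by simp

lemma comp_right1:
  assumes "f \<in> Hom C W X" "g \<in> Hom C X Y" "h \<in> Hom C Y Z" "g \<cdot> f = k"
  shows "(h \<cdot> g) \<cdot> f = h \<cdot> k"
  using Comp_assoc[OF assms(1-3)] assms(4) by simp

lemma comp_left:
  assumes "f \<in> Hom C W X" "g \<in> Hom C X Y" "h \<in> Hom C Y Z" "g' \<in> Hom C X Y'" "h' \<in> Hom C Y' Z"
    "h \<cdot> g = h' \<cdot> g'"
  shows "h \<cdot> (g \<cdot> f) = h' \<cdot> (g' \<cdot> f)"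
  using Comp_assoc[OF assms(1-3)] Comp_assoc[OF assms(1,4,5)] assms(6) by simp

lemma comp_right:
  assumes "f \<in> Hom C W X" "g \<in> Hom C X Y" "f' \<in> Hom C W X'" "g' \<in> Hom C X' Y" "h \<in> Hom C Y Z"
    "g \<cdot> f = g' \<cdot> f'"
  shows "(h \<cdot> g) \<cdot> f = (h \<cdot> g') \<cdot> f'"
  using Comp_assoc[OF assms(1,2,5)] Comp_assoc[OF assms(3,4,5)] assms(6) by simp

lemma isomorphismI:
  assumes "f \<in> Hom C X Y" "g \<in> Hom C Y X" "g \<cdot> f = Ident C X" "f \<cdot> g = Ident C Y"
  shows "isomorphism C X Y f"
  using assms by (auto simp: isomorphism_def)

lemma isomorphism_Ident: "X \<in> Ob C \<Longrightarrow> isomorphism C X X (Ident C X)"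
  using isomorphismI Ident_Hom Comp_Ident by metis

end

section \<open>Conflations, pullbacks and pushouts\<close>

definition conflation ::
    "('o, 'm, 'z) exact_cat_scheme \<Rightarrow> 'o \<Rightarrow> 'm \<Rightarrow> 'o \<Rightarrow> 'm \<Rightarrow> 'o \<Rightarrow> bool" where
  "conflation E K i A p B \<longleftrightarrow> (i, p) \<in> Conflations E \<and> i \<in> Hom E K A \<and> p \<in> Hom E A B"

context exact_category
begin

lemma conflation_of: "(i, p) \<in> Conflations E \<Longrightarrow> conflation E (Dom E i) i (Dom E p) p (Cod E p)"
  using kernel_cokernel_pair[of i p] by (auto simp: conflation_def is_kernel_def Hom_def)

lemma deflationE:
  assumes "deflation E p" "p \<in> Hom E A B"
  obtains K i where "conflation E K i A p B"
  using assms conflation_of by (fastforce simp: deflation_def Hom_def)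

lemma deflation_Arr: "deflation E p \<Longrightarrow> p \<in> Hom E (Dom E p) (Cod E p)"
  using conflation_of by (auto simp: deflation_def conflation_def)

lemma inflationE:
  assumes "inflation E i" "i \<in> Hom E K A"
  obtains B p where "conflation E K i A p B"
proof -
  obtain p where p: "(i, p) \<in> Conflations E" using assms by (auto simp: inflation_def)
  show ?thesis using that conflation_of[OF p] assms by (auto simp: conflation_def Hom_def)
qed

lemma inflation_Arr: "inflation E i \<Longrightarrow> i \<in> Hom E (Dom E i) (Cod E i)"
  using conflation_of by (fastforce simp: inflation_def conflation_def Hom_def)

lemma conflationD:
  assumes "conflation E K i A p B"
  shows "i \<in> Hom E K A" "p \<in> Hom E A B" "inflation E i" "deflation E p"
    "p \<cdot> i = Zero E K B"
  using assms kernel_cokernel_pair[of i p]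
  by (auto simp: conflation_def inflation_def deflation_def is_kernel_def Hom_def)

lemma conflation_kernel: "conflation E K i A p B \<Longrightarrow> is_kernel E i p"
  using kernel_cokernel_pair by (auto simp: conflation_def)

lemma is_kernel_lift:
  assumes "is_kernel E i p" "i \<in> Hom E K A" "p \<in> Hom E A B" "f \<in> Hom E W A" "p \<cdot> f = Zero E W B"
  shows "\<exists>!g. g \<in> Hom E W K \<and> i \<cdot> g = f"
proof -
  have e: "Dom E i = K" "Dom E p = A" "Cod E p = B" using assms by (auto simp: Hom_iff)
  show ?thesis
    using assms(1) Hom_Ob(1)[OF assms(4)] assms(4,5) unfolding is_kernel_def e by blast
qed

lemma is_cokernel_desc:
  assumes "is_cokernel E p i" "i \<in> Hom E K A" "p \<in> Hom E A B" "f \<in> Hom E A W" "f \<cdot> i = Zero E K W"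
  shows "\<exists>!g. g \<in> Hom E B W \<and> g \<cdot> p = f"
proof -
  have e: "Dom E i = K" "Cod E i = A" "Cod E p = B" using assms by (auto simp: Hom_iff)
  show ?thesis
    using assms(1) Hom_Ob(2)[OF assms(4)] assms(4,5) unfolding is_cokernel_def e by blast
qed

lemma conflation_lift:
  assumes "conflation E K i A p B" "f \<in> Hom E W A" "p \<cdot> f = Zero E W B"
  obtains g where "g \<in> Hom E W K" "i \<cdot> g = f"
proof -
  show ?thesis
    using is_kernel_lift[OF conflation_kernel conflationD(1,2) assms(2,3)] assms(1) that by blast
qed

text \<open>\<open>p\<close> kills \<open>i \<cdot> g\<close>, so the uniqueness clause of the
  kernel applies to this very arrow.\<close>

lemma is_kernel_mono:
  assumes "is_kernel E i p" "g \<in> Hom E W K" "h \<in> Hom E W K" "i \<in> Hom E K A" "i \<cdot> g = i \<cdot> h"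
  shows "g = h"
proof -
  have p: "p \<in> Hom E A (Cod E p)" "p \<cdot> i = Zero E K (Cod E p)"
    using assms by (auto simp: is_kernel_def Hom_def)
  have f: "i \<cdot> g \<in> Hom E W A" using Comp_Hom assms by metis
  have "p \<cdot> (i \<cdot> g) = Zero E W (Cod E p)"
    using Comp_assoc[OF assms(2,4) p(1)] p Zero_Comp assms(2) Hom_Ob by metis
  then have "\<exists>!k. k \<in> Hom E W K \<and> i \<cdot> k = i \<cdot> g"
    using is_kernel_lift[OF assms(1,4) p(1) f] by simp
  then show ?thesis using assms by metis
qed

lemma conflation_mono:
  assumes "conflation E K i A p B" "g \<in> Hom E W K" "h \<in> Hom E W K" "i \<cdot> g = i \<cdot> h"
  shows "g = h"
  using is_kernel_mono conflation_kernel conflationD(1) assms by metis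

lemma conflation_desc:
  assumes "conflation E K i A p B" "f \<in> Hom E A W" "f \<cdot> i = Zero E K W"
  obtains g where "g \<in> Hom E B W" "g \<cdot> p = f"
proof -
  have "is_cokernel E p i" using assms kernel_cokernel_pair by (auto simp: conflation_def)
  from is_cokernel_desc[OF this conflationD(1,2)[OF assms(1)] assms(2,3)]
  show ?thesis using that by blast
qed

lemma deflation_epi:
  assumes "deflation E p" "p \<in> Hom E A B" "g \<in> Hom E B W" "h \<in> Hom E B W" "g \<cdot> p = h \<cdot> p"
  shows "g = h"
proof -
  obtain K i where c: "conflation E K i A p B" using deflationE assms by metis
  note d = conflationD[OF c]
  have k: "is_cokernel E p i" using c kernel_cokernel_pair by (auto simp: conflation_def)
  have f: "g \<cdot> p \<in> Hom E A W" using Comp_Hom assms by metis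
  have "(g \<cdot> p) \<cdot> i = Zero E K W"
    using Comp_assoc[OF d(1) assms(2,3)] d(5) Comp_Zero assms(3) d(1) Hom_Ob by metis
  then have "\<exists>!k. k \<in> Hom E B W \<and> k \<cdot> p = g \<cdot> p"
    using is_cokernel_desc[OF k d(1,2) f] by simp
  then show ?thesis using assms by metis
qed

lemma inflation_mono:
  assumes "inflation E i" "i \<in> Hom E K A" "g \<in> Hom E W K" "h \<in> Hom E W K" "i \<cdot> g = i \<cdot> h"
  shows "g = h"
  using conflation_mono inflationE assms by metis

lemma deflation_comp:
  assumes "deflation E f" "deflation E g" "f \<in> Hom E A B" "g \<in> Hom E B D"
  shows "deflation E (g \<cdot> f)"
  using deflation_Comp assms by (simp add: Hom_iff)

text \<open>The unique factorization is split into existence and joint cancellation: existence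
  serves to lift along a deflation, cancellation to compare arrows into the pullback.\<close>

lemma pullback_deflation:
  assumes "deflation E p" "p \<in> Hom E A B" "g \<in> Hom E D B"
  obtains p' P g' where "deflation E p'" "p' \<in> Hom E P D" "g' \<in> Hom E P A" "p \<cdot> g' = g \<cdot> p'"
    "\<And>W a b. a \<in> Hom E W A \<Longrightarrow> b \<in> Hom E W D \<Longrightarrow> p \<cdot> a = g \<cdot> b \<Longrightarrow>
      \<exists>h \<in> Hom E W P. g' \<cdot> h = a \<and> p' \<cdot> h = b"
    "\<And>W h k. h \<in> Hom E W P \<Longrightarrow> k \<in> Hom E W P \<Longrightarrow> g' \<cdot> h = g' \<cdot> k \<Longrightarrow> p' \<cdot> h = p' \<cdot> k \<Longrightarrow> h = k"
proof -
  have "g \<in> Arr E" "Cod E p = Cod E g" using assms by (auto simp: Hom_iff)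
  then obtain p' g' where pb: "is_pullback E p g p' g'" and d: "deflation E p'"
    using deflation_pullback assms(1) by metis
  define P where "P = Dom E p'"
  have p': "p' \<in> Hom E P D" and g': "g' \<in> Hom E P A"
    using pb assms by (auto simp: is_pullback_def Hom_iff P_def)
  have sq: "p \<cdot> g' = g \<cdot> p'" using pb by (simp add: is_pullback_def)
  have e: "Dom E p = A" "Dom E g = D" using assms by (auto simp: Hom_iff)
  have u: "\<exists>!h. h \<in> Hom E W P \<and> g' \<cdot> h = a \<and> p' \<cdot> h = b"
    if "a \<in> Hom E W A" "b \<in> Hom E W D" "p \<cdot> a = g \<cdot> b" for W a b
    using pb that Hom_Ob(1)[OF that(1)] unfolding is_pullback_def P_def e by blast
  show ?thesis
  proof (rule that[OF d p' g' sq])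
    show "\<exists>h \<in> Hom E W P. g' \<cdot> h = a \<and> p' \<cdot> h = b"
      if "a \<in> Hom E W A" "b \<in> Hom E W D" "p \<cdot> a = g \<cdot> b" for W a b
      using u[OF that] by blast
    show "h = k" if h: "h \<in> Hom E W P" "k \<in> Hom E W P" "g' \<cdot> h = g' \<cdot> k" "p' \<cdot> h = p' \<cdot> k" for W h k
    proof -
      have "g' \<cdot> h \<in> Hom E W A" "p' \<cdot> h \<in> Hom E W D" using Comp_Hom h p' g' by metis+
      moreover have "p \<cdot> (g' \<cdot> h) = g \<cdot> (p' \<cdot> h)"
        by (rule comp_left[OF h(1) g' assms(2) p' assms(3) sq])
      ultimately show ?thesis using u h by metis
    qed
  qed
qed

lemma pushout_inflation:
  assumes "inflation E i" "i \<in> Hom E A B" "g \<in> Hom E A D"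
  obtains i' Q g' where "inflation E i'" "i' \<in> Hom E D Q" "g' \<in> Hom E B Q" "g' \<cdot> i = i' \<cdot> g"
    "\<And>W a b. a \<in> Hom E B W \<Longrightarrow> b \<in> Hom E D W \<Longrightarrow> a \<cdot> i = b \<cdot> g \<Longrightarrow>
      \<exists>h \<in> Hom E Q W. h \<cdot> g' = a \<and> h \<cdot> i' = b"
    "\<And>W h k. h \<in> Hom E Q W \<Longrightarrow> k \<in> Hom E Q W \<Longrightarrow> h \<cdot> g' = k \<cdot> g' \<Longrightarrow> h \<cdot> i' = k \<cdot> i' \<Longrightarrow> h = k"
proof -
  have "g \<in> Arr E" "Dom E i = Dom E g" using assms by (auto simp: Hom_iff)
  then obtain i' g' where pb: "is_pushout E i g i' g'" and d: "inflation E i'"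
    using inflation_pushout assms(1) by metis
  define Q where "Q = Cod E i'"
  have i': "i' \<in> Hom E D Q" and g': "g' \<in> Hom E B Q"
    using pb assms by (auto simp: is_pushout_def Hom_iff Q_def)
  have sq: "g' \<cdot> i = i' \<cdot> g" using pb by (simp add: is_pushout_def)
  have e: "Cod E i = B" "Cod E g = D" using assms by (auto simp: Hom_iff)
  have u: "\<exists>!h. h \<in> Hom E Q W \<and> h \<cdot> g' = a \<and> h \<cdot> i' = b"
    if "a \<in> Hom E B W" "b \<in> Hom E D W" "a \<cdot> i = b \<cdot> g" for W a b
    using pb that Hom_Ob(2)[OF that(1)] unfolding is_pushout_def Q_def e by blast
  show ?thesis
  proof (rule that[OF d i' g' sq])
    show "\<exists>h \<in> Hom E Q W. h \<cdot> g' = a \<and> h \<cdot> i' = b"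
      if "a \<in> Hom E B W" "b \<in> Hom E D W" "a \<cdot> i = b \<cdot> g" for W a b
      using u[OF that] by blast
    show "h = k" if h: "h \<in> Hom E Q W" "k \<in> Hom E Q W" "h \<cdot> g' = k \<cdot> g'" "h \<cdot> i' = k \<cdot> i'" for W h k
    proof -
      have "h \<cdot> g' \<in> Hom E B W" "h \<cdot> i' \<in> Hom E D W" using Comp_Hom h i' g' by metis+
      moreover have "(h \<cdot> g') \<cdot> i = (h \<cdot> i') \<cdot> g"
        by (rule comp_right[OF assms(2) g' assms(3) i' h(1) sq])
      ultimately show ?thesis using u h by metis
    qed
  qed
qed

text \<open>The pair \<open>(b \<cdot> i, p')\<close> is isomorphic to a conflation
  \<open>(i, p)\<close>, through \<open>b\<close> in the middle and identities at the ends.\<close>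

lemma deflation_iso:
  assumes "deflation E p" "p \<in> Hom E A B" "isomorphism E A A' b" "p' \<in> Hom E A' B" "p = p' \<cdot> b"
  shows "deflation E p'"
proof -
  obtain K i where c: "conflation E K i A p B" using deflationE assms by metis
  note d = conflationD[OF c]
  have b: "b \<in> Hom E A A'" using assms by (simp add: isomorphism_def)
  have K: "K \<in> Ob E" "B \<in> Ob E" using d Hom_Ob by auto
  have bi: "b \<cdot> i \<in> Hom E K A'" using Comp_Hom d b by metis
  have "isomorphism E (Dom E i) K (Ident E K)" "isomorphism E (Cod E i) A' b"
    "isomorphism E (Cod E p) B (Ident E B)"
    using d isomorphism_Ident K assms by (auto simp: Hom_iff)
  moreover have "b \<cdot> i = (b \<cdot> i) \<cdot> Ident E K" "Ident E B \<cdot> p = p' \<cdot> b"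
    using Comp_Ident[OF bi] Ident_Comp[OF assms(2)] assms(5) by simp_all
  moreover have "(i, p) \<in> Conflations E" using c by (simp add: conflation_def)
  ultimately have "(b \<cdot> i, p') \<in> Conflations E"
    using Conflations_iso[OF _ bi assms(4)] by blast
  then show ?thesis by (auto simp: deflation_def)
qed

lemma inflation_iso:
  assumes "inflation E i" "i \<in> Hom E K A" "isomorphism E A A' b" "i' \<in> Hom E K A'" "i' = b \<cdot> i"
  shows "inflation E i'"
proof -
  obtain B p where c: "conflation E K i A p B" using inflationE assms by metis
  note d = conflationD[OF c]
  obtain b' where b: "b \<in> Hom E A A'" and b': "b' \<in> Hom E A' A" "b' \<cdot> b = Ident E A"
    using assms by (auto simp: isomorphism_def)
  have K: "K \<in> Ob E" "B \<in> Ob E" using d Hom_Ob by auto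
  have pb: "p \<cdot> b' \<in> Hom E A' B" using Comp_Hom d b' by metis
  have "isomorphism E (Dom E i) K (Ident E K)" "isomorphism E (Cod E i) A' b"
    "isomorphism E (Cod E p) B (Ident E B)"
    using d isomorphism_Ident K assms by (auto simp: Hom_iff)
  moreover have "b \<cdot> i = i' \<cdot> Ident E K" "Ident E B \<cdot> p = (p \<cdot> b') \<cdot> b"
    using Comp_Ident[OF assms(4)] Ident_Comp[OF d(2)] assms(5)
      comp_right1[OF b b'(1) d(2) b'(2)] Comp_Ident[OF d(2)] by simp_all
  moreover have "(i, p) \<in> Conflations E" using c by (simp add: conflation_def)
  ultimately have "(i', p \<cdot> b') \<in> Conflations E"
    using Conflations_iso[OF _ assms(4) pb] by blast
  then show ?thesis by (auto simp: inflation_def)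
qed

text \<open>Some cokernel \<open>p0\<close> completes the inflation to a conflation, any other
  cokernel differs from it by an isomorphism, and conflations are closed under isomorphism. Thus a
  cokernel verified by hand is a deflation.\<close>

lemma conflationI_cokernel:
  assumes "inflation E i" "i \<in> Hom E K A" "p \<in> Hom E A B" "p \<cdot> i = Zero E K B"
    and desc: "\<And>W f. f \<in> Hom E A W \<Longrightarrow> f \<cdot> i = Zero E K W \<Longrightarrow> \<exists>g \<in> Hom E B W. g \<cdot> p = f"
    and epi: "\<And>W g h. g \<in> Hom E B W \<Longrightarrow> h \<in> Hom E B W \<Longrightarrow> g \<cdot> p = h \<cdot> p \<Longrightarrow> g = h"
  shows "conflation E K i A p B"
proof -
  obtain B0 p0 where c: "conflation E K i A p0 B0" using inflationE assms by metis
  note d = conflationD[OF c]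
  have K: "K \<in> Ob E" "A \<in> Ob E" "B \<in> Ob E" "B0 \<in> Ob E" using d assms Hom_Ob by auto
  obtain u where u: "u \<in> Hom E B0 B" "u \<cdot> p0 = p" using conflation_desc[OF c assms(3,4)] .
  obtain v where v: "v \<in> Hom E B B0" "v \<cdot> p = p0" using desc[OF d(2,5)] by blast
  have "(u \<cdot> v) \<cdot> p = Ident E B \<cdot> p" "(v \<cdot> u) \<cdot> p0 = Ident E B0 \<cdot> p0"
    using comp_right1[OF assms(3) v(1) u(1) v(2)] comp_right1[OF d(2) u(1) v(1) u(2)]
      Ident_Comp[OF assms(3)] Ident_Comp[OF d(2)] u(2) v(2) by simp_all
  then have "u \<cdot> v = Ident E B" "v \<cdot> u = Ident E B0"
    using epi deflation_epi[OF d(4,2)] Comp_Hom[OF v(1) u(1)] Comp_Hom[OF u(1) v(1)]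
      Ident_Hom K by blast+
  then have "isomorphism E (Cod E p0) B u"
    using isomorphismI u v d(2) by (auto simp: Hom_iff)
  moreover have "isomorphism E (Dom E i) K (Ident E K)" "isomorphism E (Cod E i) A (Ident E A)"
    using isomorphism_Ident K d(1) by (auto simp: Hom_iff)
  moreover have "Ident E A \<cdot> i = i \<cdot> Ident E K" "u \<cdot> p0 = p \<cdot> Ident E A"
    using Comp_Ident[OF d(1)] Ident_Comp[OF d(1)] Comp_Ident[OF assms(3)] u(2) by simp_all
  moreover have "(i, p0) \<in> Conflations E" using c by (simp add: conflation_def)
  ultimately have "(i, p) \<in> Conflations E"
    using Conflations_iso[OF _ assms(2,3)] by blast
  then show ?thesis using assms by (simp add: conflation_def)
qed

section \<open>Zero objects, split epimorphisms and cancellation of deflations\<close>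

text \<open>The axioms speak of identities only. The cokernel \<open>c\<close> of the inflation
  \<open>Ident E X\<close> equals \<open>c \<cdot> Ident E X\<close>, which is zero; being epic and
  zero, it ends in a zero object.\<close>

lemma deflation_to_zero:
  assumes "X \<in> Ob E"
  obtains Z where "deflation E (Zero E X Z)" "Z \<in> Ob E" "Ident E Z = Zero E Z Z"
proof -
  obtain Z c where c: "conflation E X (Ident E X) X c Z"
    using inflationE inflation_Ident Ident_Hom assms by metis
  note d = conflationD[OF c]
  have Z: "Z \<in> Ob E" using d Hom_Ob by auto
  have c0: "c = Zero E X Z" using d Comp_Ident by metis
  have "Ident E Z \<cdot> c = Zero E Z Z \<cdot> c"
    using c0 Comp_Zero Ident_Hom Zero_Hom assms Z by metis
  then have "Ident E Z = Zero E Z Z"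
    using deflation_epi[OF d(4,2)] Ident_Hom Zero_Hom Z by blast
  then show ?thesis using that d(4) Z c0 by blast
qed

lemma inflation_from_zero:
  assumes "X \<in> Ob E"
  obtains Z where "inflation E (Zero E Z X)" "Z \<in> Ob E" "Ident E Z = Zero E Z Z"
proof -
  obtain Z c where c: "conflation E Z c X (Ident E X) X"
    using deflationE deflation_Ident Ident_Hom assms by metis
  note d = conflationD[OF c]
  have Z: "Z \<in> Ob E" using d Hom_Ob by auto
  have c0: "c = Zero E Z X" using d Ident_Comp by metis
  have "c \<cdot> Ident E Z = c \<cdot> Zero E Z Z"
    using c0 Zero_Comp Ident_Hom Zero_Hom assms Z by metis
  then have "Ident E Z = Zero E Z Z"
    using conflation_mono[OF c] Ident_Hom Zero_Hom Z by blast
  then show ?thesis using that d(3) Z c0 by blast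
qed

lemma zero_Hom_unique:
  assumes "Ident E Z = Zero E Z Z" "f \<in> Hom E W Z"
  shows "f = Zero E W Z"
  using assms Ident_Comp Zero_Comp Hom_Ob by metis

text \<open>The complementary idempotent \<open>1 - s \<cdot> p\<close> splits through an object
  \<open>K\<close>, so that \<open>P\<close> is the sum of \<open>K\<close> and \<open>A\<close>
  with \<open>p\<close> as a projection. A projection from a product is the pullback of a deflation
  from \<open>K\<close> to a zero object, hence a deflation.\<close>

lemma split_epi_deflation:
  assumes "idempotent_complete E" "p \<in> Hom E P A" "s \<in> Hom E A P" "p \<cdot> s = Ident E A"
  shows "deflation E p"
proof -
  have Ob: "P \<in> Ob E" "A \<in> Ob E" using assms Hom_Ob by auto
  have sp: "s \<cdot> p \<in> Hom E P P" using Comp_Hom assms by metis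
  note idP = Ident_Hom[OF Ob(1)]
  define e where "e = Sub E (Ident E P) (s \<cdot> p)"
  have e: "e \<in> Hom E P P" using e_def Sub_Hom sp idP by simp
  have eI: "Add E e (s \<cdot> p) = Ident E P" using Sub_Add[OF idP sp] e_def by simp
  have psp: "p \<cdot> (s \<cdot> p) = p" "(s \<cdot> p) \<cdot> s = s"
    using comp_left1[OF assms(2,3,2,4)] comp_right1[OF assms(3,2,3,4)]
      Ident_Comp[OF assms(2)] Comp_Ident[OF assms(3)] by simp_all
  have pe: "p \<cdot> e = Zero E P A"
    using Comp_Sub[OF idP sp assms(2)] Comp_Ident assms(2) psp Sub_self e_def by metis
  have es: "e \<cdot> s = Zero E A P"
    using Sub_Comp[OF assms(3) idP sp] Ident_Comp assms(3) psp Sub_self e_def by metis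
  have "e \<cdot> e = Sub E (Ident E P \<cdot> e) ((s \<cdot> p) \<cdot> e)" using Sub_Comp[OF e idP sp] e_def by simp
  also have "(s \<cdot> p) \<cdot> e = Zero E P P"
    using comp_right1[OF e assms(2,3) pe] Comp_Zero[OF assms(3) Ob(1)] by simp
  finally have "e \<cdot> e = e" using Sub_Zero Ident_Comp e by metis
  then obtain K r t where K: "K \<in> Ob E" and r: "r \<in> Hom E P K" and t: "t \<in> Hom E K P"
    and tr: "t \<cdot> r = e" and rt: "r \<cdot> t = Ident E K"
    using assms(1) Ob e unfolding idempotent_complete_def by metis
  have rtr: "r \<cdot> e = r" "e \<cdot> t = t"
    using comp_left1[OF r t r rt] comp_right1[OF t r t rt] Ident_Comp[OF r] Comp_Ident[OF t] tr
    by simp_all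
  have rs: "r \<cdot> s = Zero E A K"
    using comp_right1[OF assms(3) e r es] Comp_Zero[OF r Ob(2)] rtr by simp
  have pt: "p \<cdot> t = Zero E K A"
    using comp_left1[OF t e assms(2) pe] Zero_Comp[OF t Ob(2)] rtr by simp
  obtain Z where z: "deflation E (Zero E K Z)" "Z \<in> Ob E" "Ident E Z = Zero E Z Z"
    using deflation_to_zero K .
  \<comment> \<open>Over a zero object the pullback \<open>Q\<close> is the product of
    \<open>K\<close> and \<open>A\<close>, with projections \<open>g'\<close> and \<open>p'\<close>;
    the arrows \<open>h\<close> and \<open>k\<close> below identify it with
    \<open>P\<close>.\<close>
  obtain Q p' g' where Q: "deflation E p'" "p' \<in> Hom E Q A" "g' \<in> Hom E Q K"
    and "Zero E K Z \<cdot> g' = Zero E A Z \<cdot> p'"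
    and QE: "\<And>W a b. a \<in> Hom E W K \<Longrightarrow> b \<in> Hom E W A \<Longrightarrow> Zero E K Z \<cdot> a = Zero E A Z \<cdot> b \<Longrightarrow>
      \<exists>h \<in> Hom E W Q. g' \<cdot> h = a \<and> p' \<cdot> h = b"
    and QU: "\<And>W h k. h \<in> Hom E W Q \<Longrightarrow> k \<in> Hom E W Q \<Longrightarrow> g' \<cdot> h = g' \<cdot> k \<Longrightarrow> p' \<cdot> h = p' \<cdot> k \<Longrightarrow> h = k"
    by (rule pullback_deflation[OF z(1) Zero_Hom[OF K z(2)] Zero_Hom[OF Ob(2) z(2)]]) (rule that)
  have Qo: "Q \<in> Ob E" using Q Hom_Ob by auto
  obtain h where h: "h \<in> Hom E P Q" "g' \<cdot> h = r" "p' \<cdot> h = p"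
    using QE[OF r assms(2)] Zero_Comp r assms(2) z(2) by metis
  have tg: "t \<cdot> g' \<in> Hom E Q P" and sp': "s \<cdot> p' \<in> Hom E Q P" using Comp_Hom Q t assms by metis+
  define k where "k = Add E (t \<cdot> g') (s \<cdot> p')"
  have k: "k \<in> Hom E Q P" using Add_Hom tg sp' k_def by simp
  have rtg: "r \<cdot> (t \<cdot> g') = g'" using comp_left1[OF Q(3) t r rt] Ident_Comp[OF Q(3)] by simp
  have rsp: "r \<cdot> (s \<cdot> p') = Zero E Q K"
    using comp_left1[OF Q(2) assms(3) r rs] Zero_Comp[OF Q(2) K] by simp
  have "r \<cdot> k = g'" using Comp_Add[OF tg sp' r] rtg rsp Add_Zero Q k_def by metis
  moreover have ptg: "p \<cdot> (t \<cdot> g') = Zero E Q A"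
    using comp_left1[OF Q(3) t assms(2) pt] Zero_Comp[OF Q(3) Ob(2)] by simp
  have psp': "p \<cdot> (s \<cdot> p') = p'"
    using comp_left1[OF Q(2) assms(3,2,4)] Ident_Comp[OF Q(2)] by simp
  have pk: "p \<cdot> k = p'" using Comp_Add[OF tg sp' assms(2)] ptg psp' Add_Zero Q k_def by metis
  ultimately have "g' \<cdot> (h \<cdot> k) = g' \<cdot> Ident E Q" "p' \<cdot> (h \<cdot> k) = p' \<cdot> Ident E Q"
    using comp_left1[OF k h(1) Q(3) h(2)] comp_left1[OF k h(1) Q(2) h(3)]
      Comp_Ident[OF Q(2)] Comp_Ident[OF Q(3)] by simp_all
  then have hk: "h \<cdot> k = Ident E Q" using QU[of "h \<cdot> k" Q "Ident E Q"] Comp_Hom k h Ident_Hom Qo by metis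
  have "k \<cdot> h = Add E ((t \<cdot> g') \<cdot> h) ((s \<cdot> p') \<cdot> h)" using Add_Comp[OF h(1) tg sp'] k_def by simp
  also have "(t \<cdot> g') \<cdot> h = e" using comp_right1[OF h(1) Q(3) t h(2)] tr by simp
  also have "(s \<cdot> p') \<cdot> h = s \<cdot> p" using comp_right1[OF h(1) Q(2) assms(3) h(3)] by simp
  finally have kh: "k \<cdot> h = Ident E P" using eI by simp
  show ?thesis using deflation_iso[OF Q(1,2) isomorphismI[OF k h(1) hk kh] assms(2)] pk by simp
qed

text \<open>
  In the pullback of the deflation \<open>g f\<close> along \<open>g\<close>, the projection to \<open>A\<close> is split by \<open>(1, f)\<close>, hence a
  deflation; so \<open>g p\<close> is a deflation, where \<open>p\<close> is the projection to \<open>B\<close>. The kernel \<open>k\<close> of \<open>g\<close> is an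
  inflation because it is a pushout of the kernel of \<open>g p\<close>.
\<close>

lemma deflation_cancel:
  assumes ic: "idempotent_complete E"
    and f: "f \<in> Hom E A B" and g: "g \<in> Hom E B D" and gf: "deflation E (g \<cdot> f)"
  shows "deflation E g"
proof -
  have Ob: "A \<in> Ob E" "B \<in> Ob E" "D \<in> Ob E" using Hom_Ob f g by auto
  have gfH: "g \<cdot> f \<in> Hom E A D" using Comp_Hom f g by blast
  obtain p P a where p: "deflation E p" "p \<in> Hom E P B" and a: "a \<in> Hom E P A"
    and sq: "(g \<cdot> f) \<cdot> a = g \<cdot> p"
    and ex: "\<And>W x y. x \<in> Hom E W A \<Longrightarrow> y \<in> Hom E W B \<Longrightarrow> (g \<cdot> f) \<cdot> x = g \<cdot> y \<Longrightarrow>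
      \<exists>h \<in> Hom E W P. a \<cdot> h = x \<and> p \<cdot> h = y"
    and uniq: "\<And>W h k. h \<in> Hom E W P \<Longrightarrow> k \<in> Hom E W P \<Longrightarrow> a \<cdot> h = a \<cdot> k \<Longrightarrow> p \<cdot> h = p \<cdot> k \<Longrightarrow> h = k"
    by (rule pullback_deflation[OF gf gfH g]) (rule that)
  obtain s where s: "s \<in> Hom E A P" "a \<cdot> s = Ident E A"
    using ex[OF Ident_Hom[OF Ob(1)] f] Comp_Ident[OF gfH] by blast
  have da: "deflation E a" by (rule split_epi_deflation[OF ic a s])
  have h: "deflation E (g \<cdot> p)" using deflation_comp[OF da gf a gfH] sq by simp
  have hH: "g \<cdot> p \<in> Hom E P D" using Comp_Hom p g by blast
  obtain N n where N: "conflation E N n P (g \<cdot> p) D" using deflationE[OF h hH] .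
  note n = conflationD[OF N]
  obtain K t where K: "conflation E K t P a A" using deflationE[OF da a] .
  note t = conflationD[OF K]
  have KO: "K \<in> Ob E" "N \<in> Ob E" using t n Hom_Ob by auto
  \<comment> \<open>Parallel sides of a pullback square have the same kernel: \<open>p\<close>
    carries the kernel \<open>t\<close> of \<open>a\<close> to a kernel of \<open>g\<close>, which
    \<open>k_lift\<close> and \<open>k_mono\<close> confirm.\<close>
  define k where "k = p \<cdot> t"
  have k: "k \<in> Hom E K B" using Comp_Hom t p k_def by metis
  have gk: "g \<cdot> k = Zero E K D"
    using comp_left[OF t(1) p(2) g a gfH sq[symmetric]] t(5) Comp_Zero[OF gfH KO(1)] k_def by simp
  have k_lift: "\<exists>y \<in> Hom E W K. k \<cdot> y = x" if x: "x \<in> Hom E W B" "g \<cdot> x = Zero E W D" for W x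
  proof -
    have W: "W \<in> Ob E" using Hom_Ob x by auto
    obtain z where z: "z \<in> Hom E W P" "a \<cdot> z = Zero E W A" "p \<cdot> z = x"
      using ex[OF Zero_Hom[OF W Ob(1)] x(1)] Comp_Zero[OF gfH W] x(2) by auto
    obtain y where "y \<in> Hom E W K" "t \<cdot> y = z" using conflation_lift[OF K z(1,2)] .
    then show ?thesis using comp_right1[OF _ t(1) p(2)] z(3) k_def by metis
  qed
  have k_mono: "y = y'" if y: "y \<in> Hom E W K" "y' \<in> Hom E W K" "k \<cdot> y = k \<cdot> y'" for W y y'
  proof -
    have "p \<cdot> (t \<cdot> y) = p \<cdot> (t \<cdot> y')"
      using Comp_assoc[OF y(1) t(1) p(2)] Comp_assoc[OF y(2) t(1) p(2)] y(3) k_def by simp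
    moreover have "a \<cdot> (t \<cdot> y) = a \<cdot> (t \<cdot> y')"
      using comp_left1[OF y(1) t(1) a t(5)] comp_left1[OF y(2) t(1) a t(5)]
        Zero_Comp[OF y(1) Ob(1)] Zero_Comp[OF y(2) Ob(1)] by simp
    ultimately have "t \<cdot> y = t \<cdot> y'" using uniq Comp_Hom[OF y(1) t(1)] Comp_Hom[OF y(2) t(1)] by blast
    then show ?thesis using conflation_mono[OF K y(1,2)] by simp
  qed
  have pn: "p \<cdot> n \<in> Hom E N B" using Comp_Hom n p by metis
  have "g \<cdot> (p \<cdot> n) = Zero E N D" using Comp_assoc[OF n(1) p(2) g] n(5) by simp
  then obtain n' where n': "n' \<in> Hom E N K" "k \<cdot> n' = p \<cdot> n" using k_lift[OF pn] by blast
  \<comment> \<open>\<open>n'\<close> is not known to be a deflation, but the pullback of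
    \<open>p\<close> along \<open>k\<close> is one and factors through \<open>n'\<close>, so
    \<open>n'\<close> can be cancelled on the right.\<close>
  have n'_epi: "x = y" if xy: "x \<in> Hom E K W" "y \<in> Hom E K W" "x \<cdot> n' = y \<cdot> n'" for W x y
  proof -
    obtain p'' R r where p'': "deflation E p''" "p'' \<in> Hom E R K" and r: "r \<in> Hom E R P"
      and sqr: "p \<cdot> r = k \<cdot> p''"
      using pullback_deflation[OF p k] by metis
    have "(g \<cdot> p) \<cdot> r = Zero E R D"
      using comp_right[OF r p(2) p''(2) k g sqr] gk Zero_Comp[OF p''(2) Ob(3)] by simp
    then obtain z where z: "z \<in> Hom E R N" "n \<cdot> z = r" using conflation_lift[OF N r] by blast
    have "k \<cdot> (n' \<cdot> z) = k \<cdot> p''"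
      using comp_left[OF z(1) n'(1) k n(1) p(2) n'(2)] z sqr by simp
    then have "n' \<cdot> z = p''" using k_mono[OF Comp_Hom[OF z(1) n'(1)] p''(2)] by simp
    then have "x \<cdot> p'' = y \<cdot> p''"
      using Comp_assoc[OF z(1) n'(1)] xy by metis
    then show ?thesis using deflation_epi[OF p'' xy(1,2)] by simp
  qed
  obtain i Q b where i: "inflation E i" "i \<in> Hom E K Q" and b: "b \<in> Hom E P Q"
    and sqb: "b \<cdot> n = i \<cdot> n'"
    and pex: "\<And>W x y. x \<in> Hom E P W \<Longrightarrow> y \<in> Hom E K W \<Longrightarrow> x \<cdot> n = y \<cdot> n' \<Longrightarrow>
      \<exists>h \<in> Hom E Q W. h \<cdot> b = x \<and> h \<cdot> i = y"
    and pun: "\<And>W h k. h \<in> Hom E Q W \<Longrightarrow> k \<in> Hom E Q W \<Longrightarrow> h \<cdot> b = k \<cdot> b \<Longrightarrow> h \<cdot> i = k \<cdot> i \<Longrightarrow> h = k"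
    by (rule pushout_inflation[OF n(3,1) n'(1)]) (rule that)
  have QO: "Q \<in> Ob E" using i Hom_Ob by auto
  obtain u where u: "u \<in> Hom E Q B" "u \<cdot> b = p" "u \<cdot> i = k" using pex[OF p(2) k n'(2)[symmetric]] by blast
  \<comment> \<open>The inverse of \<open>u\<close> is obtained by descent along \<open>p\<close>:
    the kernel \<open>n2\<close> of \<open>p\<close> factors through \<open>n\<close> by an arrow
    that \<open>n'\<close> kills, hence \<open>b\<close> kills \<open>n2\<close>.\<close>
  obtain N2 n2 where N2: "conflation E N2 n2 P p B" using deflationE[OF p] .
  note n2 = conflationD[OF N2]
  have N2O: "N2 \<in> Ob E" using n2 Hom_Ob by auto
  have "(g \<cdot> p) \<cdot> n2 = Zero E N2 D" using comp_right1[OF n2(1) p(2) g n2(5)] Comp_Zero[OF g N2O] by simp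
  then obtain l where l: "l \<in> Hom E N2 N" "n \<cdot> l = n2" using conflation_lift[OF N n2(1)] by blast
  have n'l: "n' \<cdot> l \<in> Hom E N2 K" using Comp_Hom l n' by metis
  have "k \<cdot> (n' \<cdot> l) = k \<cdot> Zero E N2 K"
    using comp_left[OF l(1) n'(1) k n(1) p(2) n'(2)] l n2(5) Comp_Zero[OF k N2O] by simp
  then have n'l0: "n' \<cdot> l = Zero E N2 K" using k_mono[OF n'l Zero_Hom[OF N2O KO(1)]] by simp
  have "b \<cdot> n2 = Zero E N2 Q"
    using comp_left[OF l(1) n(1) b n'(1) i(2) sqb] l n'l0 Comp_Zero[OF i(2) N2O] by simp
  then obtain v where v: "v \<in> Hom E B Q" "v \<cdot> p = b" using conflation_desc[OF N2 b] by blast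
  have "(u \<cdot> v) \<cdot> p = Ident E B \<cdot> p"
    using comp_right1[OF p(2) v(1) u(1) v(2)] u(2) Ident_Comp[OF p(2)] by simp
  then have uv: "u \<cdot> v = Ident E B"
    using deflation_epi[OF p Comp_Hom[OF v(1) u(1)] Ident_Hom[OF Ob(2)]] by simp
  have vk: "v \<cdot> k \<in> Hom E K Q" using Comp_Hom v k by metis
  have "(v \<cdot> k) \<cdot> n' = i \<cdot> n'"
    using comp_right[OF n'(1) k n(1) p(2) v(1) n'(2)] v(2) sqb by simp
  then have vk: "v \<cdot> k = i" using n'_epi[OF vk i(2)] by simp
  have "(v \<cdot> u) \<cdot> b = Ident E Q \<cdot> b" "(v \<cdot> u) \<cdot> i = Ident E Q \<cdot> i"
    using comp_right1[OF b u(1) v(1) u(2)] comp_right1[OF i(2) u(1) v(1) u(3)] v(2) vk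
      Ident_Comp[OF b] Ident_Comp[OF i(2)] by simp_all
  then have vu: "v \<cdot> u = Ident E Q" using pun[OF Comp_Hom[OF u(1) v(1)] Ident_Hom[OF QO]] by simp
  have kinf: "inflation E k"
    by (rule inflation_iso[OF i isomorphismI[OF u(1) v(1) vu uv] k u(3)[symmetric]])
  have "conflation E K k B g D"
  proof (rule conflationI_cokernel[OF kinf k g gk])
    \<comment> \<open>The cokernel property of \<open>g\<close> is inherited from
      \<open>g \<cdot> p\<close> by cancelling the deflation \<open>p\<close>.\<close>
    fix W x assume x: "x \<in> Hom E B W" "x \<cdot> k = Zero E K W"
    have W: "W \<in> Ob E" using x Hom_Ob by auto
    have xp: "x \<cdot> p \<in> Hom E P W" using Comp_Hom x p by metis
    have "(x \<cdot> p) \<cdot> n = Zero E N W"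
      using comp_right[OF n(1) p(2) n'(1) k x(1) n'(2)[symmetric]] x(2) Zero_Comp[OF n'(1) W] by simp
    then obtain y where y: "y \<in> Hom E D W" "y \<cdot> (g \<cdot> p) = x \<cdot> p" using conflation_desc[OF N xp] by blast
    have "(y \<cdot> g) \<cdot> p = x \<cdot> p" using Comp_assoc[OF p(2) g y(1)] y(2) by simp
    then have "y \<cdot> g = x" using deflation_epi[OF p Comp_Hom[OF g y(1)] x(1)] by simp
    then show "\<exists>y \<in> Hom E D W. y \<cdot> g = x" using y(1) by blast
  next
    fix W x y assume xy: "x \<in> Hom E D W" "y \<in> Hom E D W" "x \<cdot> g = y \<cdot> g"
    have "x \<cdot> (g \<cdot> p) = y \<cdot> (g \<cdot> p)"
      using Comp_assoc[OF p(2) g xy(1)] Comp_assoc[OF p(2) g xy(2)] xy(3) by simp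
    then show "x = y" using deflation_epi[OF h hH xy(1,2)] by simp
  qed
  then show ?thesis using conflationD by blast
qed

text \<open>Functoriality of extensions in the subobject: pushing out an inflation does not change
  its cokernel. An arrow from \<open>M\<close> that kills \<open>k\<close> is determined by its
  composite with \<open>y\<close>, which kills \<open>m\<close> and so factors through
  \<open>q\<close>.\<close>

lemma conflation_pushforward:
  assumes c: "conflation E I m Y q Z" and u: "u \<in> Hom E I K"
  obtains M k d y where "conflation E K k M d Z" "y \<in> Hom E Y M" "y \<cdot> m = k \<cdot> u" "d \<cdot> y = q"
proof -
  note m = conflationD[OF c]
  obtain k M y where k: "inflation E k" "k \<in> Hom E K M" and y: "y \<in> Hom E Y M"
    and sq: "y \<cdot> m = k \<cdot> u"
    and pex: "\<And>W a b. a \<in> Hom E Y W \<Longrightarrow> b \<in> Hom E K W \<Longrightarrow> a \<cdot> m = b \<cdot> u \<Longrightarrow>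
      \<exists>h \<in> Hom E M W. h \<cdot> y = a \<and> h \<cdot> k = b"
    and pun: "\<And>W g h. g \<in> Hom E M W \<Longrightarrow> h \<in> Hom E M W \<Longrightarrow> g \<cdot> y = h \<cdot> y \<Longrightarrow> g \<cdot> k = h \<cdot> k \<Longrightarrow> g = h"
    by (rule pushout_inflation[OF m(3,1) u]) (rule that)
  have Ob: "K \<in> Ob E" "Z \<in> Ob E" using k m Hom_Ob by auto
  obtain d where d: "d \<in> Hom E M Z" "d \<cdot> y = q" "d \<cdot> k = Zero E K Z"
    using pex[OF m(2) Zero_Hom[OF Ob]] m(5) Zero_Comp[OF u Ob(2)] by auto
  have "conflation E K k M d Z"
  proof (rule conflationI_cokernel[OF k d(1,3)])
    fix W x assume x: "x \<in> Hom E M W" "x \<cdot> k = Zero E K W"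
    have W: "W \<in> Ob E" using x Hom_Ob by auto
    have "(x \<cdot> y) \<cdot> m = Zero E I W"
      using comp_right[OF m(1) y u k(2) x(1) sq] x(2) Zero_Comp[OF u W] by simp
    then obtain z where z: "z \<in> Hom E Z W" "z \<cdot> q = x \<cdot> y"
      using conflation_desc[OF c Comp_Hom[OF y x(1)]] by blast
    have "(z \<cdot> d) \<cdot> y = x \<cdot> y" "(z \<cdot> d) \<cdot> k = x \<cdot> k"
      using comp_right1[OF y d(1) z(1) d(2)] comp_right1[OF k(2) d(1) z(1) d(3)] z(2) x(2)
        Comp_Zero[OF z(1) Ob(1)] by simp_all
    then have "z \<cdot> d = x" using pun[OF Comp_Hom[OF d(1) z(1)] x(1)] by simp
    then show "\<exists>z \<in> Hom E Z W. z \<cdot> d = x" using z(1) by blast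
  next
    fix W g h assume gh: "g \<in> Hom E Z W" "h \<in> Hom E Z W" "g \<cdot> d = h \<cdot> d"
    have "g \<cdot> q = h \<cdot> q"
      using comp_right1[OF y d(1) gh(1) d(2)] comp_right1[OF y d(1) gh(2) d(2)] gh(3) by simp
    then show "g = h" using deflation_epi[OF m(4,2) gh(1,2)] by simp
  qed
  then show ?thesis using that y sq d(2) by blast
qed

end

section \<open>Additive functors\<close>

lemma Yo_simps [simp]:
  "carrier (FOb (\<Upsilon> C X) W) = Hom C W X"
  "x \<otimes>\<^bsub>FOb (\<Upsilon> C X) W\<^esub> y = Add C x y"
  "\<one>\<^bsub>FOb (\<Upsilon> C X) W\<^esub> = Zero C W X"
  "FArr (\<Upsilon> C X) f g = g \<cdot>\<^bsub>C\<^esub> f"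
  by (simp_all add: Yo_def hom_group_def)

context preadditive_category
begin

lemma functor_props:
  assumes "F \<in> additive_functors C"
  shows functor_group: "X \<in> Ob C \<Longrightarrow> comm_group (FOb F X)"
    and functor_closed: "f \<in> Hom C X Y \<Longrightarrow> x \<in> carrier (FOb F Y) \<Longrightarrow> FArr F f x \<in> carrier (FOb F X)"
    and functor_mult: "f \<in> Hom C X Y \<Longrightarrow> x \<in> carrier (FOb F Y) \<Longrightarrow> y \<in> carrier (FOb F Y) \<Longrightarrow>
      FArr F f (x \<otimes>\<^bsub>FOb F Y\<^esub> y) = FArr F f x \<otimes>\<^bsub>FOb F X\<^esub> FArr F f y"
    and functor_Ident: "X \<in> Ob C \<Longrightarrow> x \<in> carrier (FOb F X) \<Longrightarrow> FArr F (Ident C X) x = x"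
    and functor_Comp: "f \<in> Hom C X Y \<Longrightarrow> g \<in> Hom C Y Z \<Longrightarrow> x \<in> carrier (FOb F Z) \<Longrightarrow>
      FArr F (g \<cdot> f) x = FArr F f (FArr F g x)"
    and functor_Add: "f \<in> Hom C X Y \<Longrightarrow> g \<in> Hom C X Y \<Longrightarrow> x \<in> carrier (FOb F Y) \<Longrightarrow>
      FArr F (Add C f g) x = FArr F f x \<otimes>\<^bsub>FOb F X\<^esub> FArr F g x"
proof -
  show "X \<in> Ob C \<Longrightarrow> comm_group (FOb F X)" using assms by (simp add: additive_functors_def)
  have h: "FArr F f \<in> hom (FOb F Y) (FOb F X)" if "f \<in> Hom C X Y"
    using assms that Hom_Ob[OF that] by (simp add: additive_functors_def)
  show "f \<in> Hom C X Y \<Longrightarrow> x \<in> carrier (FOb F Y) \<Longrightarrow> FArr F f x \<in> carrier (FOb F X)"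
    using h hom_in_carrier by metis
  show "f \<in> Hom C X Y \<Longrightarrow> x \<in> carrier (FOb F Y) \<Longrightarrow> y \<in> carrier (FOb F Y) \<Longrightarrow>
      FArr F f (x \<otimes>\<^bsub>FOb F Y\<^esub> y) = FArr F f x \<otimes>\<^bsub>FOb F X\<^esub> FArr F f y"
    by (rule hom_mult[OF h])
  show "X \<in> Ob C \<Longrightarrow> x \<in> carrier (FOb F X) \<Longrightarrow> FArr F (Ident C X) x = x"
    using assms by (simp add: additive_functors_def)
  show "f \<in> Hom C X Y \<Longrightarrow> g \<in> Hom C Y Z \<Longrightarrow> x \<in> carrier (FOb F Z) \<Longrightarrow>
      FArr F (g \<cdot> f) x = FArr F f (FArr F g x)"
    using assms Hom_Ob[of f X Y] Hom_Ob[of g Y Z] by (simp add: additive_functors_def)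
  show "f \<in> Hom C X Y \<Longrightarrow> g \<in> Hom C X Y \<Longrightarrow> x \<in> carrier (FOb F Y) \<Longrightarrow>
      FArr F (Add C f g) x = FArr F f x \<otimes>\<^bsub>FOb F X\<^esub> FArr F g x"
    using assms Hom_Ob[of f X Y] by (simp add: additive_functors_def)
qed

lemma functor_one:
  assumes "F \<in> additive_functors C" "f \<in> Hom C X Y"
  shows "FArr F f \<one>\<^bsub>FOb F Y\<^esub> = \<one>\<^bsub>FOb F X\<^esub>"
proof -
  have "FArr F f \<in> hom (FOb F Y) (FOb F X)"
    using assms Hom_Ob[OF assms(2)] by (simp add: additive_functors_def)
  then show ?thesis
    by (rule hom_one)
      (use functor_group[OF assms(1)] Hom_Ob[OF assms(2)] in \<open>auto simp: comm_group_def\<close>)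
qed

lemma functor_one_closed:
  assumes "F \<in> additive_functors C" "X \<in> Ob C"
  shows "\<one>\<^bsub>FOb F X\<^esub> \<in> carrier (FOb F X)"
  using functor_group[OF assms] by (simp add: comm_group_def group.is_monoid)

lemma functor_mult_closed:
  assumes "F \<in> additive_functors C" "X \<in> Ob C" "x \<in> carrier (FOb F X)" "y \<in> carrier (FOb F X)"
  shows "x \<otimes>\<^bsub>FOb F X\<^esub> y \<in> carrier (FOb F X)"
  using functor_group[OF assms(1,2)] assms(3,4) by (simp add: comm_group_def group.is_monoid monoid.m_closed)

lemma functor_diff:
  assumes "F \<in> additive_functors C" "X \<in> Ob C" "x \<in> carrier (FOb F X)" "y \<in> carrier (FOb F X)"
  obtains z where "z \<in> carrier (FOb F X)" "z \<otimes>\<^bsub>FOb F X\<^esub> y = x" "y \<otimes>\<^bsub>FOb F X\<^esub> z = x"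
proof -
  interpret comm_group "FOb F X" using functor_group assms by blast
  have "(x \<otimes>\<^bsub>FOb F X\<^esub> inv\<^bsub>FOb F X\<^esub> y) \<otimes>\<^bsub>FOb F X\<^esub> y = x" using assms by (simp add: m_assoc)
  then show ?thesis
    using that[of "x \<otimes>\<^bsub>FOb F X\<^esub> inv\<^bsub>FOb F X\<^esub> y"] assms m_comm[of y "x \<otimes>\<^bsub>FOb F X\<^esub> inv\<^bsub>FOb F X\<^esub> y"]
    by simp
qed

lemma functor_cancel:
  assumes "F \<in> additive_functors C" "X \<in> Ob C" "x \<in> carrier (FOb F X)" "y \<in> carrier (FOb F X)"
    "z \<in> carrier (FOb F X)" "x \<otimes>\<^bsub>FOb F X\<^esub> z = y \<otimes>\<^bsub>FOb F X\<^esub> z"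
  shows "x = y"
proof -
  interpret comm_group "FOb F X" using functor_group assms by blast
  show ?thesis using assms by simp
qed

lemma functor_l_one:
  assumes "F \<in> additive_functors C" "X \<in> Ob C" "x \<in> carrier (FOb F X)"
  shows "\<one>\<^bsub>FOb F X\<^esub> \<otimes>\<^bsub>FOb F X\<^esub> x = x" "x \<otimes>\<^bsub>FOb F X\<^esub> \<one>\<^bsub>FOb F X\<^esub> = x"
proof -
  interpret comm_group "FOb F X" using functor_group assms by blast
  show "\<one>\<^bsub>FOb F X\<^esub> \<otimes>\<^bsub>FOb F X\<^esub> x = x" "x \<otimes>\<^bsub>FOb F X\<^esub> \<one>\<^bsub>FOb F X\<^esub> = x" using assms by simp_all
qed

lemma functor_mult_ac:
  assumes "F \<in> additive_functors C" "X \<in> Ob C"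
    "x \<in> carrier (FOb F X)" "y \<in> carrier (FOb F X)" "z \<in> carrier (FOb F X)"
  shows "(x \<otimes>\<^bsub>FOb F X\<^esub> y) \<otimes>\<^bsub>FOb F X\<^esub> z = x \<otimes>\<^bsub>FOb F X\<^esub> (y \<otimes>\<^bsub>FOb F X\<^esub> z)"
    "x \<otimes>\<^bsub>FOb F X\<^esub> y = y \<otimes>\<^bsub>FOb F X\<^esub> x"
proof -
  interpret comm_group "FOb F X" using functor_group assms by blast
  show "(x \<otimes>\<^bsub>FOb F X\<^esub> y) \<otimes>\<^bsub>FOb F X\<^esub> z = x \<otimes>\<^bsub>FOb F X\<^esub> (y \<otimes>\<^bsub>FOb F X\<^esub> z)"
    "x \<otimes>\<^bsub>FOb F X\<^esub> y = y \<otimes>\<^bsub>FOb F X\<^esub> x"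
    using assms by (auto simp only: m_assoc intro: m_comm)
qed

lemma functor_interchange:
  assumes "F \<in> additive_functors C" "X \<in> Ob C"
    "x \<in> carrier (FOb F X)" "y \<in> carrier (FOb F X)" "z \<in> carrier (FOb F X)" "w \<in> carrier (FOb F X)"
  shows "(x \<otimes>\<^bsub>FOb F X\<^esub> y) \<otimes>\<^bsub>FOb F X\<^esub> (z \<otimes>\<^bsub>FOb F X\<^esub> w) =
    (x \<otimes>\<^bsub>FOb F X\<^esub> z) \<otimes>\<^bsub>FOb F X\<^esub> (y \<otimes>\<^bsub>FOb F X\<^esub> w)"
proof -
  interpret comm_group "FOb F X" using functor_group assms by blast
  show ?thesis using assms by (simp add: m_assoc m_lcomm)
qed

lemma natural_props:
  assumes "natural C F G \<tau>"
  shows natural_closed: "X \<in> Ob C \<Longrightarrow> x \<in> carrier (FOb F X) \<Longrightarrow> \<tau> X x \<in> carrier (FOb G X)"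
    and natural_mult: "X \<in> Ob C \<Longrightarrow> x \<in> carrier (FOb F X) \<Longrightarrow> y \<in> carrier (FOb F X) \<Longrightarrow>
      \<tau> X (x \<otimes>\<^bsub>FOb F X\<^esub> y) = \<tau> X x \<otimes>\<^bsub>FOb G X\<^esub> \<tau> X y"
    and natural_arr: "f \<in> Hom C X Y \<Longrightarrow> x \<in> carrier (FOb F Y) \<Longrightarrow>
      \<tau> X (FArr F f x) = FArr G f (\<tau> Y x)"
proof -
  show "X \<in> Ob C \<Longrightarrow> x \<in> carrier (FOb F X) \<Longrightarrow> \<tau> X x \<in> carrier (FOb G X)"
    using assms hom_in_carrier unfolding natural_def by metis
  show "X \<in> Ob C \<Longrightarrow> x \<in> carrier (FOb F X) \<Longrightarrow> y \<in> carrier (FOb F X) \<Longrightarrow>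
      \<tau> X (x \<otimes>\<^bsub>FOb F X\<^esub> y) = \<tau> X x \<otimes>\<^bsub>FOb G X\<^esub> \<tau> X y"
    by (rule hom_mult) (use assms in \<open>auto simp: natural_def\<close>)
  show "f \<in> Hom C X Y \<Longrightarrow> x \<in> carrier (FOb F Y) \<Longrightarrow> \<tau> X (FArr F f x) = FArr G f (\<tau> Y x)"
    using assms Hom_Ob[of f X Y] unfolding natural_def by metis
qed

lemma naturalI:
  assumes "\<And>X x. X \<in> Ob C \<Longrightarrow> x \<in> carrier (FOb F X) \<Longrightarrow> \<tau> X x \<in> carrier (FOb G X)"
    and "\<And>X x y. X \<in> Ob C \<Longrightarrow> x \<in> carrier (FOb F X) \<Longrightarrow> y \<in> carrier (FOb F X) \<Longrightarrow>
      \<tau> X (x \<otimes>\<^bsub>FOb F X\<^esub> y) = \<tau> X x \<otimes>\<^bsub>FOb G X\<^esub> \<tau> X y"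
    and "\<And>X Y f x. f \<in> Hom C X Y \<Longrightarrow> x \<in> carrier (FOb F Y) \<Longrightarrow>
      \<tau> X (FArr F f x) = FArr G f (\<tau> Y x)"
  shows "natural C F G \<tau>"
  using assms unfolding natural_def hom_def by blast

lemma natural_one:
  assumes "natural C F G \<tau>" "F \<in> additive_functors C" "G \<in> additive_functors C" "X \<in> Ob C"
  shows "\<tau> X \<one>\<^bsub>FOb F X\<^esub> = \<one>\<^bsub>FOb G X\<^esub>"
  by (rule hom_one) (use assms functor_group in \<open>auto simp: comm_group_def natural_def\<close>)

lemma natural_comp:
  assumes "natural C F G \<sigma>" "natural C G H \<tau>"
  shows "natural C F H (\<lambda>X x. \<tau> X (\<sigma> X x))"
  by (rule naturalI)
    (simp_all add: natural_props[OF assms(1)] natural_props[OF assms(2)] Hom_Ob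
      natural_arr[OF assms(1)] natural_arr[OF assms(2)] natural_closed[OF assms(1) Hom_Ob(2)])

lemma natural_id: "natural C F F (\<lambda>X x. x)"
  by (rule naturalI) auto

lemma natural_inj:
  assumes "natural C F G \<tau>" "F \<in> additive_functors C" "G \<in> additive_functors C" "X \<in> Ob C"
    and ker: "\<And>x. x \<in> carrier (FOb F X) \<Longrightarrow> \<tau> X x = \<one>\<^bsub>FOb G X\<^esub> \<Longrightarrow> x = \<one>\<^bsub>FOb F X\<^esub>"
    and "x \<in> carrier (FOb F X)" "y \<in> carrier (FOb F X)" "\<tau> X x = \<tau> X y"
  shows "x = y"
proof -
  obtain z where z: "z \<in> carrier (FOb F X)" "z \<otimes>\<^bsub>FOb F X\<^esub> y = x" using functor_diff assms by metis
  have "\<tau> X z \<otimes>\<^bsub>FOb G X\<^esub> \<tau> X y = \<one>\<^bsub>FOb G X\<^esub> \<otimes>\<^bsub>FOb G X\<^esub> \<tau> X y"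
    using natural_mult[OF assms(1,4) z(1) assms(7)] z(2) assms(8)
      functor_l_one(1)[OF assms(3,4) natural_closed[OF assms(1,4,7)]] by simp
  then have "\<tau> X z = \<one>\<^bsub>FOb G X\<^esub>"
    using functor_cancel[OF assms(3,4)] natural_closed[OF assms(1,4)] z assms(7)
      functor_one_closed[OF assms(3,4)] by blast
  then have "z = \<one>\<^bsub>FOb F X\<^esub>" using ker z by blast
  then show ?thesis using z functor_l_one(1)[OF assms(2,4,7)] by simp
qed

lemma Yo_functor:
  assumes "X \<in> Ob C"
  shows "\<Upsilon> C X \<in> additive_functors C"
  unfolding additive_functors_def mem_Collect_eq
proof (intro conjI ballI)
  fix W assume W: "W \<in> Ob C"
  show "comm_group (FOb (\<Upsilon> C X) W)" using hom_group[OF W assms] by (simp add: Yo_def)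
  fix x assume "x \<in> carrier (FOb (\<Upsilon> C X) W)"
  then show "FArr (\<Upsilon> C X) (Ident C W) x = x" using Comp_Ident by simp
next
  fix V W f assume f: "f \<in> Hom C V W"
  show "FArr (\<Upsilon> C X) f \<in> hom (FOb (\<Upsilon> C X) W) (FOb (\<Upsilon> C X) V)"
    unfolding hom_def using f Comp_Hom Add_Comp by auto
next
  fix U V W f g x assume "f \<in> Hom C U V" "g \<in> Hom C V W" "x \<in> carrier (FOb (\<Upsilon> C X) W)"
  then show "FArr (\<Upsilon> C X) (g \<cdot> f) x = FArr (\<Upsilon> C X) f (FArr (\<Upsilon> C X) g x)"
    using Comp_assoc by simp
next
  fix U V f g x assume "f \<in> Hom C U V" "g \<in> Hom C U V" "x \<in> carrier (FOb (\<Upsilon> C X) V)"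
  then show "FArr (\<Upsilon> C X) (Add C f g) x = FArr (\<Upsilon> C X) f x \<otimes>\<^bsub>FOb (\<Upsilon> C X) U\<^esub> FArr (\<Upsilon> C X) g x"
    using Comp_Add by simp
qed

lemma natural_Yo_map:
  assumes "f \<in> Hom C X Y"
  shows "natural C (\<Upsilon> C X) (\<Upsilon> C Y) (Yo_map C f)"
  by (rule naturalI) (use assms Comp_Hom Comp_Add Comp_assoc in \<open>auto simp: Yo_map_def\<close>)

section \<open>The Yoneda lemma, natural transformations defined by choices, quotient
  functors\<close>

lemma yoneda:
  assumes "natural C (\<Upsilon> C X) F \<tau>" "f \<in> Hom C W X"
  shows "\<tau> W f = FArr F f (\<tau> X (Ident C X))"
  using natural_arr[OF assms(1,2), of "Ident C X"] Ident_Hom Hom_Ob[OF assms(2)] Ident_Comp assms(2)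
  by simp

lemma natural_of_element:
  assumes "F \<in> additive_functors C" "X \<in> Ob C" "x \<in> carrier (FOb F X)"
  shows "natural C (\<Upsilon> C X) F (\<lambda>W w. FArr F w x)"
  by (rule naturalI)
    (use assms functor_closed functor_Add functor_Comp in auto)


text \<open>A total additive relation is single-valued as soon as its fibre over the neutral element
  is trivial: two values at \<open>x\<close> become equal after adding a value at the inverse of
  \<open>x\<close>. This serves for maps prescribed on non-unique decompositions of a section, where
  well-definedness then has to be checked at the neutral element only.\<close>

lemma natural_of_rel:
  assumes F: "F \<in> additive_functors C" and G: "G \<in> additive_functors C"
    and total: "\<And>W x. W \<in> Ob C \<Longrightarrow> x \<in> carrier (FOb F W) \<Longrightarrow> \<exists>z. R W x z"
    and dom: "\<And>W x z. W \<in> Ob C \<Longrightarrow> R W x z \<Longrightarrow> x \<in> carrier (FOb F W) \<and> z \<in> carrier (FOb G W)"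
    and mult: "\<And>W x z x' z'. W \<in> Ob C \<Longrightarrow> R W x z \<Longrightarrow> R W x' z' \<Longrightarrow>
      R W (x \<otimes>\<^bsub>FOb F W\<^esub> x') (z \<otimes>\<^bsub>FOb G W\<^esub> z')"
    and arr: "\<And>V W f x z. f \<in> Hom C V W \<Longrightarrow> R W x z \<Longrightarrow> R V (FArr F f x) (FArr G f z)"
    and one: "\<And>W z. W \<in> Ob C \<Longrightarrow> R W \<one>\<^bsub>FOb F W\<^esub> z \<Longrightarrow> z = \<one>\<^bsub>FOb G W\<^esub>"
  obtains \<tau> where "natural C F G \<tau>" "\<And>W x z. W \<in> Ob C \<Longrightarrow> R W x z \<Longrightarrow> \<tau> W x = z"
proof -
  have uniq: "z = z'" if W: "W \<in> Ob C" and r: "R W x z" "R W x z'" for W x z z'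
  proof -
    interpret F: comm_group "FOb F W" using functor_group F W by blast
    interpret G: comm_group "FOb G W" using functor_group G W by blast
    have c: "x \<in> carrier (FOb F W)" "z \<in> carrier (FOb G W)" "z' \<in> carrier (FOb G W)"
      using dom W r by blast+
    obtain y where y: "R W (inv\<^bsub>FOb F W\<^esub> x) y" using total W c by blast
    then have yc: "y \<in> carrier (FOb G W)" using dom W by blast
    have "z \<otimes>\<^bsub>FOb G W\<^esub> y = \<one>\<^bsub>FOb G W\<^esub>" "z' \<otimes>\<^bsub>FOb G W\<^esub> y = \<one>\<^bsub>FOb G W\<^esub>"
      using one[OF W, of "z \<otimes>\<^bsub>FOb G W\<^esub> y"] one[OF W, of "z' \<otimes>\<^bsub>FOb G W\<^esub> y"]
        mult[OF W r(1) y] mult[OF W r(2) y] c(1) by simp_all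
    then show ?thesis using G.right_cancel[of y z z'] c yc by simp
  qed
  define \<tau> where "\<tau> W x = (SOME z. R W x z)" for W x
  have \<tau>: "\<tau> W x = z" if "W \<in> Ob C" "R W x z" for W x z
    using uniq[OF that(1) that(2)] someI[of "R W x" z] that unfolding \<tau>_def by metis
  have R\<tau>: "R W x (\<tau> W x)" if "W \<in> Ob C" "x \<in> carrier (FOb F W)" for W x
    using total[OF that] \<tau>[OF that(1)] by auto
  have "natural C F G \<tau>"
  proof (rule naturalI)
    fix X x y assume X: "X \<in> Ob C" "x \<in> carrier (FOb F X)" "y \<in> carrier (FOb F X)"
    show "\<tau> X x \<in> carrier (FOb G X)" using dom X R\<tau> by blast
    show "\<tau> X (x \<otimes>\<^bsub>FOb F X\<^esub> y) = \<tau> X x \<otimes>\<^bsub>FOb G X\<^esub> \<tau> X y"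
      using \<tau> mult X R\<tau> by blast
  next
    fix X Y f x assume f: "f \<in> Hom C X Y" "x \<in> carrier (FOb F Y)"
    show "\<tau> X (FArr F f x) = FArr G f (\<tau> Y x)"
      using \<tau> arr[OF f(1)] R\<tau> Hom_Ob[OF f(1)] f(2) by blast
  qed
  then show ?thesis using that \<tau> by blast
qed

text \<open>The universal property of a quotient, from the relation of all pairs of
  \<open>\<pi> a\<close> and \<open>\<rho> a\<close>. The three functors may take values in
  different types, so \<open>A\<close> can be representable while \<open>F\<close> and
  \<open>G\<close> live in \<open>Mod_cat C\<close>.\<close>

lemma natural_factor:
  assumes A: "A \<in> additive_functors C" and F: "F \<in> additive_functors C" and G: "G \<in> additive_functors C"
    and p: "natural C A F \<pi>" and r: "natural C A G \<rho>"
    and surj: "\<And>W x. W \<in> Ob C \<Longrightarrow> x \<in> carrier (FOb F W) \<Longrightarrow> \<exists>a \<in> carrier (FOb A W). \<pi> W a = x"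
    and ker: "\<And>W a. W \<in> Ob C \<Longrightarrow> a \<in> carrier (FOb A W) \<Longrightarrow> \<pi> W a = \<one>\<^bsub>FOb F W\<^esub> \<Longrightarrow> \<rho> W a = \<one>\<^bsub>FOb G W\<^esub>"
  obtains \<tau> where "natural C F G \<tau>"
    "\<And>W a. W \<in> Ob C \<Longrightarrow> a \<in> carrier (FOb A W) \<Longrightarrow> \<tau> W (\<pi> W a) = \<rho> W a"
proof -
  define R where "R W x z \<longleftrightarrow> (\<exists>a \<in> carrier (FOb A W). x = \<pi> W a \<and> z = \<rho> W a)" for W x z
  obtain \<tau> where t: "natural C F G \<tau>" "\<And>W x z. W \<in> Ob C \<Longrightarrow> R W x z \<Longrightarrow> \<tau> W x = z"
  proof (rule natural_of_rel[OF F G, of R])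
    show "\<exists>z. R W x z" if "W \<in> Ob C" "x \<in> carrier (FOb F W)" for W x
      using surj[OF that] R_def by metis
    show "x \<in> carrier (FOb F W) \<and> z \<in> carrier (FOb G W)" if "W \<in> Ob C" "R W x z" for W x z
      using that natural_closed[OF p] natural_closed[OF r] by (auto simp: R_def)
    show "R W (x \<otimes>\<^bsub>FOb F W\<^esub> x') (z \<otimes>\<^bsub>FOb G W\<^esub> z')"
      if W: "W \<in> Ob C" and R: "R W x z" "R W x' z'" for W x z x' z'
    proof -
      obtain a a' where a: "a \<in> carrier (FOb A W)" "a' \<in> carrier (FOb A W)"
        "x = \<pi> W a" "z = \<rho> W a" "x' = \<pi> W a'" "z' = \<rho> W a'"
        using R unfolding R_def by blast
      then show ?thesis
        using natural_mult[OF p W] natural_mult[OF r W] functor_mult_closed[OF A W]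
        unfolding R_def by metis
    qed
    show "R V (FArr F f x) (FArr G f z)" if f: "f \<in> Hom C V W" and R: "R W x z" for V W f x z
    proof -
      obtain a where a: "a \<in> carrier (FOb A W)" "x = \<pi> W a" "z = \<rho> W a" using R R_def by auto
      then show ?thesis
        using natural_arr[OF p f] natural_arr[OF r f] functor_closed[OF A f] unfolding R_def by metis
    qed
    show "z = \<one>\<^bsub>FOb G W\<^esub>" if "W \<in> Ob C" "R W \<one>\<^bsub>FOb F W\<^esub> z" for W z
      using that ker R_def by auto
  qed blast
  show ?thesis using that[OF t(1)] t(2) R_def by blast
qed

text \<open>\<open>r\<close> may both identify sections and change the type of values, so a quotient
  and its transport into \<open>'u\<close> are formed together. The hypotheses say that equality
  under \<open>r\<close> is a congruence.\<close>

lemma image_functor: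
  fixes r :: "'o \<Rightarrow> 'v \<Rightarrow> 'u"
  assumes G: "G \<in> additive_functors C"
    and cong: "\<And>W x x' y y'. W \<in> Ob C \<Longrightarrow> x \<in> carrier (FOb G W) \<Longrightarrow> x' \<in> carrier (FOb G W) \<Longrightarrow>
      y \<in> carrier (FOb G W) \<Longrightarrow> y' \<in> carrier (FOb G W) \<Longrightarrow> r W x = r W x' \<Longrightarrow> r W y = r W y' \<Longrightarrow>
      r W (x \<otimes>\<^bsub>FOb G W\<^esub> y) = r W (x' \<otimes>\<^bsub>FOb G W\<^esub> y')"
    and arr: "\<And>V W f x x'. f \<in> Hom C V W \<Longrightarrow> x \<in> carrier (FOb G W) \<Longrightarrow> x' \<in> carrier (FOb G W) \<Longrightarrow>
      r W x = r W x' \<Longrightarrow> r V (FArr G f x) = r V (FArr G f x')"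
  obtains H where "H \<in> additive_functors C" "natural C G H r"
    "\<And>W. carrier (FOb H W) = r W ` carrier (FOb G W)" "\<And>W. \<one>\<^bsub>FOb H W\<^esub> = r W \<one>\<^bsub>FOb G W\<^esub>"
proof -
  \<comment> \<open>A section of \<open>r\<close>: operations on images are computed on chosen
    preimages, and the congruence makes the choice irrelevant.\<close>
  define s where "s W = inv_into (carrier (FOb G W)) (r W)" for W
  define H :: "('o, 'm, 'u) presheaf" where "H = \<lparr>
      FOb = (\<lambda>W. \<lparr>carrier = r W ` carrier (FOb G W), mult = (\<lambda>a b. r W (s W a \<otimes>\<^bsub>FOb G W\<^esub> s W b)),
        one = r W \<one>\<^bsub>FOb G W\<^esub>\<rparr>),
      FArr = (\<lambda>f a. r (Dom C f) (FArr G f (s (Cod C f) a)))\<rparr>"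
  have s: "s W a \<in> carrier (FOb G W)" "r W (s W a) = a" if "a \<in> r W ` carrier (FOb G W)" for W a
    using that by (simp_all add: s_def inv_into_into f_inv_into_f)
  have car: "carrier (FOb H W) = r W ` carrier (FOb G W)" and one: "\<one>\<^bsub>FOb H W\<^esub> = r W \<one>\<^bsub>FOb G W\<^esub>" for W
    by (simp_all add: H_def)
  have mult: "r W x \<otimes>\<^bsub>FOb H W\<^esub> r W y = r W (x \<otimes>\<^bsub>FOb G W\<^esub> y)"
    if "W \<in> Ob C" "x \<in> carrier (FOb G W)" "y \<in> carrier (FOb G W)" for W x y
  proof -
    have "r W (s W (r W x) \<otimes>\<^bsub>FOb G W\<^esub> s W (r W y)) = r W (x \<otimes>\<^bsub>FOb G W\<^esub> y)"
      by (rule cong) (use that s in auto)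
    then show ?thesis by (simp add: H_def)
  qed
  have arrH: "FArr H f (r W x) = r V (FArr G f x)" if "f \<in> Hom C V W" "x \<in> carrier (FOb G W)" for V W f x
  proof -
    have "r V (FArr G f (s W (r W x))) = r V (FArr G f x)"
      by (rule arr[OF that(1)]) (use that s in auto)
    then show ?thesis using that by (simp add: H_def Hom_iff)
  qed
  have grp: "comm_group (FOb H W)" if W: "W \<in> Ob C" for W
  proof (rule comm_groupI)
    show "\<one>\<^bsub>FOb H W\<^esub> \<in> carrier (FOb H W)" using functor_one_closed[OF G W] by (simp add: car one)
  next
    fix a b assume "a \<in> carrier (FOb H W)" "b \<in> carrier (FOb H W)"
    then obtain x y where x: "x \<in> carrier (FOb G W)" "a = r W x" and y: "y \<in> carrier (FOb G W)" "b = r W y"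
      by (auto simp: car)
    show "a \<otimes>\<^bsub>FOb H W\<^esub> b \<in> carrier (FOb H W)"
      using x y mult[OF W] functor_mult_closed[OF G W] by (simp add: car)
    show "a \<otimes>\<^bsub>FOb H W\<^esub> b = b \<otimes>\<^bsub>FOb H W\<^esub> a"
      using x y mult[OF W] functor_mult_ac(2)[OF G W x(1) y(1)] by (simp add: y(1))
    fix c assume "c \<in> carrier (FOb H W)"
    then obtain z where z: "z \<in> carrier (FOb G W)" "c = r W z" by (auto simp: car)
    show "(a \<otimes>\<^bsub>FOb H W\<^esub> b) \<otimes>\<^bsub>FOb H W\<^esub> c = a \<otimes>\<^bsub>FOb H W\<^esub> (b \<otimes>\<^bsub>FOb H W\<^esub> c)"
      using x y z mult[OF W] functor_mult_ac(1)[OF G W x(1) y(1) z(1)] functor_mult_closed[OF G W]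
      by simp
  next
    fix a assume "a \<in> carrier (FOb H W)"
    then obtain x where x: "x \<in> carrier (FOb G W)" "a = r W x" by (auto simp: car)
    show "\<one>\<^bsub>FOb H W\<^esub> \<otimes>\<^bsub>FOb H W\<^esub> a = a"
      using x mult[OF W] functor_one_closed[OF G W] functor_l_one[OF G W] by (simp add: one)
    obtain y where y: "y \<in> carrier (FOb G W)" "y \<otimes>\<^bsub>FOb G W\<^esub> x = \<one>\<^bsub>FOb G W\<^esub>"
      using functor_diff[OF G W functor_one_closed[OF G W] x(1)] by metis
    then have "r W y \<otimes>\<^bsub>FOb H W\<^esub> a = \<one>\<^bsub>FOb H W\<^esub>" using x mult[OF W] by (simp add: one)
    then show "\<exists>b \<in> carrier (FOb H W). b \<otimes>\<^bsub>FOb H W\<^esub> a = \<one>\<^bsub>FOb H W\<^esub>" using y(1) by (auto simp: car)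
  qed
  have "H \<in> additive_functors C"
    unfolding additive_functors_def mem_Collect_eq
  proof (intro conjI ballI)
    show "comm_group (FOb H W)" if "W \<in> Ob C" for W using grp that .
    show "FArr H f \<in> hom (FOb H W) (FOb H V)" if "V \<in> Ob C" "W \<in> Ob C" "f \<in> Hom C V W" for V W f
      using that arrH mult functor_closed[OF G] functor_mult[OF G] functor_mult_closed[OF G]
      by (auto simp: hom_def car)
    show "FArr H (Ident C W) x = x" if "W \<in> Ob C" "x \<in> carrier (FOb H W)" for W x
      using that arrH[OF Ident_Hom] functor_Ident[OF G] by (auto simp: car)
    show "FArr H (g \<cdot> f) x = FArr H f (FArr H g x)"
      if "f \<in> Hom C U V" "g \<in> Hom C V W" "x \<in> carrier (FOb H W)" for U V W f g x
      using that arrH[OF Comp_Hom] arrH functor_Comp[OF G] functor_closed[OF G] by (auto simp: car)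
    show "FArr H (Add C f g) x = FArr H f x \<otimes>\<^bsub>FOb H V\<^esub> FArr H g x"
      if "V \<in> Ob C" "f \<in> Hom C V W" "g \<in> Hom C V W" "x \<in> carrier (FOb H W)" for V W f g x
      using that arrH[OF Add_Hom] arrH mult functor_Add[OF G] functor_closed[OF G] by (auto simp: car)
  qed
  moreover have "natural C G H r"
    by (rule naturalI) (simp_all add: car mult arrH)
  ultimately show ?thesis using that car one by blast
qed

section \<open>Presentations by representable functors\<close>

text \<open>Names the objects and the quotient map, which \<open>presented_by\<close> leaves
  implicit, and spells out exactness on sections.\<close>

definition presents :: "'m \<Rightarrow> 'o \<Rightarrow> 'o \<Rightarrow> ('o, 'm, 'u) presheaf \<Rightarrow> ('o \<Rightarrow> 'm \<Rightarrow> 'u) \<Rightarrow> bool" where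
  "presents g A B F \<pi> \<longleftrightarrow> g \<in> Hom C A B \<and> natural C (\<Upsilon> C B) F \<pi> \<and>
    (\<forall>W\<in>Ob C. \<forall>x\<in>carrier (FOb F W). \<exists>w\<in>Hom C W B. \<pi> W w = x) \<and>
    (\<forall>W. \<forall>w\<in>Hom C W B. \<pi> W w = \<one>\<^bsub>FOb F W\<^esub> \<longleftrightarrow> (\<exists>v\<in>Hom C W A. w = g \<cdot> v))"

lemma presents_iff:
  assumes g: "g \<in> Hom C A B"
  shows "presents g A B F \<pi> \<longleftrightarrow> natural C (\<Upsilon> C B) F \<pi> \<and>
    exact_at C (\<Upsilon> C A) (Yo_map C g) (\<Upsilon> C B) \<pi> F \<and> epic C (\<Upsilon> C B) \<pi> F"
proof (intro iffI conjI; (elim conjE)?)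
  assume p: "presents g A B F \<pi>"
  show n: "natural C (\<Upsilon> C B) F \<pi>" using p by (simp add: presents_def)
  show "exact_at C (\<Upsilon> C A) (Yo_map C g) (\<Upsilon> C B) \<pi> F"
    using p Comp_Hom[OF _ g] by (auto simp: presents_def exact_at_def kernel_def Yo_map_def)
  show "epic C (\<Upsilon> C B) \<pi> F"
    using p natural_closed[OF n] unfolding epic_def presents_def by (fastforce simp: image_iff)
next
  assume n: "natural C (\<Upsilon> C B) F \<pi>" and e: "exact_at C (\<Upsilon> C A) (Yo_map C g) (\<Upsilon> C B) \<pi> F"
    and s: "epic C (\<Upsilon> C B) \<pi> F"
  have "\<pi> W w = \<one>\<^bsub>FOb F W\<^esub> \<longleftrightarrow> (\<exists>v\<in>Hom C W A. w = g \<cdot> v)" if w: "w \<in> Hom C W B" for W w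
  proof -
    have "(\<lambda>v. g \<cdot> v) ` Hom C W A = {w \<in> Hom C W B. \<pi> W w = \<one>\<^bsub>FOb F W\<^esub>}"
      using e Hom_Ob[OF w] by (simp add: exact_at_def kernel_def Yo_map_def)
    then show ?thesis using w by blast
  qed
  moreover have "\<exists>w\<in>Hom C W B. \<pi> W w = x" if "W \<in> Ob C" "x \<in> carrier (FOb F W)" for W x
    using s that by (force simp: epic_def)
  ultimately show "presents g A B F \<pi>" using g n by (simp add: presents_def)
qed

lemma presented_by_iff: "g \<in> Hom C A B \<Longrightarrow> presented_by C g F \<longleftrightarrow> (\<exists>\<pi>. presents g A B F \<pi>)"
  by (auto simp: presented_by_def presents_iff Hom_iff)

lemma presentsD:
  assumes "presents g A B F \<pi>"
  shows "g \<in> Hom C A B" "natural C (\<Upsilon> C B) F \<pi>"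
    and "W \<in> Ob C \<Longrightarrow> x \<in> carrier (FOb F W) \<Longrightarrow> \<exists>w\<in>Hom C W B. \<pi> W w = x"
    and "w \<in> Hom C W B \<Longrightarrow> \<pi> W w = \<one>\<^bsub>FOb F W\<^esub> \<longleftrightarrow> (\<exists>v\<in>Hom C W A. w = g \<cdot> v)"
  using assms by (auto simp: presents_def)

text \<open>The cosets that make up the cokernel of \<open>Yo_map C g\<close> are sets of arrows,
  and only single hom-sets are known to embed into \<open>'u\<close>. Taking one arrow from each
  coset keeps the values inside a hom-set.\<close>

lemma exists_presented:
  assumes g: "g \<in> Hom C A B" and emb: "homs_embed_in C TYPE('u)"
  obtains H :: "('o, 'm, 'u) presheaf" and \<pi> where "H \<in> additive_functors C" "presents g A B H \<pi>"
proof -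
  have B: "B \<in> Ob C" "A \<in> Ob C" using g Hom_Ob by auto
  have "\<exists>\<iota> :: 'm \<Rightarrow> 'u. inj_on \<iota> (Hom C W B)" if "W \<in> Ob C" for W
    using emb that B by (simp add: homs_embed_in_def)
  then obtain \<iota> :: "'o \<Rightarrow> 'm \<Rightarrow> 'u" where \<iota>: "inj_on (\<iota> W) (Hom C W B)" if "W \<in> Ob C" for W
    by metis
  define eq where "eq W w w' \<longleftrightarrow> (\<exists>v\<in>Hom C W A. w' = Add C w (g \<cdot> v))" for W w w'
  have gH: "g \<cdot> v \<in> Hom C W B" if "v \<in> Hom C W A" for v W using Comp_Hom that g by blast
  have eqH: "w' \<in> Hom C W B" if "w \<in> Hom C W B" "eq W w w'" for W w w'
    using that gH Add_Hom unfolding eq_def by blast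
  have refl: "eq W w w" if w: "w \<in> Hom C W B" for W w
  proof -
    have "w = Add C w (g \<cdot> Zero C W A)" using Comp_Zero[OF g] Hom_Ob(1)[OF w] Add_Zero(1)[OF w] by simp
    then show ?thesis using Zero_Hom[OF Hom_Ob(1)[OF w] B(2)] unfolding eq_def by blast
  qed
  have add: "eq W (Add C w x) (Add C w' x')"
    if w: "w \<in> Hom C W B" "x \<in> Hom C W B" and e: "eq W w w'" "eq W x x'" for W w w' x x'
  proof -
    obtain v u where v: "v \<in> Hom C W A" "w' = Add C w (g \<cdot> v)" and u: "u \<in> Hom C W A" "x' = Add C x (g \<cdot> u)"
      using e unfolding eq_def by blast
    have "Add C w' x' = Add C (Add C w x) (g \<cdot> Add C v u)"
      using functor_interchange[OF Yo_functor[OF B(1)] Hom_Ob(1)[OF w(1)], of w "g \<cdot> v" x "g \<cdot> u"]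
        w gH v u Comp_Add[OF v(1) u(1) g] by simp
    then show ?thesis using Add_Hom v u unfolding eq_def by blast
  qed
  have arr: "eq V (w \<cdot> f) (w' \<cdot> f)" if f: "f \<in> Hom C V W" and w: "w \<in> Hom C W B" "eq W w w'" for V W f w w'
  proof -
    obtain v where v: "v \<in> Hom C W A" "w' = Add C w (g \<cdot> v)" using w unfolding eq_def by blast
    have "w' \<cdot> f = Add C (w \<cdot> f) (g \<cdot> (v \<cdot> f))"
      using v Add_Comp[OF f w(1) gH[OF v(1)]] Comp_assoc[OF f v(1) g] by simp
    then show ?thesis using Comp_Hom[OF f v(1)] unfolding eq_def by blast
  qed
  have sym: "eq W w' w" if w: "w \<in> Hom C W B" "eq W w w'" for W w w'
  proof -
    obtain v where v: "v \<in> Hom C W A" "w' = Add C w (g \<cdot> v)" using w unfolding eq_def by blast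
    have W: "W \<in> Ob C" using Hom_Ob w by auto
    obtain u where u: "u \<in> Hom C W A" "Add C v u = Zero C W A"
      using functor_diff[OF Yo_functor[OF B(2)] W, of "Zero C W A" v] v(1) Zero_Hom[OF W B(2)] by auto
    have "Add C w' (g \<cdot> u) = Add C w (Add C (g \<cdot> v) (g \<cdot> u))"
      using functor_mult_ac(1)[OF Yo_functor[OF B(1)] W, of w "g \<cdot> v" "g \<cdot> u"] w gH v u by simp
    also have "\<dots> = w" using Comp_Add[OF v(1) u(1) g] u(2) Comp_Zero[OF g W] Add_Zero(1)[OF w(1)] by simp
    finally show ?thesis using u(1) unfolding eq_def by metis
  qed
  have trans: "eq W w w''" if w: "w \<in> Hom C W B" "eq W w w'" "eq W w' w''" for W w w' w''
  proof -
    obtain v u where v: "v \<in> Hom C W A" "w' = Add C w (g \<cdot> v)" and u: "u \<in> Hom C W A" "w'' = Add C w' (g \<cdot> u)"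
      using w unfolding eq_def by blast
    have "w'' = Add C w (g \<cdot> Add C v u)"
      using functor_mult_ac(1)[OF Yo_functor[OF B(1)] Hom_Ob(1)[OF w(1)], of w "g \<cdot> v" "g \<cdot> u"]
        w gH v u Comp_Add[OF v(1) u(1) g] by simp
    then show ?thesis using Add_Hom v u unfolding eq_def by blast
  qed
  \<comment> \<open>The value at \<open>W\<close> consists of chosen coset representatives, embedded into \<open>'u\<close> by \<open>\<iota>\<close>.\<close>
  define r where "r W w = \<iota> W (SOME w'. eq W w w')" for W w
  have some: "eq W w (SOME w'. eq W w w')" if "w \<in> Hom C W B" for W w
    by (rule someI[of "eq W w" w]) (rule refl[OF that])
  have r: "r W w = r W w' \<longleftrightarrow> eq W w w'" if w: "w \<in> Hom C W B" "w' \<in> Hom C W B" for W w w'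
  proof
    have W: "W \<in> Ob C" using Hom_Ob w by auto
    assume "r W w = r W w'"
    then have "(SOME z. eq W w z) = (SOME z. eq W w' z)"
      using inj_onD[OF \<iota>[OF W]] eqH some w unfolding r_def by blast
    then show "eq W w w'" using some[OF w(1)] some[OF w(2)] sym trans w by metis
  next
    assume "eq W w w'"
    then have "eq W w = eq W w'" using sym trans w by blast
    then show "r W w = r W w'" by (simp add: r_def)
  qed
  obtain H where H: "H \<in> additive_functors C" "natural C (\<Upsilon> C B) H r"
    "\<And>W. carrier (FOb H W) = r W ` carrier (FOb (\<Upsilon> C B) W)" "\<And>W. \<one>\<^bsub>FOb H W\<^esub> = r W \<one>\<^bsub>FOb (\<Upsilon> C B) W\<^esub>"
  proof (rule image_functor[OF Yo_functor[OF B(1)], of r])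
    show "r W (x \<otimes>\<^bsub>FOb (\<Upsilon> C B) W\<^esub> y) = r W (x' \<otimes>\<^bsub>FOb (\<Upsilon> C B) W\<^esub> y')"
      if "x \<in> carrier (FOb (\<Upsilon> C B) W)" "x' \<in> carrier (FOb (\<Upsilon> C B) W)"
        "y \<in> carrier (FOb (\<Upsilon> C B) W)" "y' \<in> carrier (FOb (\<Upsilon> C B) W)"
        "r W x = r W x'" "r W y = r W y'" for W x x' y y'
      using that r add Add_Hom by simp
    show "r V (FArr (\<Upsilon> C B) f x) = r V (FArr (\<Upsilon> C B) f x')"
      if "f \<in> Hom C V W" "x \<in> carrier (FOb (\<Upsilon> C B) W)" "x' \<in> carrier (FOb (\<Upsilon> C B) W)"
        "r W x = r W x'" for V W f x x'
      using that r arr Comp_Hom by simp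
  qed blast
  have "presents g A B H r"
    unfolding presents_def
  proof (intro conjI ballI allI g H(2))
    show "\<exists>w\<in>Hom C W B. r W w = x" if "x \<in> carrier (FOb H W)" for W x
      using that H(3) by auto
    show "r W w = \<one>\<^bsub>FOb H W\<^esub> \<longleftrightarrow> (\<exists>v\<in>Hom C W A. w = g \<cdot> v)" if w: "w \<in> Hom C W B" for W w
    proof -
      have z: "Zero C W B \<in> Hom C W B" using Zero_Hom B Hom_Ob w by auto
      have "r W w = \<one>\<^bsub>FOb H W\<^esub> \<longleftrightarrow> eq W (Zero C W B) w"
        using H(4) r[OF z w] by auto
      then show ?thesis using Add_Zero(2)[OF gH] by (auto simp: eq_def)
    qed
  qed
  then show ?thesis using that H(1) by blast
qed

end

section \<open>Short exact sequences and objects with a resolution of length two\<close>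

definition kernel_functor ::
    "('o, 'm, 'u) presheaf \<Rightarrow> ('o, 'm, 'v) presheaf \<Rightarrow> ('o \<Rightarrow> 'u \<Rightarrow> 'v) \<Rightarrow> ('o, 'm, 'u) presheaf" where
  "kernel_functor G H \<tau> = \<lparr>FOb = (\<lambda>W. (FOb G W)\<lparr>carrier := kernel (FOb G W) (FOb H W) (\<tau> W)\<rparr>),
    FArr = FArr G\<rparr>"

lemma kernel_functor_simps [simp]:
  "carrier (FOb (kernel_functor G H \<tau>) W) = kernel (FOb G W) (FOb H W) (\<tau> W)"
  "x \<otimes>\<^bsub>FOb (kernel_functor G H \<tau>) W\<^esub> y = x \<otimes>\<^bsub>FOb G W\<^esub> y"
  "\<one>\<^bsub>FOb (kernel_functor G H \<tau>) W\<^esub> = \<one>\<^bsub>FOb G W\<^esub>"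
  "FArr (kernel_functor G H \<tau>) = FArr G"
  by (simp_all add: kernel_functor_def)

context preadditive_category
begin

lemma kernel_functor_closed:
  assumes t: "natural C G H \<tau>" and G: "G \<in> additive_functors C" and H: "H \<in> additive_functors C"
  shows "kernel_functor G H \<tau> \<in> additive_functors C"
  unfolding additive_functors_def mem_Collect_eq
proof (intro conjI ballI)
  fix W assume W: "W \<in> Ob C"
  note c = functor_mult_closed[OF G W] functor_one_closed[OF G W] functor_one_closed[OF H W]
    natural_mult[OF t W] natural_one[OF t G H W] functor_l_one[OF G W] functor_l_one[OF H W]
  show "comm_group (FOb (kernel_functor G H \<tau>) W)"
  proof (rule comm_groupI)
    fix x assume x: "x \<in> carrier (FOb (kernel_functor G H \<tau>) W)"
    then have xG: "x \<in> carrier (FOb G W)" by (simp add: kernel_def)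
    obtain y where y: "y \<in> carrier (FOb G W)" "y \<otimes>\<^bsub>FOb G W\<^esub> x = \<one>\<^bsub>FOb G W\<^esub>"
      using functor_diff[OF G W c(2) xG] by metis
    then have "\<tau> W y = \<one>\<^bsub>FOb H W\<^esub>"
      using natural_mult[OF t W y(1) xG] x natural_one[OF t G H W]
        functor_l_one(2)[OF H W natural_closed[OF t W y(1)]]
      by (simp add: kernel_def)
    then show "\<exists>y \<in> carrier (FOb (kernel_functor G H \<tau>) W).
        y \<otimes>\<^bsub>FOb (kernel_functor G H \<tau>) W\<^esub> x = \<one>\<^bsub>FOb (kernel_functor G H \<tau>) W\<^esub>"
      using y by (auto simp: kernel_def)
  qed (use c functor_mult_ac[OF G W] in \<open>auto simp: kernel_def\<close>)
next
  fix V W f assume f: "f \<in> Hom C V W"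
  show "FArr (kernel_functor G H \<tau>) f \<in> hom (FOb (kernel_functor G H \<tau>) W) (FOb (kernel_functor G H \<tau>) V)"
    using f functor_closed[OF G f] functor_mult[OF G f] natural_arr[OF t f] functor_one[OF H f]
    by (auto simp: hom_def kernel_def)
next
  fix W x assume "W \<in> Ob C" "x \<in> carrier (FOb (kernel_functor G H \<tau>) W)"
  then show "FArr (kernel_functor G H \<tau>) (Ident C W) x = x"
    using functor_Ident[OF G] by (simp add: kernel_def)
next
  fix U V W f g x assume "f \<in> Hom C U V" "g \<in> Hom C V W" "x \<in> carrier (FOb (kernel_functor G H \<tau>) W)"
  then show "FArr (kernel_functor G H \<tau>) (g \<cdot> f) x = FArr (kernel_functor G H \<tau>) f (FArr (kernel_functor G H \<tau>) g x)"
    using functor_Comp[OF G] by (simp add: kernel_def)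
next
  fix V W f g x assume "f \<in> Hom C V W" "g \<in> Hom C V W" "x \<in> carrier (FOb (kernel_functor G H \<tau>) W)"
  then show "FArr (kernel_functor G H \<tau>) (Add C f g) x =
      FArr (kernel_functor G H \<tau>) f x \<otimes>\<^bsub>FOb (kernel_functor G H \<tau>) V\<^esub> FArr (kernel_functor G H \<tau>) g x"
    using functor_Add[OF G] by (simp add: kernel_def)
qed

lemma natural_into_kernel:
  assumes "natural C F G \<sigma>" "\<And>W x. W \<in> Ob C \<Longrightarrow> x \<in> carrier (FOb F W) \<Longrightarrow> \<tau> W (\<sigma> W x) = \<one>\<^bsub>FOb H W\<^esub>"
  shows "natural C F (kernel_functor G H \<tau>) \<sigma>"
  by (rule naturalI)
    (use assms natural_closed[OF assms(1)] natural_mult[OF assms(1)] natural_arr[OF assms(1)]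
      in \<open>auto simp: kernel_def\<close>)

lemma natural_from_kernel: "natural C (kernel_functor G H \<tau>) G (\<lambda>W x. x)"
  by (rule naturalI) (auto simp: kernel_def)

section \<open>Conflations of functors\<close>

text \<open>The condition behind \<open>Conflations (Mod_cat C)\<close>, for families of maps
  instead of the extensional triples \<open>mor\<close>; all arguments on sections use this
  form.\<close>

definition short_exact ::
    "('o, 'm, 'u) presheaf \<Rightarrow> ('o \<Rightarrow> 'u \<Rightarrow> 'u) \<Rightarrow> ('o, 'm, 'u) presheaf \<Rightarrow> ('o \<Rightarrow> 'u \<Rightarrow> 'u) \<Rightarrow>
     ('o, 'm, 'u) presheaf \<Rightarrow> bool" where
  "short_exact F \<sigma> G \<tau> H \<longleftrightarrow> F \<in> additive_functors C \<and> G \<in> additive_functors C \<and> H \<in> additive_functors C \<and>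
    natural C F G \<sigma> \<and> natural C G H \<tau> \<and> monic C F \<sigma> \<and> exact_at C F \<sigma> G \<tau> H \<and> epic C G \<tau> H"

lemma short_exactD:
  assumes "short_exact F \<sigma> G \<tau> H"
  shows "F \<in> additive_functors C" "G \<in> additive_functors C" "H \<in> additive_functors C"
    and "natural C F G \<sigma>" "natural C G H \<tau>"
    and "W \<in> Ob C \<Longrightarrow> x \<in> carrier (FOb F W) \<Longrightarrow> y \<in> carrier (FOb F W) \<Longrightarrow> \<sigma> W x = \<sigma> W y \<Longrightarrow> x = y"
    and "W \<in> Ob C \<Longrightarrow> y \<in> carrier (FOb G W) \<Longrightarrow> \<tau> W y = \<one>\<^bsub>FOb H W\<^esub> \<Longrightarrow> \<exists>x\<in>carrier (FOb F W). y = \<sigma> W x"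
    and "W \<in> Ob C \<Longrightarrow> x \<in> carrier (FOb F W) \<Longrightarrow> \<tau> W (\<sigma> W x) = \<one>\<^bsub>FOb H W\<^esub>"
    and "W \<in> Ob C \<Longrightarrow> z \<in> carrier (FOb H W) \<Longrightarrow> \<exists>y\<in>carrier (FOb G W). \<tau> W y = z"
proof -
  note d = assms[unfolded short_exact_def]
  show "F \<in> additive_functors C" "G \<in> additive_functors C" "H \<in> additive_functors C"
    "natural C F G \<sigma>" "natural C G H \<tau>" using d by auto
  show "W \<in> Ob C \<Longrightarrow> x \<in> carrier (FOb F W) \<Longrightarrow> y \<in> carrier (FOb F W) \<Longrightarrow> \<sigma> W x = \<sigma> W y \<Longrightarrow> x = y"
    using d by (auto simp: monic_def dest: inj_onD)
  have e: "\<sigma> W ` carrier (FOb F W) = kernel (FOb G W) (FOb H W) (\<tau> W)" if "W \<in> Ob C"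
    using d that by (simp add: exact_at_def)
  then show "W \<in> Ob C \<Longrightarrow> y \<in> carrier (FOb G W) \<Longrightarrow> \<tau> W y = \<one>\<^bsub>FOb H W\<^esub> \<Longrightarrow> \<exists>x\<in>carrier (FOb F W). y = \<sigma> W x"
    "W \<in> Ob C \<Longrightarrow> x \<in> carrier (FOb F W) \<Longrightarrow> \<tau> W (\<sigma> W x) = \<one>\<^bsub>FOb H W\<^esub>"
    unfolding kernel_def by blast+
  show "W \<in> Ob C \<Longrightarrow> z \<in> carrier (FOb H W) \<Longrightarrow> \<exists>y\<in>carrier (FOb G W). \<tau> W y = z"
    using d unfolding epic_def by (metis imageE)
qed

lemma short_exact_kernel:
  assumes t: "natural C G H \<tau>" and G: "G \<in> additive_functors C" and H: "H \<in> additive_functors C"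
    and surj: "\<And>W z. W \<in> Ob C \<Longrightarrow> z \<in> carrier (FOb H W) \<Longrightarrow> \<exists>y\<in>carrier (FOb G W). \<tau> W y = z"
  shows "short_exact (kernel_functor G H \<tau>) (\<lambda>W x. x) G \<tau> H"
  unfolding short_exact_def
  using kernel_functor_closed[OF t G H] natural_from_kernel assms natural_closed[OF t]
  by (fastforce simp: monic_def exact_at_def epic_def)

lemma mor_simps [simp]:
  "Dom (Mod_cat C) (mor C F G \<tau>) = F" "Cod (Mod_cat C) (mor C F G \<tau>) = G"
  by (simp_all add: Mod_cat_def mor_def)

lemma Mod_conflationI: "short_exact F \<sigma> G \<tau> H \<Longrightarrow> (mor C F G \<sigma>, mor C G H \<tau>) \<in> Conflations (Mod_cat C)"
  unfolding short_exact_def Mod_cat_def by simp blast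

lemma Mod_conflationE:
  assumes "(i, p) \<in> Conflations (Mod_cat C)"
  obtains F \<sigma> G \<tau> H where "i = mor C F G \<sigma>" "p = mor C G H \<tau>" "short_exact F \<sigma> G \<tau> H"
  using assms unfolding short_exact_def Mod_cat_def by auto

lemma P2_simps [simp]:
  "Dom (P2 C) = Dom (Mod_cat C)" "Cod (P2 C) = Cod (Mod_cat C)" "Comp (P2 C) = Comp (Mod_cat C)"
  "Add (P2 C) = Add (Mod_cat C)" "Ident (P2 C) = Ident (Mod_cat C)" "Zero (P2 C) = Zero (Mod_cat C)"
  "Ob (P2 C) = P2_objects C"
  by (simp_all add: P2_def full_exact_subcat_def)

lemma P2_conflationI:
  assumes "short_exact F \<sigma> G \<tau> H" "F \<in> P2_objects C" "G \<in> P2_objects C" "H \<in> P2_objects C"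
  shows "(mor C F G \<sigma>, mor C G H \<tau>) \<in> Conflations (P2 C)"
  using Mod_conflationI[OF assms(1)] assms(2-4) by (simp add: P2_def full_exact_subcat_def)

lemma P2_conflationE:
  assumes "(i, p) \<in> Conflations (P2 C)"
  obtains F \<sigma> G \<tau> H where "i = mor C F G \<sigma>" "p = mor C G H \<tau>" "short_exact F \<sigma> G \<tau> H"
    "F \<in> P2_objects C" "G \<in> P2_objects C" "H \<in> P2_objects C"
proof -
  have c: "(i, p) \<in> Conflations (Mod_cat C)" "Dom (Mod_cat C) i \<in> P2_objects C"
    "Cod (Mod_cat C) i \<in> P2_objects C" "Cod (Mod_cat C) p \<in> P2_objects C"
    using assms by (auto simp: P2_def full_exact_subcat_def)
  show ?thesis using Mod_conflationE[OF c(1)] that c by (metis mor_simps)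
qed

lemma P2_HomE:
  assumes "f \<in> Hom (P2 C) F G"
  obtains \<tau> where "f = mor C F G \<tau>" "natural C F G \<tau>" "F \<in> P2_objects C" "G \<in> P2_objects C"
    "F \<in> additive_functors C" "G \<in> additive_functors C"
  using assms by (auto simp: Hom_iff P2_def full_exact_subcat_def) (auto simp: Mod_cat_def mor_def)

lemma P2_HomI:
  assumes "natural C F G \<tau>" "F \<in> P2_objects C" "G \<in> P2_objects C"
  shows "mor C F G \<tau> \<in> Hom (P2 C) F G"
proof -
  have "mor C F G \<tau> \<in> Arr (Mod_cat C)"
    using assms by (auto simp: Mod_cat_def P2_objects_def)
  then show ?thesis using assms by (simp add: Hom_iff P2_def full_exact_subcat_def)
qed

lemma mor_eq_iff:
  "mor C F G \<sigma> = mor C F G \<tau> \<longleftrightarrow> (\<forall>W\<in>Ob C. \<forall>x\<in>carrier (FOb F W). \<sigma> W x = \<tau> W x)"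
  unfolding mor_def by (auto simp: fun_eq_iff restrict_def)

text \<open>Both components are restricted to sections, and the inner restriction disappears because
  \<open>\<sigma>\<close> sends sections to sections.\<close>

lemma mor_comp:
  assumes "natural C F G \<sigma>"
  shows "Comp (Mod_cat C) (mor C G H \<tau>) (mor C F G \<sigma>) = mor C F H (\<lambda>W x. \<tau> W (\<sigma> W x))"
proof -
  have "Comp (Mod_cat C) (mor C G H \<tau>) (mor C F G \<sigma>) =
    mor C F H (\<lambda>W x. (restrict (\<lambda>X. restrict (\<tau> X) (carrier (FOb G X))) (Ob C)) W
      ((restrict (\<lambda>X. restrict (\<sigma> X) (carrier (FOb F X))) (Ob C)) W x))"
    by (simp add: Mod_cat_def mor_def)
  also have "\<dots> = mor C F H (\<lambda>W x. \<tau> W (\<sigma> W x))"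
    unfolding mor_eq_iff using natural_closed[OF assms] by simp
  finally show ?thesis .
qed

lemma mor_Ident: "Ident (Mod_cat C) F = mor C F F (\<lambda>W x. x)"
  by (simp add: Mod_cat_def)

lemma mor_Zero: "Zero (Mod_cat C) F G = mor C F G (\<lambda>W x. \<one>\<^bsub>FOb G W\<^esub>)"
  by (simp add: Mod_cat_def)

lemma mor_Add:
  "Add (Mod_cat C) (mor C F G \<sigma>) (mor C F G \<tau>) = mor C F G (\<lambda>W x. \<sigma> W x \<otimes>\<^bsub>FOb G W\<^esub> \<tau> W x)"
proof -
  have "Add (Mod_cat C) (mor C F G \<sigma>) (mor C F G \<tau>) =
    mor C F G (\<lambda>W x. (restrict (\<lambda>X. restrict (\<sigma> X) (carrier (FOb F X))) (Ob C)) W x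
      \<otimes>\<^bsub>FOb G W\<^esub> (restrict (\<lambda>X. restrict (\<tau> X) (carrier (FOb F X))) (Ob C)) W x)"
    by (simp add: Mod_cat_def mor_def)
  also have "\<dots> = mor C F G (\<lambda>W x. \<sigma> W x \<otimes>\<^bsub>FOb G W\<^esub> \<tau> W x)"
    unfolding mor_eq_iff by simp
  finally show ?thesis .
qed

section \<open>Objects with a resolution of length two\<close>

lemma P2_objects_functor: "F \<in> P2_objects C \<Longrightarrow> F \<in> additive_functors C"
  by (simp add: P2_objects_def)

text \<open>The hypotheses make \<open>i\<close> a kernel of \<open>g\<close>, which amounts to
  exactness of \<open>0 -> \<Upsilon>(K) -> \<Upsilon>(A) -> \<Upsilon>(B)\<close>. The objects in
  question are the cokernels of \<open>\<Upsilon>(g)\<close> for arrows \<open>g\<close> that have a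
  kernel.\<close>

lemma P2_objectsI:
  assumes F: "F \<in> additive_functors C" and p: "presents g A B F \<pi>"
    and i: "i \<in> Hom C K A" "g \<cdot> i = Zero C K B"
    and mono: "\<And>W x. x \<in> Hom C W K \<Longrightarrow> i \<cdot> x = Zero C W A \<Longrightarrow> x = Zero C W K"
    and lift: "\<And>W x. x \<in> Hom C W A \<Longrightarrow> g \<cdot> x = Zero C W B \<Longrightarrow> \<exists>y\<in>Hom C W K. i \<cdot> y = x"
  shows "F \<in> P2_objects C"
proof -
  note p1 = presentsD[OF p]
  have Ob: "K \<in> Ob C" "A \<in> Ob C" "B \<in> Ob C" using i p1 Hom_Ob by auto
  have inj: "inj_on (\<lambda>x. i \<cdot> x) (Hom C W K)" if W: "W \<in> Ob C" for W
    using natural_inj[OF natural_Yo_map[OF i(1)] Yo_functor Yo_functor W] Ob mono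
    by (auto simp: inj_on_def Yo_map_def)
  have "monic C (\<Upsilon> C K) (Yo_map C i)" using inj by (simp add: monic_def Yo_map_def)
  moreover have "exact_at C (\<Upsilon> C K) (Yo_map C i) (\<Upsilon> C A) (Yo_map C g) (\<Upsilon> C B)"
  proof -
    have "g \<cdot> (i \<cdot> y) = Zero C W B" if "y \<in> Hom C W K" for W y
      using comp_left1[OF that i(1) p1(1) i(2)] Zero_Comp[OF that Ob(3)] by simp
    then show ?thesis using lift Comp_Hom[OF _ i(1)]
      by (fastforce simp: exact_at_def kernel_def Yo_map_def image_iff)
  qed
  ultimately show ?thesis
    using F natural_Yo_map[OF i(1)] natural_Yo_map[OF p1(1)] p[unfolded presents_iff[OF p1(1)]] Ob
    unfolding P2_objects_def by blast
qed

text \<open>By Yoneda the maps between representables are composition with the images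
  \<open>i\<close> and \<open>g\<close> of identities, and exactness says that \<open>i\<close> is a
  kernel of \<open>g\<close>.\<close>

lemma P2_objectsE:
  assumes "F \<in> P2_objects C"
  obtains K i A g B \<pi> where "presents g A B F \<pi>" "i \<in> Hom C K A" "g \<cdot> i = Zero C K B"
    "\<And>W x. x \<in> Hom C W K \<Longrightarrow> i \<cdot> x = Zero C W A \<Longrightarrow> x = Zero C W K"
    "\<And>W x. x \<in> Hom C W A \<Longrightarrow> g \<cdot> x = Zero C W B \<Longrightarrow> \<exists>y\<in>Hom C W K. i \<cdot> y = x"
proof -
  obtain K A B \<alpha> \<beta> \<pi> where Ob: "K \<in> Ob C" "A \<in> Ob C" "B \<in> Ob C"
    and n: "natural C (\<Upsilon> C K) (\<Upsilon> C A) \<alpha>" "natural C (\<Upsilon> C A) (\<Upsilon> C B) \<beta>" "natural C (\<Upsilon> C B) F \<pi>"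
    and e: "monic C (\<Upsilon> C K) \<alpha>" "exact_at C (\<Upsilon> C K) \<alpha> (\<Upsilon> C A) \<beta> (\<Upsilon> C B)"
      "exact_at C (\<Upsilon> C A) \<beta> (\<Upsilon> C B) \<pi> F" "epic C (\<Upsilon> C B) \<pi> F"
    using assms unfolding P2_objects_def by blast
  define i where "i = \<alpha> K (Ident C K)"
  define g where "g = \<beta> A (Ident C A)"
  have i: "i \<in> Hom C K A" and g: "g \<in> Hom C A B"
    using natural_closed[OF n(1) Ob(1)] natural_closed[OF n(2) Ob(2)] Ident_Hom Ob
    by (simp_all add: i_def g_def)
  have \<alpha>: "\<alpha> W x = i \<cdot> x" if "x \<in> Hom C W K" for W x using yoneda[OF n(1) that] by (simp add: i_def)
  have \<beta>: "\<beta> W x = g \<cdot> x" if "x \<in> Hom C W A" for W x using yoneda[OF n(2) that] by (simp add: g_def)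
  have "exact_at C (\<Upsilon> C A) (Yo_map C g) (\<Upsilon> C B) \<pi> F"
    using e(3) \<beta> by (simp add: exact_at_def Yo_map_def)
  then have p: "presents g A B F \<pi>" using presents_iff[OF g] n(3) e(4) by blast
  have ex: "(\<lambda>x. i \<cdot> x) ` Hom C W K = {x \<in> Hom C W A. g \<cdot> x = Zero C W B}" if "W \<in> Ob C" for W
  proof -
    have "\<alpha> W ` Hom C W K = {x \<in> Hom C W A. \<beta> W x = Zero C W B}"
      using e(2) that by (simp add: exact_at_def kernel_def)
    moreover have "\<alpha> W ` Hom C W K = (\<lambda>x. i \<cdot> x) ` Hom C W K" using \<alpha> by (auto simp: image_iff)
    ultimately show ?thesis using \<beta> by auto
  qed
  show ?thesis
  proof (rule that[OF p i])
    show "g \<cdot> i = Zero C K B" using ex[OF Ob(1)] Ident_Hom[OF Ob(1)] Comp_Ident[OF i] by force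
    show "x = Zero C W K" if x: "x \<in> Hom C W K" "i \<cdot> x = Zero C W A" for W x
    proof -
      have W: "W \<in> Ob C" using Hom_Ob x by auto
      have z: "Zero C W K \<in> Hom C W K" using Zero_Hom W Ob by blast
      have "\<alpha> W x = \<alpha> W (Zero C W K)" using \<alpha>[OF x(1)] \<alpha>[OF z] x(2) Comp_Zero[OF i W] by simp
      then show ?thesis using e(1) W x z by (auto simp: monic_def inj_on_def)
    qed
    show "\<exists>y\<in>Hom C W K. i \<cdot> y = x" if x: "x \<in> Hom C W A" "g \<cdot> x = Zero C W B" for W x
    proof -
      have "x \<in> (\<lambda>x. i \<cdot> x) ` Hom C W K" using ex[OF Hom_Ob(1)[OF x(1)]] x by simp
      then show ?thesis by blast
    qed
  qed
qed

end

section \<open>Sheafification for the topology of deflations\<close>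

context exact_category
begin

text \<open>
  Since \<open>\<Upsilon>(Z)\<close> is a sheaf for the topology of deflations, this says that \<open>\<xi>\<close> is the sheafification of \<open>F\<close>.
\<close>

definition locally_iso :: "('o, 'm, 'u) presheaf \<Rightarrow> 'o \<Rightarrow> ('o \<Rightarrow> 'u \<Rightarrow> 'm) \<Rightarrow> bool" where
  "locally_iso F Z \<xi> \<longleftrightarrow> Z \<in> Ob E \<and> natural E F (\<Upsilon> E Z) \<xi> \<and>
    (\<forall>W\<in>Ob E. \<forall>x\<in>carrier (FOb F W). \<xi> W x = Zero E W Z \<longrightarrow>
      (\<exists>V. \<exists>p\<in>Hom E V W. deflation E p \<and> FArr F p x = \<one>\<^bsub>FOb F V\<^esub>)) \<and>
    (\<forall>W\<in>Ob E. \<forall>w\<in>Hom E W Z. \<exists>V. \<exists>p\<in>Hom E V W. deflation E p \<and>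
      (\<exists>x\<in>carrier (FOb F V). \<xi> V x = w \<cdot> p))"

lemma locally_isoD:
  assumes "locally_iso F Z \<xi>"
  shows "Z \<in> Ob E" "natural E F (\<Upsilon> E Z) \<xi>"
  using assms by (auto simp: locally_iso_def)

lemma locally_iso_kernel:
  assumes "locally_iso F Z \<xi>" "W \<in> Ob E" "x \<in> carrier (FOb F W)" "\<xi> W x = Zero E W Z"
  obtains V p where "p \<in> Hom E V W" "deflation E p" "FArr F p x = \<one>\<^bsub>FOb F V\<^esub>"
  using assms unfolding locally_iso_def by blast

lemma locally_iso_cokernel:
  assumes "locally_iso F Z \<xi>" "w \<in> Hom E W Z"
  obtains V p x where "p \<in> Hom E V W" "deflation E p" "x \<in> carrier (FOb F V)" "\<xi> V x = w \<cdot> p"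
  using assms Hom_Ob(1)[OF assms(2)] unfolding locally_iso_def by blast

section \<open>Admissible presentations and representable sheafifications\<close>

lemma admissibleE:
  assumes "admissible E f"
  obtains p X I m Y where "deflation E p" "p \<in> Hom E X I" "inflation E m" "m \<in> Hom E I Y" "f = m \<cdot> p"
  using assms deflation_Arr inflation_Arr unfolding admissible_def by metis

lemma admissibleI:
  assumes "deflation E p" "p \<in> Hom E X I" "inflation E m" "m \<in> Hom E I Y"
  shows "admissible E (m \<cdot> p)"
  using assms unfolding admissible_def Hom_iff by metis

lemma mod_admE:
  assumes "F \<in> mod_adm E"
  obtains p X I m Y \<pi> where "F \<in> additive_functors E" "deflation E p" "p \<in> Hom E X I" "inflation E m"
    "m \<in> Hom E I Y" "presents (m \<cdot> p) X Y F \<pi>"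
proof -
  obtain f where F: "F \<in> additive_functors E" "admissible E f" "presented_by E f F"
    using assms by (auto simp: mod_adm_def)
  obtain p X I m Y where f: "deflation E p" "p \<in> Hom E X I" "inflation E m" "m \<in> Hom E I Y" "f = m \<cdot> p"
    using admissibleE F by blast
  show ?thesis using that[OF F(1) f(1-4)] F(3) presented_by_iff[OF Comp_Hom[OF f(2,4)]] f(5) by blast
qed

text \<open>Composing with a monic \<open>m\<close> does not change kernels, so the kernel of the
  deflation \<open>p\<close> is also a kernel of \<open>m \<cdot> p\<close> and completes the
  resolution.\<close>

lemma P2_objects_of_presents:
  assumes F: "F \<in> additive_functors E" and p: "deflation E p" "p \<in> Hom E X I"
    and m: "m \<in> Hom E I Y" "\<And>W x. x \<in> Hom E W I \<Longrightarrow> m \<cdot> x = Zero E W Y \<Longrightarrow> x = Zero E W I"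
    and P: "presents (m \<cdot> p) X Y F \<pi>"
  shows "F \<in> P2_objects E"
proof -
  obtain K i where c: "conflation E K i X p I" using deflationE[OF p] .
  note i = conflationD[OF c]
  have Ob: "K \<in> Ob E" "X \<in> Ob E" using i Hom_Ob by auto
  show ?thesis
  proof (rule P2_objectsI[OF F P i(1)])
    show "(m \<cdot> p) \<cdot> i = Zero E K Y" using comp_right1[OF i(1) p(2) m(1) i(5)] Comp_Zero[OF m(1) Ob(1)] by simp
    show "x = Zero E W K" if x: "x \<in> Hom E W K" "i \<cdot> x = Zero E W X" for W x
    proof -
      have W: "W \<in> Ob E" using Hom_Ob x by auto
      have "i \<cdot> x = i \<cdot> Zero E W K" using x(2) Comp_Zero[OF i(1) W] by simp
      then show ?thesis using conflation_mono[OF c x(1) Zero_Hom[OF W Ob(1)]] by simp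
    qed
    show "\<exists>y\<in>Hom E W K. i \<cdot> y = x" if x: "x \<in> Hom E W X" "(m \<cdot> p) \<cdot> x = Zero E W Y" for W x
    proof -
      have "p \<cdot> x = Zero E W I" using m(2)[OF Comp_Hom[OF x(1) p(2)]] Comp_assoc[OF x(1) p(2) m(1)] x(2) by simp
      then show ?thesis using conflation_lift[OF c x(1)] by metis
    qed
  qed
qed

lemma inflation_zero_kernel:
  assumes "inflation E m" "m \<in> Hom E I Y" "x \<in> Hom E W I" "m \<cdot> x = Zero E W Y"
  shows "x = Zero E W I"
proof -
  have W: "W \<in> Ob E" "I \<in> Ob E" using Hom_Ob assms(3) by auto
  have "m \<cdot> x = m \<cdot> Zero E W I" using assms(4) Comp_Zero[OF assms(2) W(1)] by simp
  then show ?thesis using inflation_mono[OF assms(1-3) Zero_Hom[OF W]] by simp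
qed

lemma mod_adm_subset_P2: "mod_adm E \<subseteq> P2_objects E"
proof
  fix F :: "('o, 'm, 'u) presheaf" assume "F \<in> mod_adm E"
  then obtain p X I m Y \<pi> where *: "F \<in> additive_functors E" "deflation E p" "p \<in> Hom E X I" "inflation E m"
    "m \<in> Hom E I Y" "presents (m \<cdot> p) X Y F \<pi>"
    by (rule mod_admE)
  show "F \<in> P2_objects E"
    by (rule P2_objects_of_presents[OF *(1-3,5) _ *(6)]) (rule inflation_zero_kernel[OF *(4,5)])
qed

lemma presents_nat:
  assumes "presents g A B F \<pi>" "W \<in> Ob E" "f \<in> Hom E V W" "w \<in> Hom E W B"
  shows "FArr F f (\<pi> W w) = \<pi> V (w \<cdot> f)"
  using natural_arr[OF presentsD(2)[OF assms(1)] assms(3), of w] assms(4) by simp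

text \<open>\<open>\<xi>\<close> is induced by composition with \<open>q\<close>. A section killed
  by it is represented by an arrow through \<open>m\<close>, which lifts to \<open>X\<close> over a
  pullback of \<open>p\<close>; a section of \<open>\<Upsilon>(Z)\<close> lifts over a pullback of
  \<open>q\<close>.\<close>

lemma presents_locally_iso:
  assumes F: "F \<in> additive_functors E" and P: "presents (m \<cdot> p) X Y F \<pi>"
    and p: "deflation E p" "p \<in> Hom E X I" and c: "conflation E I m Y q Z"
  obtains \<xi> where "locally_iso F Z \<xi>"
proof -
  note m = conflationD[OF c]
  have Ob: "Y \<in> Ob E" "Z \<in> Ob E" "X \<in> Ob E" using m p Hom_Ob by auto
  note P1 = presentsD[OF P]
  have qmp: "q \<cdot> ((m \<cdot> p) \<cdot> v) = Zero E W Z" if v: "v \<in> Hom E W X" for W v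
    using Comp_assoc[OF v p(2) m(1)] comp_left1[OF Comp_Hom[OF v p(2)] m(1,2,5)]
      Zero_Comp[OF Comp_Hom[OF v p(2)] Ob(2)] by simp
  obtain \<xi> where \<xi>: "natural E F (\<Upsilon> E Z) \<xi>"
    "\<And>W a. W \<in> Ob E \<Longrightarrow> a \<in> carrier (FOb (\<Upsilon> E Y) W) \<Longrightarrow> \<xi> W (\<pi> W a) = Yo_map E q W a"
  proof (rule natural_factor[OF Yo_functor[OF Ob(1)] F Yo_functor[OF Ob(2)] P1(2) natural_Yo_map[OF m(2)]])
    show "\<exists>a\<in>carrier (FOb (\<Upsilon> E Y) W). \<pi> W a = x" if "W \<in> Ob E" "x \<in> carrier (FOb F W)" for W x
      using P1(3)[OF that] by simp
    show "Yo_map E q W a = \<one>\<^bsub>FOb (\<Upsilon> E Z) W\<^esub>"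
      if "a \<in> carrier (FOb (\<Upsilon> E Y) W)" "\<pi> W a = \<one>\<^bsub>FOb F W\<^esub>" for W a
      using that P1(4)[of a W] qmp by (auto simp: Yo_map_def)
  qed blast
  have \<xi>\<pi>: "\<xi> W (\<pi> W w) = q \<cdot> w" if "w \<in> Hom E W Y" for W w
    using \<xi>(2)[OF Hom_Ob(1)[OF that]] that by (simp add: Yo_map_def)
  have "locally_iso F Z \<xi>"
    unfolding locally_iso_def
  proof (intro conjI ballI impI Ob(2) \<xi>(1))
    fix W x assume W: "W \<in> Ob E" and x: "x \<in> carrier (FOb F W)" "\<xi> W x = Zero E W Z"
    obtain w where w: "w \<in> Hom E W Y" "\<pi> W w = x" using P1(3)[OF W x(1)] by blast
    have "q \<cdot> w = Zero E W Z" using \<xi>\<pi>[OF w(1)] w(2) x(2) by simp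
    then obtain u where u: "u \<in> Hom E W I" "m \<cdot> u = w" using conflation_lift[OF c w(1)] by blast
    obtain t V v where t: "deflation E t" "t \<in> Hom E V W" and v: "v \<in> Hom E V X" "p \<cdot> v = u \<cdot> t"
      using pullback_deflation[OF p u(1)] by metis
    have "w \<cdot> t = m \<cdot> (u \<cdot> t)" using Comp_assoc[OF t(2) u(1) m(1)] u(2) by simp
    also have "\<dots> = (m \<cdot> p) \<cdot> v" using Comp_assoc[OF v(1) p(2) m(1)] v(2) by simp
    finally have "\<pi> V (w \<cdot> t) = \<one>\<^bsub>FOb F V\<^esub>" using P1(4)[OF Comp_Hom[OF t(2) w(1)]] v(1) by blast
    then have "FArr F t x = \<one>\<^bsub>FOb F V\<^esub>" using presents_nat[OF P W t(2) w(1)] w(2) by simp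
    then show "\<exists>V. \<exists>p\<in>Hom E V W. deflation E p \<and> FArr F p x = \<one>\<^bsub>FOb F V\<^esub>" using t by blast
  next
    fix W w assume W: "W \<in> Ob E" and w: "w \<in> Hom E W Z"
    obtain t V v where t: "deflation E t" "t \<in> Hom E V W" and v: "v \<in> Hom E V Y" "q \<cdot> v = w \<cdot> t"
      using pullback_deflation[OF m(4,2) w] by metis
    have "\<pi> V v \<in> carrier (FOb F V)" using natural_closed[OF P1(2) Hom_Ob(1)[OF v(1)]] v(1) by simp
    moreover have "\<xi> V (\<pi> V v) = w \<cdot> t" using \<xi>\<pi>[OF v(1)] v(2) by simp
    ultimately show "\<exists>V. \<exists>p\<in>Hom E V W. deflation E p \<and> (\<exists>x\<in>carrier (FOb F V). \<xi> V x = w \<cdot> p)"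
      using t by blast
  qed
  then show ?thesis using that by blast
qed

text \<open>The composite \<open>\<Upsilon>(B) -> F -> \<Upsilon>(Z)\<close> is composition with
  some \<open>q\<close>. Local surjectivity makes a deflation factor through \<open>q\<close>, local
  injectivity makes one factor through the map from \<open>A\<close> to the kernel of
  \<open>q\<close>, and cancellation shows that both maps are deflations.\<close>

lemma locally_iso_admissible:
  assumes ic: "idempotent_complete E" and F: "F \<in> additive_functors E" and P: "presents g A B F \<pi>"
    and L: "locally_iso F Z \<xi>"
  shows "admissible E g"
proof -
  note P1 = presentsD[OF P] and L1 = locally_isoD[OF L]
  have Ob: "A \<in> Ob E" "B \<in> Ob E" using P1(1) Hom_Ob by auto
  have n: "natural E (\<Upsilon> E B) (\<Upsilon> E Z) (\<lambda>W w. \<xi> W (\<pi> W w))" using natural_comp[OF P1(2) L1(2)] .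
  define q where "q = \<xi> B (\<pi> B (Ident E B))"
  have q: "q \<in> Hom E B Z" using natural_closed[OF n Ob(2)] Ident_Hom[OF Ob(2)] by (simp add: q_def)
  have \<xi>\<pi>: "\<xi> W (\<pi> W w) = q \<cdot> w" if "w \<in> Hom E W B" for W w
    using yoneda[OF n that] by (simp add: q_def)
  \<comment> \<open>Local surjectivity is tested on the universal section, the identity of
    \<open>Z\<close>.\<close>
  obtain V p x where p: "p \<in> Hom E V Z" "deflation E p" and x: "x \<in> carrier (FOb F V)" "\<xi> V x = Ident E Z \<cdot> p"
    using locally_iso_cokernel[OF L Ident_Hom[OF L1(1)]] .
  obtain h where h: "h \<in> Hom E V B" "\<pi> V h = x" using P1(3)[OF Hom_Ob(1)[OF p(1)] x(1)] by blast
  have "q \<cdot> h = p" using \<xi>\<pi>[OF h(1)] h(2) x(2) Ident_Comp[OF p(1)] by simp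
  then have dq: "deflation E q" using deflation_cancel[OF ic h(1) q] p(2) by simp
  obtain I m where c: "conflation E I m B q Z" using deflationE[OF dq q] .
  note m = conflationD[OF c]
  have IO: "I \<in> Ob E" using m Hom_Ob by auto
  have "\<pi> A g = \<one>\<^bsub>FOb F A\<^esub>" using P1(4)[OF P1(1)] Comp_Ident[OF P1(1)] Ident_Hom[OF Ob(1)] by metis
  then have "q \<cdot> g = Zero E A Z"
    using \<xi>\<pi>[OF P1(1)] natural_one[OF L1(2) F Yo_functor[OF L1(1)] Ob(1)] by simp
  then obtain g' where g': "g' \<in> Hom E A I" "m \<cdot> g' = g" using conflation_lift[OF c P1(1)] by blast
  \<comment> \<open>\<open>m\<close> is the universal arrow killed by \<open>q\<close>. Its class in
    \<open>F\<close> dies on a deflation \<open>r\<close>, which therefore factors through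
    \<open>g'\<close>.\<close>
  have "\<xi> I (\<pi> I m) = Zero E I Z" using \<xi>\<pi>[OF m(1)] m(5) by simp
  moreover have "\<pi> I m \<in> carrier (FOb F I)" using natural_closed[OF P1(2) IO] m(1) by simp
  ultimately obtain U r where r: "r \<in> Hom E U I" "deflation E r" "FArr F r (\<pi> I m) = \<one>\<^bsub>FOb F U\<^esub>"
    using locally_iso_kernel[OF L IO] by metis
  have "\<pi> U (m \<cdot> r) = \<one>\<^bsub>FOb F U\<^esub>" using presents_nat[OF P IO r(1) m(1)] r(3) by simp
  then obtain v where v: "v \<in> Hom E U A" "m \<cdot> r = g \<cdot> v" using P1(4)[OF Comp_Hom[OF r(1) m(1)]] by blast
  have "m \<cdot> r = m \<cdot> (g' \<cdot> v)" using Comp_assoc[OF v(1) g'(1) m(1)] g'(2) v(2) by simp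
  then have "r = g' \<cdot> v" using conflation_mono[OF c r(1) Comp_Hom[OF v(1) g'(1)]] by simp
  then have "deflation E g'" using deflation_cancel[OF ic v(1) g'(1)] r(2) by simp
  then show ?thesis using admissibleI[OF _ g'(1) m(3,1)] g'(2) by simp
qed

text \<open>Membership in \<open>P2_objects E\<close> supplies one presentation, to which
  \<open>locally_iso_admissible\<close> applies. Afterwards only the representing object and the
  comparison map matter.\<close>

lemma mod_adm_iff:
  assumes ic: "idempotent_complete E" and F: "F \<in> P2_objects E"
  shows "F \<in> mod_adm E \<longleftrightarrow> (\<exists>Z \<xi>. locally_iso F Z \<xi>)"
proof
  assume "F \<in> mod_adm E"
  then obtain p X I m Y \<pi> where *: "F \<in> additive_functors E" "deflation E p" "p \<in> Hom E X I" "inflation E m"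
    "m \<in> Hom E I Y" "presents (m \<cdot> p) X Y F \<pi>"
    by (rule mod_admE)
  obtain Z q where c: "conflation E I m Y q Z" using inflationE[OF *(4,5)] .
  show "\<exists>Z \<xi>. locally_iso F Z \<xi>" using presents_locally_iso[OF *(1,6,2,3) c] by blast
next
  assume "\<exists>Z \<xi>. locally_iso F Z \<xi>"
  then obtain Z \<xi> where L: "locally_iso F Z \<xi>" by blast
  obtain g A B \<pi> where P: "presents g A B F \<pi>" using P2_objectsE[OF F] by metis
  note F' = P2_objects_functor[OF F]
  have "admissible E g" by (rule locally_iso_admissible[OF ic F' P L])
  then show "F \<in> mod_adm E"
    using F' P presented_by_iff[OF presentsD(1)[OF P]] unfolding mod_adm_def by blast
qed

section \<open>The universal property of the sheafification\<close>

text \<open>Descent: some deflation \<open>t\<close> onto \<open>Z\<close> is the value of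
  \<open>\<xi>\<close> at a section \<open>x\<close> of \<open>F\<close>, and \<open>\<eta>\<close>
  sends \<open>x\<close> to an arrow that kills the kernel of \<open>t\<close>, which thus descends
  to an arrow from \<open>Z\<close>.\<close>

lemma locally_iso_factor:
  assumes F: "F \<in> additive_functors E" and L: "locally_iso F Z \<xi>"
    and e: "natural E F (\<Upsilon> E Z') \<eta>" and Z': "Z' \<in> Ob E"
  obtains d where "d \<in> Hom E Z Z'" "\<And>W x. W \<in> Ob E \<Longrightarrow> x \<in> carrier (FOb F W) \<Longrightarrow> \<eta> W x = d \<cdot> \<xi> W x"
proof -
  note L1 = locally_isoD[OF L]
  have \<xi>H: "\<xi> W x \<in> Hom E W Z" and \<eta>H: "\<eta> W x \<in> Hom E W Z'"
    if "W \<in> Ob E" "x \<in> carrier (FOb F W)" for W x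
    using natural_closed[OF L1(2) that] natural_closed[OF e that] by simp_all
  have nat: "\<xi> V (FArr F f x) = \<xi> W x \<cdot> f" "\<eta> V (FArr F f x) = \<eta> W x \<cdot> f"
    if "f \<in> Hom E V W" "x \<in> carrier (FOb F W)" for V W f x
    using natural_arr[OF L1(2) that] natural_arr[OF e that] by simp_all
  \<comment> \<open>\<open>\<eta>\<close> cannot separate what \<open>\<xi>\<close> identifies: the
    difference \<open>z\<close> of the two sections vanishes on a deflation, and deflations are
    epic.\<close>
  have eq: "\<eta> W x = \<eta> W y" if W: "W \<in> Ob E" and x: "x \<in> carrier (FOb F W)" "y \<in> carrier (FOb F W)"
    and \<xi>: "\<xi> W x = \<xi> W y" for W x y
  proof (rule natural_inj[OF natural_id Yo_functor[OF Z'] Yo_functor[OF Z'] W])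
    obtain z where z: "z \<in> carrier (FOb F W)" "z \<otimes>\<^bsub>FOb F W\<^esub> y = x" using functor_diff[OF F W x] by metis
    have zW: "Zero E W Z \<in> Hom E W Z" "Zero E W Z' \<in> Hom E W Z'" using Zero_Hom W L1(1) Z' by auto
    have "Add E (\<xi> W z) (\<xi> W y) = Add E (Zero E W Z) (\<xi> W y)"
      using natural_mult[OF L1(2) W z(1) x(2)] z(2) \<xi> Add_Zero(2)[OF \<xi>H[OF W x(2)]] by simp
    then have "\<xi> W z = Zero E W Z" using Add_cancel[OF \<xi>H[OF W z(1)] zW(1) \<xi>H[OF W x(2)]] by simp
    then obtain V p where p: "p \<in> Hom E V W" "deflation E p" "FArr F p z = \<one>\<^bsub>FOb F V\<^esub>"
      using locally_iso_kernel[OF L W z(1)] by blast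
    have V: "V \<in> Ob E" using p Hom_Ob by auto
    have "\<eta> W z \<cdot> p = Zero E W Z' \<cdot> p"
      using nat(2)[OF p(1) z(1)] p(3) natural_one[OF e F Yo_functor[OF Z'] V] Zero_Comp[OF p(1) Z'] by simp
    then have "\<eta> W z = Zero E W Z'" using deflation_epi[OF p(2,1) \<eta>H[OF W z(1)] zW(2)] by simp
    then show "\<eta> W x = \<eta> W y"
      using natural_mult[OF e W z(1) x(2)] z(2) Add_Zero(2)[OF \<eta>H[OF W x(2)]] by simp
  qed (use \<eta>H[OF W] x in simp_all)
  obtain V t x where t: "t \<in> Hom E V Z" "deflation E t" and x: "x \<in> carrier (FOb F V)" "\<xi> V x = Ident E Z \<cdot> t"
    using locally_iso_cokernel[OF L Ident_Hom[OF L1(1)]] .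
  have V: "V \<in> Ob E" using t Hom_Ob by auto
  have xt: "\<xi> V x = t" using x(2) Ident_Comp[OF t(1)] by simp
  obtain K l where c: "conflation E K l V t Z" using deflationE[OF t(2,1)] .
  note l = conflationD[OF c]
  have K: "K \<in> Ob E" using l Hom_Ob by auto
  note one = functor_one_closed[OF F K]
  have "\<xi> K (FArr F l x) = \<xi> K \<one>\<^bsub>FOb F K\<^esub>"
    using nat(1)[OF l(1) x(1)] xt l(5) natural_one[OF L1(2) F Yo_functor[OF L1(1)] K] by simp
  then have "\<eta> K (FArr F l x) = \<eta> K \<one>\<^bsub>FOb F K\<^esub>" using eq[OF K functor_closed[OF F l(1) x(1)] one] by simp
  then have "\<eta> V x \<cdot> l = Zero E K Z'"
    using nat(2)[OF l(1) x(1)] natural_one[OF e F Yo_functor[OF Z'] K] by simp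
  then obtain d where d: "d \<in> Hom E Z Z'" "d \<cdot> t = \<eta> V x" using conflation_desc[OF c \<eta>H[OF V x(1)]] by blast
  \<comment> \<open>Over a pullback \<open>s\<close> of \<open>t\<close>, the section
    \<open>y\<close> has the same image under \<open>\<xi>\<close> as a restriction of
    \<open>x\<close>, for which the formula holds by the choice of \<open>d\<close>.\<close>
  have "\<eta> W y = d \<cdot> \<xi> W y" if W: "W \<in> Ob E" and y: "y \<in> carrier (FOb F W)" for W y
  proof -
    obtain s U v where s: "deflation E s" "s \<in> Hom E U W" and v: "v \<in> Hom E U V" "t \<cdot> v = \<xi> W y \<cdot> s"
      using pullback_deflation[OF t(2,1) \<xi>H[OF W y]] by metis
    have U: "U \<in> Ob E" using s Hom_Ob by auto
    have "\<xi> U (FArr F v x) = \<xi> U (FArr F s y)" using nat(1)[OF v(1) x(1)] nat(1)[OF s(2) y] xt v(2) by simp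
    then have "\<eta> U (FArr F v x) = \<eta> U (FArr F s y)"
      using eq[OF U functor_closed[OF F v(1) x(1)] functor_closed[OF F s(2) y]] by simp
    then have "\<eta> W y \<cdot> s = (d \<cdot> t) \<cdot> v" using nat(2)[OF v(1) x(1)] nat(2)[OF s(2) y] d(2) by simp
    also have "\<dots> = (d \<cdot> \<xi> W y) \<cdot> s" by (rule comp_right[OF v(1) t(1) s(2) \<xi>H[OF W y] d(1) v(2)])
    finally show ?thesis
      by (rule deflation_epi[OF s \<eta>H[OF W y] Comp_Hom[OF \<xi>H[OF W y] d(1)]])
  qed
  then show ?thesis using that d(1) by blast
qed

text \<open>Uniqueness in the universal property: some deflation onto \<open>Z\<close> occurs among
  the values of \<open>\<xi>\<close>, and it can be cancelled.\<close>

lemma locally_iso_epi: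
  assumes L: "locally_iso F Z \<xi>" and d: "d \<in> Hom E Z Z'" "d' \<in> Hom E Z Z'"
    and eq: "\<And>W x. W \<in> Ob E \<Longrightarrow> x \<in> carrier (FOb F W) \<Longrightarrow> d \<cdot> \<xi> W x = d' \<cdot> \<xi> W x"
  shows "d = d'"
proof -
  obtain V t x where t: "t \<in> Hom E V Z" "deflation E t" and x: "x \<in> carrier (FOb F V)" "\<xi> V x = Ident E Z \<cdot> t"
    using locally_iso_cokernel[OF L Ident_Hom[OF locally_isoD(1)[OF L]]] .
  show ?thesis
    using deflation_epi[OF t(2,1) d] eq[OF Hom_Ob(1)[OF t(1)] x(1)] x(2) Ident_Comp[OF t(1)] by simp
qed

section \<open>Retracts, kernels and extensions\<close>

text \<open>By the universal property the idempotent \<open>\<iota> \<rho>\<close> of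
  \<open>F\<close> induces an arrow \<open>e\<close> on \<open>Z\<close>, idempotent by uniqueness.
  The object through which \<open>e\<close> splits represents the sheafification of
  \<open>A\<close>.\<close>

lemma locally_iso_retract:
  assumes ic: "idempotent_complete E"
    and A: "A \<in> additive_functors E" and F: "F \<in> additive_functors E" and L: "locally_iso F Z \<xi>"
    and i: "natural E A F \<iota>" and r: "natural E F A \<rho>"
    and ri: "\<And>W a. W \<in> Ob E \<Longrightarrow> a \<in> carrier (FOb A W) \<Longrightarrow> \<rho> W (\<iota> W a) = a"
  obtains Z' \<xi>' where "locally_iso A Z' \<xi>'"
proof -
  note L1 = locally_isoD[OF L]
  have \<xi>H: "\<xi> W x \<in> Hom E W Z" if "W \<in> Ob E" "x \<in> carrier (FOb F W)" for W x
    using natural_closed[OF L1(2) that] by simp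
  note ic' = natural_closed[OF i] and rc = natural_closed[OF r]
  obtain e where e: "e \<in> Hom E Z Z"
    and e\<xi>: "\<And>W x. W \<in> Ob E \<Longrightarrow> x \<in> carrier (FOb F W) \<Longrightarrow> \<xi> W (\<iota> W (\<rho> W x)) = e \<cdot> \<xi> W x"
    by (rule locally_iso_factor[OF F L natural_comp[OF natural_comp[OF r i] L1(2)] L1(1)]) (rule that)
  have "(e \<cdot> e) \<cdot> \<xi> W x = e \<cdot> \<xi> W x" if W: "W \<in> Ob E" and x: "x \<in> carrier (FOb F W)" for W x
  proof -
    have "(e \<cdot> e) \<cdot> \<xi> W x = e \<cdot> \<xi> W (\<iota> W (\<rho> W x))"
      using comp_right1[OF \<xi>H[OF W x] e e refl] e\<xi>[OF W x] by simp
    also have "\<dots> = e \<cdot> \<xi> W x"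
      using e\<xi>[OF W ic'[OF W rc[OF W x]]] ri[OF W rc[OF W x]] e\<xi>[OF W x] by simp
    finally show ?thesis .
  qed
  then have "e \<cdot> e = e" using locally_iso_epi[OF L Comp_Hom[OF e e] e] by blast
  then obtain Z' p s where Z': "Z' \<in> Ob E" and p: "p \<in> Hom E Z Z'" and s: "s \<in> Hom E Z' Z"
    and sp: "s \<cdot> p = e" and ps: "p \<cdot> s = Ident E Z'"
    using ic L1(1) e unfolding idempotent_complete_def by blast
  define \<xi>' where "\<xi>' = (\<lambda>W a. p \<cdot> \<xi> W (\<iota> W a))"
  have n: "natural E A (\<Upsilon> E Z') \<xi>'"
    using natural_comp[OF natural_comp[OF i L1(2)] natural_Yo_map[OF p]] by (simp add: Yo_map_def \<xi>'_def)
  have "locally_iso A Z' \<xi>'"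
    unfolding locally_iso_def
  proof (intro conjI ballI impI Z' n)
    fix W a assume W: "W \<in> Ob E" and a: "a \<in> carrier (FOb A W)" "\<xi>' W a = Zero E W Z'"
    note ia = ic'[OF W a(1)]
    have "\<xi> W (\<iota> W a) = e \<cdot> \<xi> W (\<iota> W a)" using e\<xi>[OF W ia] ri[OF W a(1)] by simp
    also have "\<dots> = s \<cdot> \<xi>' W a" using comp_left1[OF \<xi>H[OF W ia] p s sp] by (simp add: \<xi>'_def)
    finally have "\<xi> W (\<iota> W a) = Zero E W Z" using a(2) Comp_Zero[OF s W] by simp
    then obtain V t where t: "t \<in> Hom E V W" "deflation E t" "FArr F t (\<iota> W a) = \<one>\<^bsub>FOb F V\<^esub>"
      using locally_iso_kernel[OF L W ia] by blast
    have V: "V \<in> Ob E" using t Hom_Ob by auto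
    have "FArr A t a = \<rho> V (FArr F t (\<iota> W a))"
      using natural_arr[OF r t(1) ia] ri[OF W a(1)] by simp
    then have "FArr A t a = \<one>\<^bsub>FOb A V\<^esub>" using t(3) natural_one[OF r F A V] by simp
    then show "\<exists>V. \<exists>p\<in>Hom E V W. deflation E p \<and> FArr A p a = \<one>\<^bsub>FOb A V\<^esub>" using t by blast
  next
    fix W w assume W: "W \<in> Ob E" and w: "w \<in> Hom E W Z'"
    obtain V t x where t: "t \<in> Hom E V W" "deflation E t" and x: "x \<in> carrier (FOb F V)" "\<xi> V x = (s \<cdot> w) \<cdot> t"
      using locally_iso_cokernel[OF L Comp_Hom[OF w s]] .
    have V: "V \<in> Ob E" using t Hom_Ob by auto
    have pe: "p \<cdot> e = p" using comp_left1[OF p s p ps] Ident_Comp[OF p] sp by simp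
    have "\<xi>' V (\<rho> V x) = p \<cdot> (e \<cdot> \<xi> V x)" using e\<xi>[OF V x(1)] by (simp add: \<xi>'_def)
    also have "\<dots> = p \<cdot> (s \<cdot> (w \<cdot> t))"
      using comp_left1[OF \<xi>H[OF V x(1)] e p pe] x(2) Comp_assoc[OF t(1) w s] by simp
    also have "\<dots> = w \<cdot> t"
      using comp_left1[OF Comp_Hom[OF t(1) w] s p ps] Ident_Comp[OF Comp_Hom[OF t(1) w]] by simp
    finally show "\<exists>V. \<exists>p\<in>Hom E V W. deflation E p \<and> (\<exists>x\<in>carrier (FOb A V). \<xi>' V x = w \<cdot> p)"
      using t rc[OF V x(1)] by blast
  qed
  then show ?thesis using that by blast
qed

text \<open>\<open>\<beta>\<close> induces an arrow \<open>d\<close> between the representing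
  objects. Some deflation onto \<open>Z'\<close> lifts to a section of \<open>H\<close>, then of
  \<open>G\<close>, and so factors through \<open>d\<close>; hence \<open>d\<close> is a deflation,
  and its kernel represents the sheafification of \<open>F\<close>.\<close>

lemma locally_iso_kernel_term:
  assumes ic: "idempotent_complete E" and S: "short_exact F \<alpha> G \<beta> H"
    and LG: "locally_iso G Z \<xi>" and LH: "locally_iso H Z' \<xi>'"
  obtains K \<zeta> where "locally_iso F K \<zeta>"
proof -
  note s = short_exactD[OF S] and G1 = locally_isoD[OF LG] and H1 = locally_isoD[OF LH]
  have GH: "\<xi> W x \<in> Hom E W Z" if "W \<in> Ob E" "x \<in> carrier (FOb G W)" for W x
    using natural_closed[OF G1(2) that] by simp
  obtain d where d: "d \<in> Hom E Z Z'"
    and d\<xi>: "\<And>W x. W \<in> Ob E \<Longrightarrow> x \<in> carrier (FOb G W) \<Longrightarrow> \<xi>' W (\<beta> W x) = d \<cdot> \<xi> W x"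
    by (rule locally_iso_factor[OF s(2) LG natural_comp[OF s(5) H1(2)] H1(1)]) (rule that)
  obtain V t x where t: "t \<in> Hom E V Z'" "deflation E t" and x: "x \<in> carrier (FOb H V)" "\<xi>' V x = Ident E Z' \<cdot> t"
    using locally_iso_cokernel[OF LH Ident_Hom[OF H1(1)]] .
  have V: "V \<in> Ob E" using t Hom_Ob by auto
  obtain y where y: "y \<in> carrier (FOb G V)" "\<beta> V y = x" using s(9)[OF V x(1)] by blast
  have "d \<cdot> \<xi> V y = t" using d\<xi>[OF V y(1)] y(2) x(2) Ident_Comp[OF t(1)] by simp
  then have dd: "deflation E d" using deflation_cancel[OF ic GH[OF V y(1)] d] t(2) by simp
  obtain K k where c: "conflation E K k Z d Z'" using deflationE[OF dd d] .
  note k = conflationD[OF c]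
  have K: "K \<in> Ob E" using k Hom_Ob by auto
  have "\<exists>z \<in> Hom E W K. k \<cdot> z = \<xi> W (\<alpha> W x)" if W: "W \<in> Ob E" and x: "x \<in> carrier (FOb F W)" for W x
  proof -
    note ax = natural_closed[OF s(4) W x]
    have "d \<cdot> \<xi> W (\<alpha> W x) = Zero E W Z'"
      using d\<xi>[OF W ax] s(8)[OF W x] natural_one[OF H1(2) s(3) Yo_functor[OF H1(1)] W] by simp
    then show ?thesis using conflation_lift[OF c GH[OF W ax]] by metis
  qed
  then obtain \<zeta> where \<zeta>: "\<And>W x. W \<in> Ob E \<Longrightarrow> x \<in> carrier (FOb F W) \<Longrightarrow>
      \<zeta> W x \<in> Hom E W K \<and> k \<cdot> \<zeta> W x = \<xi> W (\<alpha> W x)"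
    by metis
  note kn = natural_comp[OF s(4) G1(2)]
  \<comment> \<open>The values of \<open>\<zeta>\<close> were chosen one by one; they fit together
    because \<open>k\<close> is monic and \<open>\<xi> \<alpha>\<close> is natural.\<close>
  have n: "natural E F (\<Upsilon> E K) \<zeta>"
  proof (rule naturalI)
    fix X x y assume X: "X \<in> Ob E" and x: "x \<in> carrier (FOb F X)" and y: "y \<in> carrier (FOb F X)"
    show "\<zeta> X x \<in> carrier (FOb (\<Upsilon> E K) X)" using \<zeta>[OF X x] by simp
    note xy = functor_mult_closed[OF s(1) X x y]
    have "k \<cdot> \<zeta> X (x \<otimes>\<^bsub>FOb F X\<^esub> y) = k \<cdot> Add E (\<zeta> X x) (\<zeta> X y)"
      using \<zeta>[OF X xy] natural_mult[OF kn X x y] Comp_Add[of "\<zeta> X x" X K "\<zeta> X y" k Z] \<zeta>[OF X x] \<zeta>[OF X y] k(1) by simp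
    then show "\<zeta> X (x \<otimes>\<^bsub>FOb F X\<^esub> y) = \<zeta> X x \<otimes>\<^bsub>FOb (\<Upsilon> E K) X\<^esub> \<zeta> X y"
      using conflation_mono[OF c _ Add_Hom[of "\<zeta> X x" X K "\<zeta> X y"]] \<zeta>[OF X xy] \<zeta>[OF X x] \<zeta>[OF X y]
      by simp
  next
    fix X Y f x assume f: "f \<in> Hom E X Y" and x: "x \<in> carrier (FOb F Y)"
    have X: "X \<in> Ob E" "Y \<in> Ob E" using f Hom_Ob by auto
    have z: "\<zeta> Y x \<in> Hom E Y K" using \<zeta>[OF X(2) x] by simp
    note fx = functor_closed[OF s(1) f x]
    have "k \<cdot> \<zeta> X (FArr F f x) = k \<cdot> (\<zeta> Y x \<cdot> f)"
      using \<zeta>[OF X(1) fx] \<zeta>[OF X(2) x] natural_arr[OF kn f x] Comp_assoc[OF f z k(1)] by simp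
    then show "\<zeta> X (FArr F f x) = FArr (\<Upsilon> E K) f (\<zeta> Y x)"
      using conflation_mono[OF c _ Comp_Hom[OF f z]] \<zeta>[OF X(1) fx] by simp
  qed
  have "locally_iso F K \<zeta>"
    unfolding locally_iso_def
  proof (intro conjI ballI impI K n)
    fix W x assume W: "W \<in> Ob E" and x: "x \<in> carrier (FOb F W)" "\<zeta> W x = Zero E W K"
    note ax = natural_closed[OF s(4) W x(1)]
    have "\<xi> W (\<alpha> W x) = Zero E W Z" using \<zeta>[OF W x(1)] x(2) Comp_Zero[OF k(1) W] by simp
    then obtain V t where t: "t \<in> Hom E V W" "deflation E t" "FArr G t (\<alpha> W x) = \<one>\<^bsub>FOb G V\<^esub>"
      using locally_iso_kernel[OF LG W ax] by blast
    have V: "V \<in> Ob E" using t Hom_Ob by auto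
    have "\<alpha> V (FArr F t x) = \<alpha> V \<one>\<^bsub>FOb F V\<^esub>"
      using natural_arr[OF s(4) t(1) x(1)] t(3) natural_one[OF s(4,1,2) V] by simp
    then have "FArr F t x = \<one>\<^bsub>FOb F V\<^esub>"
      using s(6)[OF V functor_closed[OF s(1) t(1) x(1)] functor_one_closed[OF s(1) V]] by simp
    then show "\<exists>V. \<exists>p\<in>Hom E V W. deflation E p \<and> FArr F p x = \<one>\<^bsub>FOb F V\<^esub>" using t by blast
  next
    fix W w assume W: "W \<in> Ob E" and w: "w \<in> Hom E W K"
    obtain V t x where t: "t \<in> Hom E V W" "deflation E t" and x: "x \<in> carrier (FOb G V)" "\<xi> V x = (k \<cdot> w) \<cdot> t"
      using locally_iso_cokernel[OF LG Comp_Hom[OF w k(1)]] .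
    have V: "V \<in> Ob E" using t Hom_Ob by auto
    note wt = Comp_Hom[OF t(1) w]
    have xk: "\<xi> V x = k \<cdot> (w \<cdot> t)" using x(2) Comp_assoc[OF t(1) w k(1)] by simp
    \<comment> \<open>The local lift \<open>x\<close> to \<open>G\<close> need not come from
      \<open>F\<close>. Its image in \<open>H\<close> is killed by \<open>\<xi>'\<close>, hence
      vanishes on a further deflation \<open>u\<close>, and there exactness yields a section of
      \<open>F\<close>.\<close>
    have "\<xi>' V (\<beta> V x) = Zero E V Z'"
      using d\<xi>[OF V x(1)] xk comp_left1[OF wt k(1,2,5)] Zero_Comp[OF wt H1(1)] by simp
    then obtain U u where u: "u \<in> Hom E U V" "deflation E u" "FArr H u (\<beta> V x) = \<one>\<^bsub>FOb H U\<^esub>"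
      using locally_iso_kernel[OF LH V natural_closed[OF s(5) V x(1)]] by blast
    have U: "U \<in> Ob E" using u Hom_Ob by auto
    obtain a where a: "a \<in> carrier (FOb F U)" "FArr G u x = \<alpha> U a"
      using s(7)[OF U functor_closed[OF s(2) u(1) x(1)]] natural_arr[OF s(5) u(1) x(1)] u(3) by auto
    have "k \<cdot> \<zeta> U a = k \<cdot> (w \<cdot> (t \<cdot> u))"
      using \<zeta>[OF U a(1)] a(2) natural_arr[OF G1(2) u(1) x(1)] xk Comp_assoc[OF u(1) wt k(1)]
        Comp_assoc[OF u(1) t(1) w] by simp
    then have "\<zeta> U a = w \<cdot> (t \<cdot> u)"
      using conflation_mono[OF c _ Comp_Hom[OF Comp_Hom[OF u(1) t(1)] w]] \<zeta>[OF U a(1)] by simp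
    then show "\<exists>V. \<exists>p\<in>Hom E V W. deflation E p \<and> (\<exists>x\<in>carrier (FOb F V). \<zeta> V x = w \<cdot> p)"
      using deflation_comp[OF u(2) t(2) u(1) t(1)] Comp_Hom[OF u(1) t(1)] a(1) by blast
  qed
  then show ?thesis using that by blast
qed

text \<open>
  The extension is classified by the map \<open>c'\<close> below, along which the resolving conflation of \<open>H\<close> is
  pushed out. The sections of \<open>G\<close> are the sums \<open>\<phi>(w) + \<alpha>(a)\<close>, where \<open>\<phi>\<close> lifts \<open>\<pi>\<close> to \<open>G\<close>;
  they are sent to \<open>y' w + k \<xi>(a)\<close> in the pushout.
\<close>

lemma locally_iso_extension:
  assumes S: "short_exact F \<alpha> G \<beta> H" and LF: "locally_iso F K \<xi>"
    and P: "presents (m \<cdot> p) X Y H \<pi>" and p: "deflation E p" "p \<in> Hom E X I"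
    and c: "conflation E I m Y q Z"
  obtains M \<zeta> where "locally_iso G M \<zeta>"
proof -
  note s = short_exactD[OF S] and L1 = locally_isoD[OF LF] and P1 = presentsD[OF P] and m = conflationD[OF c]
  have Ob: "X \<in> Ob E" "Y \<in> Ob E" "I \<in> Ob E" "Z \<in> Ob E" "K \<in> Ob E" using m p L1(1) Hom_Ob by auto
  have \<xi>H: "\<xi> W x \<in> Hom E W K" if "W \<in> Ob E" "x \<in> carrier (FOb F W)" for W x
    using natural_closed[OF L1(2) that] by simp
  have \<xi>arr: "\<xi> V (FArr F f x) = \<xi> W x \<cdot> f" if "f \<in> Hom E V W" "x \<in> carrier (FOb F W)" for V W f x
    using natural_arr[OF L1(2) that] by simp
  define f where "f = m \<cdot> p"
  have f: "f \<in> Hom E X Y" using P1(1) f_def by simp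
  \<comment> \<open>By Yoneda, lifting \<open>\<pi>\<close> through \<open>\<beta>\<close> amounts
    to lifting its value at the identity.\<close>
  have "\<pi> Y (Ident E Y) \<in> carrier (FOb H Y)" using natural_closed[OF P1(2) Ob(2)] Ident_Hom[OF Ob(2)] by simp
  then obtain y where y: "y \<in> carrier (FOb G Y)" "\<beta> Y y = \<pi> Y (Ident E Y)" using s(9)[OF Ob(2)] by blast
  define \<phi> where "\<phi> W w = FArr G w y" for W :: 'o and w
  have n\<phi>: "natural E (\<Upsilon> E Y) G \<phi>" using natural_of_element[OF s(2) Ob(2) y(1)] by (simp add: \<phi>_def[abs_def])
  have \<phi>H: "\<phi> W w \<in> carrier (FOb G W)" if "w \<in> Hom E W Y" for W w
    using functor_closed[OF s(2) that y(1)] by (simp add: \<phi>_def)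
  have \<phi>arr: "FArr G t (\<phi> W w) = \<phi> V (w \<cdot> t)" if "t \<in> Hom E V W" "w \<in> Hom E W Y" for V W t w
    using natural_arr[OF n\<phi> that(1), of w] that(2) by simp
  have \<beta>\<phi>: "\<beta> W (\<phi> W w) = \<pi> W w" if w: "w \<in> Hom E W Y" for W w
    using natural_arr[OF s(5) w y(1)] y(2) presents_nat[OF P Ob(2) w Ident_Hom[OF Ob(2)]] Ident_Comp[OF w]
    by (simp add: \<phi>_def)
  have \<pi>f: "\<pi> W (f \<cdot> v) = \<one>\<^bsub>FOb H W\<^esub>" if "v \<in> Hom E W X" for W v
    using P1(4)[OF Comp_Hom[OF that f]] that f_def by blast
  \<comment> \<open>\<open>\<phi>\<close> need not vanish on \<open>f\<close> although
    \<open>\<pi>\<close> does. The section \<open>x\<close> of \<open>F\<close> measures the failure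
    and carries the information about the extension.\<close>
  have "\<pi> X f = \<one>\<^bsub>FOb H X\<^esub>" using \<pi>f[OF Ident_Hom[OF Ob(1)]] Comp_Ident[OF f] by simp
  then obtain x where x: "x \<in> carrier (FOb F X)" "\<phi> X f = \<alpha> X x"
    using s(7)[OF Ob(1) \<phi>H[OF f]] \<beta>\<phi>[OF f] by auto
  define c1 where "c1 = \<xi> X x"
  have c1: "c1 \<in> Hom E X K" using \<xi>H[OF Ob(1) x(1)] by (simp add: c1_def)
  have \<phi>f: "\<phi> W (f \<cdot> v) = \<alpha> W (FArr F v x)" if v: "v \<in> Hom E W X" for W v
    using \<phi>arr[OF v f] natural_arr[OF s(4) v x(1)] x(2) by simp
  obtain N l where cN: "conflation E N l X p I" using deflationE[OF p] .
  note l = conflationD[OF cN]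
  have N: "N \<in> Ob E" using l Hom_Ob by auto
  \<comment> \<open>\<open>c1\<close> starts at \<open>X\<close>; it descends along \<open>p\<close>
    because \<open>x\<close> restricts to the neutral section on the kernel of \<open>p\<close>, as
    \<open>\<alpha>\<close> is injective.\<close>
  have "f \<cdot> l = Zero E N Y" using comp_right1[OF l(1) p(2) m(1) l(5)] Comp_Zero[OF m(1) N] f_def by simp
  then have "\<alpha> N (FArr F l x) = \<alpha> N \<one>\<^bsub>FOb F N\<^esub>"
    using \<phi>f[OF l(1)] natural_one[OF n\<phi> Yo_functor[OF Ob(2)] s(2) N] natural_one[OF s(4,1,2) N] by simp
  then have "FArr F l x = \<one>\<^bsub>FOb F N\<^esub>"
    using s(6)[OF N functor_closed[OF s(1) l(1) x(1)] functor_one_closed[OF s(1) N]] by simp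
  then have "c1 \<cdot> l = Zero E N K"
    using \<xi>arr[OF l(1) x(1)] natural_one[OF L1(2) s(1) Yo_functor[OF Ob(5)] N] by (simp add: c1_def)
  then obtain c' where c': "c' \<in> Hom E I K" "c' \<cdot> p = c1" using conflation_desc[OF cN c1] by blast
  obtain M k d y' where cM: "conflation E K k M d Z" and y': "y' \<in> Hom E Y M" "y' \<cdot> m = k \<cdot> c'" "d \<cdot> y' = q"
    using conflation_pushforward[OF c c'(1)] .
  note k = conflationD[OF cM]
  have M: "M \<in> Ob E" using k Hom_Ob by auto
  \<comment> \<open>The pushout square precomposed with \<open>p\<close>: the relation in
    \<open>M\<close> that matches \<open>\<phi>f\<close> in \<open>G\<close>, and the reason why the
    assignment on sums is well defined.\<close>
  have y'f: "y' \<cdot> (f \<cdot> v) = k \<cdot> \<xi> W (FArr F v x)" if v: "v \<in> Hom E W X" for W v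
  proof -
    have "f \<cdot> v = m \<cdot> (p \<cdot> v)" using Comp_assoc[OF v p(2) m(1)] f_def by simp
    then have "y' \<cdot> (f \<cdot> v) = k \<cdot> (c' \<cdot> (p \<cdot> v))"
      using comp_left[OF Comp_Hom[OF v p(2)] m(1) y'(1) c'(1) k(1) y'(2)] by simp
    then show ?thesis using comp_left1[OF v p(2) c'(1,2)] \<xi>arr[OF v x(1)] by (simp add: c1_def)
  qed
  define R where "R W g z \<longleftrightarrow> (\<exists>w\<in>Hom E W Y. \<exists>a\<in>carrier (FOb F W).
    g = \<phi> W w \<otimes>\<^bsub>FOb G W\<^esub> \<alpha> W a \<and> z = Add E (y' \<cdot> w) (k \<cdot> \<xi> W a))" for W g z
  have zH: "y' \<cdot> w \<in> Hom E W M" "k \<cdot> \<xi> W a \<in> Hom E W M"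
    if "w \<in> Hom E W Y" "a \<in> carrier (FOb F W)" for W w a
    using Comp_Hom[OF that(1) y'(1)] Comp_Hom[OF \<xi>H[OF Hom_Ob(1)[OF that(1)] that(2)] k(1)] by simp_all
  have Rarr: "R V (FArr G t g) (z \<cdot> t)" if t: "t \<in> Hom E V W" and R: "R W g z" for V W t g z
  proof -
    have W: "V \<in> Ob E" "W \<in> Ob E" using t Hom_Ob by auto
    obtain w a where w: "w \<in> Hom E W Y" and a: "a \<in> carrier (FOb F W)"
      and g: "g = \<phi> W w \<otimes>\<^bsub>FOb G W\<^esub> \<alpha> W a" and z: "z = Add E (y' \<cdot> w) (k \<cdot> \<xi> W a)"
      using R R_def by blast
    have "FArr G t g = \<phi> V (w \<cdot> t) \<otimes>\<^bsub>FOb G V\<^esub> \<alpha> V (FArr F t a)"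
      using g functor_mult[OF s(2) t \<phi>H[OF w] natural_closed[OF s(4) W(2) a]] \<phi>arr[OF t w]
        natural_arr[OF s(4) t a] by simp
    moreover have "z \<cdot> t = Add E (y' \<cdot> (w \<cdot> t)) (k \<cdot> \<xi> V (FArr F t a))"
      using z Add_Comp[OF t zH[OF w a]] Comp_assoc[OF t w y'(1)] Comp_assoc[OF t \<xi>H[OF W(2) a] k(1)]
        \<xi>arr[OF t a] by simp
    ultimately show ?thesis unfolding R_def using Comp_Hom[OF t w] functor_closed[OF s(1) t a] by blast
  qed
  \<comment> \<open>Over an arrow \<open>f \<cdot> v\<close>, the sum in \<open>G\<close> and its
    prospective value come from one and the same section of \<open>F\<close>. This settles both
    well-definedness at the neutral section and local injectivity.\<close>
  have key: "z = k \<cdot> \<xi> W (FArr F v x \<otimes>\<^bsub>FOb F W\<^esub> a) \<and> g = \<alpha> W (FArr F v x \<otimes>\<^bsub>FOb F W\<^esub> a)"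
    if v: "v \<in> Hom E W X" and a: "a \<in> carrier (FOb F W)"
      and g: "g = \<phi> W (f \<cdot> v) \<otimes>\<^bsub>FOb G W\<^esub> \<alpha> W a" and z: "z = Add E (y' \<cdot> (f \<cdot> v)) (k \<cdot> \<xi> W a)" for W v a g z
  proof -
    have W: "W \<in> Ob E" using v Hom_Ob by auto
    note vx = functor_closed[OF s(1) v x(1)]
    have "g = \<alpha> W (FArr F v x \<otimes>\<^bsub>FOb F W\<^esub> a)" using g \<phi>f[OF v] natural_mult[OF s(4) W vx a] by simp
    moreover have "z = k \<cdot> \<xi> W (FArr F v x \<otimes>\<^bsub>FOb F W\<^esub> a)"
      using z y'f[OF v] natural_mult[OF L1(2) W vx a] Comp_Add[OF \<xi>H[OF W vx] \<xi>H[OF W a] k(1)] by simp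
    ultimately show ?thesis by simp
  qed
  have Rtot: "\<exists>z. R W g z" if W: "W \<in> Ob E" and g: "g \<in> carrier (FOb G W)" for W g
  proof -
    \<comment> \<open>Subtracting \<open>\<phi> W w\<close>, where \<open>w\<close> represents the
      image of \<open>g\<close> in \<open>H\<close>, leaves a section killed by
      \<open>\<beta>\<close>, hence one from \<open>F\<close>.\<close>
    obtain w where w: "w \<in> Hom E W Y" "\<pi> W w = \<beta> W g" using P1(3)[OF W natural_closed[OF s(5) W g]] by blast
    obtain b where b: "b \<in> carrier (FOb G W)" "\<phi> W w \<otimes>\<^bsub>FOb G W\<^esub> b = g" "b \<otimes>\<^bsub>FOb G W\<^esub> \<phi> W w = g"
      using functor_diff[OF s(2) W g \<phi>H[OF w(1)]] by metis
    note bw = natural_closed[OF s(5) W \<phi>H[OF w(1)]] and bb = natural_closed[OF s(5) W b(1)]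
    have "\<beta> W b \<otimes>\<^bsub>FOb H W\<^esub> \<beta> W (\<phi> W w) = \<one>\<^bsub>FOb H W\<^esub> \<otimes>\<^bsub>FOb H W\<^esub> \<beta> W (\<phi> W w)"
      using natural_mult[OF s(5) W b(1) \<phi>H[OF w(1)]] b(3) \<beta>\<phi>[OF w(1)] w(2) functor_l_one(1)[OF s(3) W bw] by simp
    then have "\<beta> W b = \<one>\<^bsub>FOb H W\<^esub>" using functor_cancel[OF s(3) W bb functor_one_closed[OF s(3) W] bw] by simp
    then obtain a where "a \<in> carrier (FOb F W)" "b = \<alpha> W a" using s(7)[OF W b(1)] by blast
    then show ?thesis unfolding R_def using w(1) b(2) by blast
  qed
  obtain \<zeta> where \<zeta>: "natural E G (\<Upsilon> E M) \<zeta>" "\<And>W g z. W \<in> Ob E \<Longrightarrow> R W g z \<Longrightarrow> \<zeta> W g = z"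
  proof (rule natural_of_rel[OF s(2) Yo_functor[OF M], of R])
    show "\<exists>z. R W g z" if "W \<in> Ob E" "g \<in> carrier (FOb G W)" for W g using Rtot[OF that] .
    show "g \<in> carrier (FOb G W) \<and> z \<in> carrier (FOb (\<Upsilon> E M) W)" if W: "W \<in> Ob E" and R: "R W g z" for W g z
      using R functor_mult_closed[OF s(2) W] \<phi>H natural_closed[OF s(4) W] zH Add_Hom by (auto simp: R_def)
    show "R W (g \<otimes>\<^bsub>FOb G W\<^esub> g') (z \<otimes>\<^bsub>FOb (\<Upsilon> E M) W\<^esub> z')"
      if W: "W \<in> Ob E" and R: "R W g z" "R W g' z'" for W g z g' z'
    proof -
      obtain w a w' a' where w: "w \<in> Hom E W Y" "a \<in> carrier (FOb F W)" "w' \<in> Hom E W Y" "a' \<in> carrier (FOb F W)"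
        and g: "g = \<phi> W w \<otimes>\<^bsub>FOb G W\<^esub> \<alpha> W a" "g' = \<phi> W w' \<otimes>\<^bsub>FOb G W\<^esub> \<alpha> W a'"
        and z: "z = Add E (y' \<cdot> w) (k \<cdot> \<xi> W a)" "z' = Add E (y' \<cdot> w') (k \<cdot> \<xi> W a')"
        using R unfolding R_def by blast
      note aa = natural_closed[OF s(4) W w(2)] natural_closed[OF s(4) W w(4)]
      have "g \<otimes>\<^bsub>FOb G W\<^esub> g' = \<phi> W (Add E w w') \<otimes>\<^bsub>FOb G W\<^esub> \<alpha> W (a \<otimes>\<^bsub>FOb F W\<^esub> a')"
        using g functor_interchange[OF s(2) W \<phi>H[OF w(1)] aa(1) \<phi>H[OF w(3)] aa(2)]
          natural_mult[OF s(4) W w(2,4)] natural_mult[OF n\<phi> W, of w w'] w by simp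
      moreover have "Add E z z' = Add E (y' \<cdot> Add E w w') (k \<cdot> \<xi> W (a \<otimes>\<^bsub>FOb F W\<^esub> a'))"
        using z functor_interchange[OF Yo_functor[OF M] W, of "y' \<cdot> w" "k \<cdot> \<xi> W a" "y' \<cdot> w'" "k \<cdot> \<xi> W a'"]
          zH[OF w(1,2)] zH[OF w(3,4)] Comp_Add[OF w(1,3) y'(1)] natural_mult[OF L1(2) W w(2,4)]
          Comp_Add[OF \<xi>H[OF W w(2)] \<xi>H[OF W w(4)] k(1)] by simp
      ultimately show ?thesis
        unfolding R_def using Add_Hom[OF w(1,3)] functor_mult_closed[OF s(1) W w(2,4)] by auto
    qed
    show "R V (FArr G t g) (FArr (\<Upsilon> E M) t z)" if "t \<in> Hom E V W" "R W g z" for V W t g z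
      using Rarr[OF that] by simp
    show "z = \<one>\<^bsub>FOb (\<Upsilon> E M) W\<^esub>" if W: "W \<in> Ob E" and R: "R W \<one>\<^bsub>FOb G W\<^esub> z" for W z
    proof -
      obtain w a where w: "w \<in> Hom E W Y" and a: "a \<in> carrier (FOb F W)"
        and g: "\<one>\<^bsub>FOb G W\<^esub> = \<phi> W w \<otimes>\<^bsub>FOb G W\<^esub> \<alpha> W a" and z: "z = Add E (y' \<cdot> w) (k \<cdot> \<xi> W a)"
        using R R_def by blast
      have "\<pi> W w \<in> carrier (FOb H W)" using natural_closed[OF P1(2) W] w by simp
      then have "\<pi> W w = \<one>\<^bsub>FOb H W\<^esub>"
        using natural_mult[OF s(5) W \<phi>H[OF w] natural_closed[OF s(4) W a]] g natural_one[OF s(5,2,3) W]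
          s(8)[OF W a] \<beta>\<phi>[OF w] functor_l_one(2)[OF s(3) W] by simp
      then obtain v where v: "v \<in> Hom E W X" "w = f \<cdot> v" using P1(4)[OF w] f_def by blast
      let ?b = "FArr F v x \<otimes>\<^bsub>FOb F W\<^esub> a"
      have b: "?b \<in> carrier (FOb F W)" using functor_mult_closed[OF s(1) W functor_closed[OF s(1) v(1) x(1)] a] .
      have zb: "z = k \<cdot> \<xi> W ?b" "\<one>\<^bsub>FOb G W\<^esub> = \<alpha> W ?b" using key[OF v(1) a] g z v(2) by auto
      then have "?b = \<one>\<^bsub>FOb F W\<^esub>"
        using s(6)[OF W b functor_one_closed[OF s(1) W]] natural_one[OF s(4,1,2) W] by simp
      then show ?thesis using zb(1) natural_one[OF L1(2) s(1) Yo_functor[OF Ob(5)] W] Comp_Zero[OF k(1) W] by simp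
    qed
  qed blast
  have "locally_iso G M \<zeta>"
    unfolding locally_iso_def
  proof (intro conjI ballI impI M \<zeta>(1))
    fix W g assume W: "W \<in> Ob E" and g: "g \<in> carrier (FOb G W)" "\<zeta> W g = Zero E W M"
    obtain z where R: "R W g z" using Rtot[OF W g(1)] by blast
    then have z0: "z = Zero E W M" using \<zeta>(2)[OF W R] g(2) by simp
    obtain w a where w: "w \<in> Hom E W Y" and a: "a \<in> carrier (FOb F W)"
      and ge: "g = \<phi> W w \<otimes>\<^bsub>FOb G W\<^esub> \<alpha> W a" and z: "z = Add E (y' \<cdot> w) (k \<cdot> \<xi> W a)"
      using R R_def by blast
    note h = zH[OF w a]
    \<comment> \<open>Applying \<open>d\<close> isolates the contribution of \<open>Y\<close> to
      \<open>z\<close>. It vanishes, so \<open>w\<close> factors through \<open>m\<close>, and on a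
      deflation through \<open>f\<close>, where \<open>key\<close> applies.\<close>
    have "d \<cdot> (y' \<cdot> w) = q \<cdot> w" using comp_left1[OF w y'(1) k(2) y'(3)] .
    moreover have "d \<cdot> (k \<cdot> \<xi> W a) = Zero E W Z"
      using comp_left1[OF \<xi>H[OF W a] k(1,2,5)] Zero_Comp[OF \<xi>H[OF W a] Ob(4)] by simp
    ultimately have "d \<cdot> z = q \<cdot> w" using Comp_Add[OF h k(2)] z Add_Zero(1)[OF Comp_Hom[OF w m(2)]] by simp
    then have "q \<cdot> w = Zero E W Z" using z0 Comp_Zero[OF k(2) W] by simp
    then obtain u where u: "u \<in> Hom E W I" "m \<cdot> u = w" using conflation_lift[OF c w] by blast
    obtain t V v where t: "deflation E t" "t \<in> Hom E V W" and v: "v \<in> Hom E V X" "p \<cdot> v = u \<cdot> t"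
      using pullback_deflation[OF p u(1)] by metis
    have V: "V \<in> Ob E" using t Hom_Ob by auto
    have wt: "w \<cdot> t = f \<cdot> v"
      using Comp_assoc[OF t(2) u(1) m(1)] Comp_assoc[OF v(1) p(2) m(1)] u(2) v(2) f_def by simp
    note ta = functor_closed[OF s(1) t(2) a]
    let ?b = "FArr F v x \<otimes>\<^bsub>FOb F V\<^esub> FArr F t a"
    have b: "?b \<in> carrier (FOb F V)" using functor_mult_closed[OF s(1) V functor_closed[OF s(1) v(1) x(1)] ta] .
    have "FArr G t g = \<phi> V (f \<cdot> v) \<otimes>\<^bsub>FOb G V\<^esub> \<alpha> V (FArr F t a)"
      using ge functor_mult[OF s(2) t(2) \<phi>H[OF w] natural_closed[OF s(4) W a]] \<phi>arr[OF t(2) w]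
        natural_arr[OF s(4) t(2) a] wt by simp
    moreover have "z \<cdot> t = Add E (y' \<cdot> (f \<cdot> v)) (k \<cdot> \<xi> V (FArr F t a))"
      using z Add_Comp[OF t(2) h] Comp_assoc[OF t(2) w y'(1)] Comp_assoc[OF t(2) \<xi>H[OF W a] k(1)]
        \<xi>arr[OF t(2) a] wt by simp
    ultimately have e: "z \<cdot> t = k \<cdot> \<xi> V ?b" "FArr G t g = \<alpha> V ?b" using key[OF v(1) ta] by auto
    have "k \<cdot> \<xi> V ?b = k \<cdot> Zero E V K" using e(1) z0 Zero_Comp[OF t(2) M] Comp_Zero[OF k(1) V] by simp
    then have "\<xi> V ?b = Zero E V K" using conflation_mono[OF cM \<xi>H[OF V b] Zero_Hom[OF V Ob(5)]] by simp
    then obtain U r where r: "r \<in> Hom E U V" "deflation E r" "FArr F r ?b = \<one>\<^bsub>FOb F U\<^esub>"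
      using locally_iso_kernel[OF LF V b] by blast
    have U: "U \<in> Ob E" using r Hom_Ob by auto
    have "FArr G (t \<cdot> r) g = \<one>\<^bsub>FOb G U\<^esub>"
      using functor_Comp[OF s(2) r(1) t(2) g(1)] e(2) natural_arr[OF s(4) r(1) b] r(3)
        natural_one[OF s(4,1,2) U] by simp
    then show "\<exists>V. \<exists>p\<in>Hom E V W. deflation E p \<and> FArr G p g = \<one>\<^bsub>FOb G V\<^esub>"
      using deflation_comp[OF r(2) t(1) r(1) t(2)] Comp_Hom[OF r(1) t(2)] by blast
  next
    fix W w assume W: "W \<in> Ob E" and w: "w \<in> Hom E W M"
    note dw = Comp_Hom[OF w k(2)]
    obtain t V v where t: "deflation E t" "t \<in> Hom E V W" and v: "v \<in> Hom E V Y" "q \<cdot> v = (d \<cdot> w) \<cdot> t"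
      using pullback_deflation[OF m(4,2) dw] by metis
    have V: "V \<in> Ob E" using t Hom_Ob by auto
    note wt = Comp_Hom[OF t(2) w] and yv = Comp_Hom[OF v(1) y'(1)]
    \<comment> \<open>The arrow into \<open>M\<close> is reached in two stages: its image in
      \<open>Z\<close> lifts to \<open>Y\<close> over \<open>t\<close>, and the remaining error is
      killed by \<open>d\<close>, comes from \<open>K\<close> and is a value of \<open>\<xi>\<close>
      over \<open>r\<close>.\<close>
    have "d \<cdot> (w \<cdot> t) = d \<cdot> (y' \<cdot> v)"
      using Comp_assoc[OF t(2) w k(2)] comp_left1[OF v(1) y'(1) k(2) y'(3)] v(2) by simp
    then have "d \<cdot> Sub E (w \<cdot> t) (y' \<cdot> v) = Zero E V Z"
      using Comp_Sub[OF wt yv k(2)] Sub_self[OF Comp_Hom[OF yv k(2)]] by simp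
    then obtain u where u: "u \<in> Hom E V K" "k \<cdot> u = Sub E (w \<cdot> t) (y' \<cdot> v)"
      using conflation_lift[OF cM Sub_Hom[OF wt yv]] by blast
    obtain U r a where r: "r \<in> Hom E U V" "deflation E r" and a: "a \<in> carrier (FOb F U)" "\<xi> U a = u \<cdot> r"
      using locally_iso_cokernel[OF LF u(1)] .
    have U: "U \<in> Ob E" using r Hom_Ob by auto
    note vr = Comp_Hom[OF r(1) v(1)]
    have "w \<cdot> t = Add E (y' \<cdot> v) (k \<cdot> u)"
      using Sub_Add[OF wt yv] u(2) Add_commute[OF Sub_Hom[OF wt yv] yv] by simp
    then have "w \<cdot> (t \<cdot> r) = Add E (y' \<cdot> (v \<cdot> r)) (k \<cdot> \<xi> U a)"
      using Comp_assoc[OF r(1) t(2) w] Add_Comp[OF r(1) yv Comp_Hom[OF u(1) k(1)]]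
        Comp_assoc[OF r(1) v(1) y'(1)] Comp_assoc[OF r(1) u(1) k(1)] a(2) by simp
    then have "R U (\<phi> U (v \<cdot> r) \<otimes>\<^bsub>FOb G U\<^esub> \<alpha> U a) (w \<cdot> (t \<cdot> r))" unfolding R_def using vr a(1) by blast
    then have "\<zeta> U (\<phi> U (v \<cdot> r) \<otimes>\<^bsub>FOb G U\<^esub> \<alpha> U a) = w \<cdot> (t \<cdot> r)" using \<zeta>(2)[OF U] by blast
    moreover have "\<phi> U (v \<cdot> r) \<otimes>\<^bsub>FOb G U\<^esub> \<alpha> U a \<in> carrier (FOb G U)"
      using functor_mult_closed[OF s(2) U \<phi>H[OF vr] natural_closed[OF s(4) U a(1)]] .
    ultimately show "\<exists>V. \<exists>p\<in>Hom E V W. deflation E p \<and> (\<exists>x\<in>carrier (FOb G V). \<zeta> V x = w \<cdot> p)"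
      using deflation_comp[OF r(2) t(1) r(1) t(2)] Comp_Hom[OF r(1) t(2)] by blast
  qed
  then show ?thesis using that by blast
qed

end

section \<open>Resolving subcategories\<close>

context preadditive_category
begin

section \<open>Splittings and copies of representable functors\<close>

text \<open>The retraction onto \<open>K\<close> is \<open>y\<close> minus
  \<open>\<mu> (\<tau> y)\<close>, read back through \<open>\<sigma>\<close>;
  \<open>natural_of_rel\<close> makes a natural map of it. The summand \<open>H\<close> is listed
  first because \<open>resolving\<close> concludes about the first summand.\<close>

lemma short_exact_split:
  assumes S: "short_exact K \<sigma> G \<tau> H" and m: "natural C H G \<mu>"
    and \<tau>\<mu>: "\<And>W x. W \<in> Ob C \<Longrightarrow> x \<in> carrier (FOb H W) \<Longrightarrow> \<tau> W (\<mu> W x) = x"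
    and P2: "K \<in> P2_objects C" "G \<in> P2_objects C" "H \<in> P2_objects C"
  shows "biproduct (P2 C) H K G"
proof -
  note s = short_exactD[OF S]
  have \<mu>\<tau>: "\<mu> W (\<tau> W y) \<in> carrier (FOb G W)" if "W \<in> Ob C" "y \<in> carrier (FOb G W)" for W y
    using natural_closed[OF m that(1) natural_closed[OF s(5) that]] .
  define R where "R W y k \<longleftrightarrow> y \<in> carrier (FOb G W) \<and> k \<in> carrier (FOb K W) \<and>
    y = \<sigma> W k \<otimes>\<^bsub>FOb G W\<^esub> \<mu> W (\<tau> W y)" for W y k
  have R_total: "\<exists>k. R W y k" if W: "W \<in> Ob C" and y: "y \<in> carrier (FOb G W)" for W y
  proof -
    obtain z where z: "z \<in> carrier (FOb G W)" "z \<otimes>\<^bsub>FOb G W\<^esub> \<mu> W (\<tau> W y) = y"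
      using functor_diff[OF s(2) W y \<mu>\<tau>[OF W y]] by metis
    note c = natural_closed[OF s(5) W z(1)] natural_closed[OF s(5) W y]
    have "\<tau> W z \<otimes>\<^bsub>FOb H W\<^esub> \<tau> W y = \<one>\<^bsub>FOb H W\<^esub> \<otimes>\<^bsub>FOb H W\<^esub> \<tau> W y"
      using natural_mult[OF s(5) W z(1) \<mu>\<tau>[OF W y]] z(2) \<tau>\<mu>[OF W c(2)] functor_l_one(1)[OF s(3) W c(2)] by simp
    then have "\<tau> W z = \<one>\<^bsub>FOb H W\<^esub>"
      using functor_cancel[OF s(3) W c(1) functor_one_closed[OF s(3) W] c(2)] by simp
    then obtain k where "k \<in> carrier (FOb K W)" "z = \<sigma> W k" using s(7)[OF W z(1)] by blast
    then show ?thesis using z(2) y unfolding R_def by metis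
  qed
  obtain \<rho> where \<rho>: "natural C G K \<rho>" "\<And>W y k. W \<in> Ob C \<Longrightarrow> R W y k \<Longrightarrow> \<rho> W y = k"
  proof (rule natural_of_rel[OF s(2,1), of R])
    show "\<exists>k. R W y k" if "W \<in> Ob C" "y \<in> carrier (FOb G W)" for W y using R_total[OF that] .
    show "y \<in> carrier (FOb G W) \<and> k \<in> carrier (FOb K W)" if "R W y k" for W y k
      using that by (simp add: R_def)
    show "R W (y \<otimes>\<^bsub>FOb G W\<^esub> y') (k \<otimes>\<^bsub>FOb K W\<^esub> k')" if W: "W \<in> Ob C" and R: "R W y k" "R W y' k'" for W y k y' k'
    proof -
      have y: "y \<in> carrier (FOb G W)" "y' \<in> carrier (FOb G W)" and k: "k \<in> carrier (FOb K W)" "k' \<in> carrier (FOb K W)"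
        and e: "y = \<sigma> W k \<otimes>\<^bsub>FOb G W\<^esub> \<mu> W (\<tau> W y)" "y' = \<sigma> W k' \<otimes>\<^bsub>FOb G W\<^esub> \<mu> W (\<tau> W y')"
        using R by (auto simp: R_def)
      note ty = natural_closed[OF s(5) W y(1)] natural_closed[OF s(5) W y(2)]
      have "\<sigma> W (k \<otimes>\<^bsub>FOb K W\<^esub> k') \<otimes>\<^bsub>FOb G W\<^esub> \<mu> W (\<tau> W (y \<otimes>\<^bsub>FOb G W\<^esub> y')) =
        (\<sigma> W k \<otimes>\<^bsub>FOb G W\<^esub> \<mu> W (\<tau> W y)) \<otimes>\<^bsub>FOb G W\<^esub> (\<sigma> W k' \<otimes>\<^bsub>FOb G W\<^esub> \<mu> W (\<tau> W y'))"
        using natural_mult[OF s(4) W k] natural_mult[OF s(5) W y] natural_mult[OF m W ty]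
          functor_interchange[OF s(2) W natural_closed[OF s(4) W k(1)] \<mu>\<tau>[OF W y(1)]
            natural_closed[OF s(4) W k(2)] \<mu>\<tau>[OF W y(2)]] by simp
      then show ?thesis
        using e functor_mult_closed[OF s(2) W y] functor_mult_closed[OF s(1) W k] by (simp add: R_def)
    qed
    show "R V (FArr G f y) (FArr K f k)" if f: "f \<in> Hom C V W" and R: "R W y k" for V W f y k
    proof -
      have W: "W \<in> Ob C" using f Hom_Ob by auto
      have y: "y \<in> carrier (FOb G W)" and k: "k \<in> carrier (FOb K W)"
        and e: "y = \<sigma> W k \<otimes>\<^bsub>FOb G W\<^esub> \<mu> W (\<tau> W y)" using R by (auto simp: R_def)
      have "FArr G f (\<sigma> W k \<otimes>\<^bsub>FOb G W\<^esub> \<mu> W (\<tau> W y)) =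
        \<sigma> V (FArr K f k) \<otimes>\<^bsub>FOb G V\<^esub> \<mu> V (\<tau> V (FArr G f y))"
        using functor_mult[OF s(2) f natural_closed[OF s(4) W k] \<mu>\<tau>[OF W y]] natural_arr[OF s(4) f k]
          natural_arr[OF s(5) f y] natural_arr[OF m f natural_closed[OF s(5) W y]] by simp
      then show ?thesis using e functor_closed[OF s(2) f y] functor_closed[OF s(1) f k] by (simp add: R_def)
    qed
    show "k = \<one>\<^bsub>FOb K W\<^esub>" if W: "W \<in> Ob C" and R: "R W \<one>\<^bsub>FOb G W\<^esub> k" for W k
    proof -
      have k: "k \<in> carrier (FOb K W)" "\<one>\<^bsub>FOb G W\<^esub> = \<sigma> W k \<otimes>\<^bsub>FOb G W\<^esub> \<mu> W (\<tau> W \<one>\<^bsub>FOb G W\<^esub>)"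
        using R by (auto simp: R_def)
      then have "\<sigma> W k = \<sigma> W \<one>\<^bsub>FOb K W\<^esub>"
        using natural_one[OF s(5,2,3) W] natural_one[OF m s(3,2) W] natural_one[OF s(4,1,2) W]
          functor_l_one(2)[OF s(2) W natural_closed[OF s(4) W k(1)]] by simp
      then show ?thesis using s(6)[OF W k(1) functor_one_closed[OF s(1) W]] by simp
    qed
  qed blast
  have dec: "\<mu> W (\<tau> W y) \<otimes>\<^bsub>FOb G W\<^esub> \<sigma> W (\<rho> W y) = y" if W: "W \<in> Ob C" and y: "y \<in> carrier (FOb G W)" for W y
  proof -
    obtain k where k: "R W y k" using R_total[OF W y] by blast
    then have "k \<in> carrier (FOb K W)" "\<rho> W y = k" "y = \<sigma> W k \<otimes>\<^bsub>FOb G W\<^esub> \<mu> W (\<tau> W y)"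
      using \<rho>(2)[OF W k] by (auto simp: R_def)
    then show ?thesis
      using functor_mult_ac(2)[OF s(2) W \<mu>\<tau>[OF W y] natural_closed[OF s(4) W]] y by metis
  qed
  have \<rho>\<sigma>: "\<rho> W (\<sigma> W k) = k" if W: "W \<in> Ob C" and k: "k \<in> carrier (FOb K W)" for W k
  proof (rule \<rho>(2)[OF W])
    note sk = natural_closed[OF s(4) W k]
    show "R W (\<sigma> W k) k"
      using s(8)[OF W k] natural_one[OF m s(3,2) W] functor_l_one(2)[OF s(2) W sk] k sk by (simp add: R_def)
  qed
  have \<rho>\<mu>: "\<rho> W (\<mu> W h) = \<one>\<^bsub>FOb K W\<^esub>" if W: "W \<in> Ob C" and h: "h \<in> carrier (FOb H W)" for W h
  proof (rule \<rho>(2)[OF W])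
    note mh = natural_closed[OF m W h]
    show "R W (\<mu> W h) \<one>\<^bsub>FOb K W\<^esub>"
      using \<tau>\<mu>[OF W h] natural_one[OF s(4,1,2) W] functor_l_one(1)[OF s(2) W mh] mh
        functor_one_closed[OF s(1) W] by (simp add: R_def)
  qed
  note homs = P2_HomI[OF m P2(3,2)] P2_HomI[OF s(4) P2(1,2)] P2_HomI[OF s(5) P2(2,3)] P2_HomI[OF \<rho>(1) P2(2,1)]
  have "Comp (P2 C) (mor C G H \<tau>) (mor C H G \<mu>) = Ident (P2 C) H"
    "Comp (P2 C) (mor C G K \<rho>) (mor C K G \<sigma>) = Ident (P2 C) K"
    "Comp (P2 C) (mor C G H \<tau>) (mor C K G \<sigma>) = Zero (P2 C) K H"
    "Comp (P2 C) (mor C G K \<rho>) (mor C H G \<mu>) = Zero (P2 C) H K"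
    "Add (P2 C) (Comp (P2 C) (mor C H G \<mu>) (mor C G H \<tau>)) (Comp (P2 C) (mor C K G \<sigma>) (mor C G K \<rho>)) =
      Ident (P2 C) G"
    using \<tau>\<mu> \<rho>\<sigma> s(8) \<rho>\<mu> dec
    by (simp_all add: mor_comp[OF m] mor_comp[OF s(4)] mor_comp[OF s(5)] mor_comp[OF \<rho>(1)]
        mor_Ident mor_Zero mor_Add mor_eq_iff)
  then show ?thesis unfolding biproduct_def using homs P2 by (simp, blast)
qed

end

context exact_category
begin

text \<open>A monic arrow has a zero object as its kernel, so the resolution starts with the functor
  of a zero object.\<close>

lemma P2_objects_of_mono:
  assumes F: "F \<in> additive_functors E" and P: "presents i A B F \<pi>"
    and mono: "\<And>W x. x \<in> Hom E W A \<Longrightarrow> i \<cdot> x = Zero E W B \<Longrightarrow> x = Zero E W A"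
  shows "F \<in> P2_objects E"
proof -
  note i = presentsD(1)[OF P]
  have Ob: "A \<in> Ob E" "B \<in> Ob E" using i Hom_Ob by auto
  obtain N where N: "inflation E (Zero E N A)" "N \<in> Ob E" "Ident E N = Zero E N N"
    using inflation_from_zero[OF Ob(1)] .
  show ?thesis
  proof (rule P2_objectsI[OF F P Zero_Hom[OF N(2) Ob(1)] Comp_Zero[OF i N(2)]])
    show "x = Zero E W N" if "x \<in> Hom E W N" for W x using zero_Hom_unique[OF N(3) that] .
    show "\<exists>y\<in>Hom E W N. Zero E N A \<cdot> y = x" if x: "x \<in> Hom E W A" "i \<cdot> x = Zero E W B" for W x
    proof -
      note z = Zero_Hom[OF Hom_Ob(1)[OF x(1)] N(2)]
      show ?thesis using z Zero_Comp[OF z Ob(1)] mono[OF x] by metis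
    qed
  qed
qed

text \<open>\<open>\<Upsilon> E Z\<close> has its values in \<open>'m\<close>, whereas
  \<open>Mod_cat E\<close> is taken over \<open>'u\<close>. The copy \<open>U\<close> is the
  cokernel of the map from a zero object to \<open>Z\<close>; this map is an inflation, hence
  admissible, and \<open>\<theta>\<close> is the comparison isomorphism.\<close>

lemma representable_model:
  assumes Z: "Z \<in> Ob E" and emb: "homs_embed_in E TYPE('u)"
  obtains U :: "('o, 'm, 'u) presheaf" and \<theta> where "U \<in> additive_functors E" "U \<in> mod_adm E"
    "natural E (\<Upsilon> E Z) U \<theta>"
    "\<And>W x. W \<in> Ob E \<Longrightarrow> x \<in> carrier (FOb U W) \<Longrightarrow> \<exists>w\<in>Hom E W Z. \<theta> W w = x"
    "\<And>W w. w \<in> Hom E W Z \<Longrightarrow> \<theta> W w = \<one>\<^bsub>FOb U W\<^esub> \<longleftrightarrow> w = Zero E W Z"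
proof -
  obtain N where N: "inflation E (Zero E N Z)" "N \<in> Ob E" "Ident E N = Zero E N N"
    using inflation_from_zero[OF Z] .
  note z = Zero_Hom[OF N(2) Z]
  obtain U :: "('o, 'm, 'u) presheaf" and \<theta> where U: "U \<in> additive_functors E" "presents (Zero E N Z) N Z U \<theta>"
    using exists_presented[OF z emb] .
  note P = presentsD[OF U(2)]
  have "admissible E (Zero E N Z)"
    using admissibleI[OF deflation_Ident[OF N(2)] Ident_Hom[OF N(2)] N(1) z] Comp_Ident[OF z] by simp
  then have "U \<in> mod_adm E" using U presented_by_iff[OF z] unfolding mod_adm_def by blast
  moreover have "\<theta> W w = \<one>\<^bsub>FOb U W\<^esub> \<longleftrightarrow> w = Zero E W Z" if w: "w \<in> Hom E W Z" for W w
    using P(4)[OF w] Zero_Comp[OF _ Z] Zero_Hom[OF Hom_Ob(1)[OF w] N(2)] by metis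
  ultimately show ?thesis using that U(1) P(2,3) by blast
qed

section \<open>Closure properties and generation\<close>

text \<open>The cover of \<open>F\<close> by a copy of \<open>\<Upsilon>(B)\<close> must be a
  deflation of \<open>P2 E\<close>, so its kernel has to lie there as well. This kernel is the image
  of \<open>\<Upsilon>(g)\<close>, that is, the cokernel of \<open>\<Upsilon>(i)\<close> with
  \<open>i\<close> monic.\<close>

lemma mod_adm_generating:
  fixes F :: "('o, 'm, 'u) presheaf"
  assumes F: "F \<in> P2_objects E" and emb: "homs_embed_in E TYPE('u)"
  shows "\<exists>p. deflation (P2 E) p \<and> Dom (P2 E) p \<in> mod_adm E \<and> Cod (P2 E) p = F"
proof -
  obtain N i A g B \<pi> where P: "presents g A B F \<pi>" and i: "i \<in> Hom E N A" "g \<cdot> i = Zero E N B"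
    and mono: "\<And>W x. x \<in> Hom E W N \<Longrightarrow> i \<cdot> x = Zero E W A \<Longrightarrow> x = Zero E W N"
    and lift: "\<And>W x. x \<in> Hom E W A \<Longrightarrow> g \<cdot> x = Zero E W B \<Longrightarrow> \<exists>y\<in>Hom E W N. i \<cdot> y = x"
    using P2_objectsE[OF F] by metis
  note P1 = presentsD[OF P] and F' = P2_objects_functor[OF F]
  have Ob: "A \<in> Ob E" "B \<in> Ob E" using P1(1) Hom_Ob by auto
  obtain U :: "('o, 'm, 'u) presheaf" and \<theta> where U: "U \<in> additive_functors E" "U \<in> mod_adm E"
    and \<theta>: "natural E (\<Upsilon> E B) U \<theta>"
    and surj: "\<And>W x. W \<in> Ob E \<Longrightarrow> x \<in> carrier (FOb U W) \<Longrightarrow> \<exists>w\<in>Hom E W B. \<theta> W w = x"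
    and ker: "\<And>W w. w \<in> Hom E W B \<Longrightarrow> \<theta> W w = \<one>\<^bsub>FOb U W\<^esub> \<longleftrightarrow> w = Zero E W B"
    using representable_model[OF Ob(2) emb] by metis
  obtain \<tau> where \<tau>: "natural E U F \<tau>" and \<tau>\<theta>: "\<And>W w. w \<in> Hom E W B \<Longrightarrow> \<tau> W (\<theta> W w) = \<pi> W w"
  proof (rule natural_factor[OF Yo_functor[OF Ob(2)] U(1) F' \<theta> P1(2)])
    show "\<exists>a\<in>carrier (FOb (\<Upsilon> E B) W). \<theta> W a = x" if "W \<in> Ob E" "x \<in> carrier (FOb U W)" for W x
      using surj[OF that] by simp
    show "\<pi> W a = \<one>\<^bsub>FOb F W\<^esub>"
      if "W \<in> Ob E" "a \<in> carrier (FOb (\<Upsilon> E B) W)" "\<theta> W a = \<one>\<^bsub>FOb U W\<^esub>" for W a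
      using that ker[of a W] natural_one[OF P1(2) Yo_functor[OF Ob(2)] F' that(1)] by simp
  qed (use Hom_Ob in auto)
  have S: "short_exact (kernel_functor U F \<tau>) (\<lambda>W x. x) U \<tau> F"
  proof (rule short_exact_kernel[OF \<tau> U(1) F'])
    fix W z assume W: "W \<in> Ob E" and z: "z \<in> carrier (FOb F W)"
    obtain w where w: "w \<in> Hom E W B" "\<pi> W w = z" using P1(3)[OF W z] by blast
    then show "\<exists>y\<in>carrier (FOb U W). \<tau> W y = z" using \<tau>\<theta>[OF w(1)] natural_closed[OF \<theta> W, of w] by auto
  qed
  let ?K = "kernel_functor U F \<tau>" and ?\<kappa> = "\<lambda>W a. \<theta> W (Yo_map E g W a)"
  have gv: "g \<cdot> v \<in> Hom E W B" "\<pi> W (g \<cdot> v) = \<one>\<^bsub>FOb F W\<^esub>" if v: "v \<in> Hom E W A" for W v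
    using Comp_Hom[OF v P1(1)] P1(4)[OF Comp_Hom[OF v P1(1)]] v by auto
  have "presents i N A ?K ?\<kappa>"
    unfolding presents_def
  proof (intro conjI ballI allI i(1))
    show "natural E (\<Upsilon> E A) ?K ?\<kappa>"
      by (rule natural_into_kernel[OF natural_comp[OF natural_Yo_map[OF P1(1)] \<theta>]])
        (use gv \<tau>\<theta> in \<open>simp add: Yo_map_def\<close>)
    show "\<exists>w\<in>Hom E W A. ?\<kappa> W w = x" if W: "W \<in> Ob E" and x: "x \<in> carrier (FOb ?K W)" for W x
    proof -
      have x': "x \<in> carrier (FOb U W)" "\<tau> W x = \<one>\<^bsub>FOb F W\<^esub>" using x by (auto simp: kernel_def)
      obtain w where w: "w \<in> Hom E W B" "\<theta> W w = x" using surj[OF W x'(1)] by blast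
      then show ?thesis using P1(4)[OF w(1)] \<tau>\<theta>[OF w(1)] x'(2) by (auto simp: Yo_map_def)
    qed
    show "?\<kappa> W w = \<one>\<^bsub>FOb ?K W\<^esub> \<longleftrightarrow> (\<exists>v\<in>Hom E W N. w = i \<cdot> v)" if w: "w \<in> Hom E W A" for W w
    proof -
      have "g \<cdot> (i \<cdot> v) = Zero E W B" if v: "v \<in> Hom E W N" for v
        using comp_left1[OF v i(1) P1(1) i(2)] Zero_Comp[OF v Ob(2)] by simp
      then have "g \<cdot> w = Zero E W B \<longleftrightarrow> (\<exists>v\<in>Hom E W N. w = i \<cdot> v)" using lift[OF w] by auto
      then show ?thesis using ker[OF gv(1)[OF w]] by (simp add: Yo_map_def)
    qed
  qed
  then have "?K \<in> P2_objects E"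
    using P2_objects_of_mono[OF short_exactD(1)[OF S]] mono by blast
  then have "(mor E ?K U (\<lambda>W x. x), mor E U F \<tau>) \<in> Conflations (P2 E)"
    using P2_conflationI[OF S _ _ F] mod_adm_subset_P2 U(2) by blast
  then show ?thesis using U(2) unfolding deflation_def by (metis P2_simps(1,2) mor_simps)
qed

text \<open>Isomorphic copies and direct summands are both retracts, so this covers two of the
  closure properties.\<close>

lemma mod_adm_retract:
  assumes ic: "idempotent_complete E" and A: "A \<in> P2_objects E" and F: "F \<in> mod_adm E"
    and i: "natural E A F \<iota>" and r: "natural E F A \<rho>"
    and ri: "\<And>W a. W \<in> Ob E \<Longrightarrow> a \<in> carrier (FOb A W) \<Longrightarrow> \<rho> W (\<iota> W a) = a"
  shows "A \<in> mod_adm E"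
proof -
  have FP: "F \<in> P2_objects E" using F mod_adm_subset_P2 by blast
  obtain Z \<xi> where L: "locally_iso F Z \<xi>" using mod_adm_iff[OF ic FP] F by blast
  obtain Z' \<xi>' where "locally_iso A Z' \<xi>'"
    using locally_iso_retract[OF ic P2_objects_functor[OF A] P2_objects_functor[OF FP] L i r ri] by blast
  then show ?thesis using mod_adm_iff[OF ic A] by blast
qed

lemma mod_adm_resolving:
  assumes ic: "idempotent_complete E" and emb: "homs_embed_in E TYPE('u)"
  shows "resolving (P2 E) (mod_adm E :: ('o, 'm, 'u) presheaf set)"
  unfolding resolving_def
proof (intro conjI ballI impI allI)
  show "mod_adm E \<subseteq> Ob (P2 E)" using mod_adm_subset_P2 by simp
next
  fix F G :: "('o, 'm, 'u) presheaf"
  assume F: "F \<in> mod_adm E" and G: "G \<in> Ob (P2 E)" and "isomorphic (P2 E) F G"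
  then obtain f g where f: "f \<in> Hom (P2 E) F G" and g: "g \<in> Hom (P2 E) G F"
    and fg: "Comp (P2 E) f g = Ident (P2 E) G"
    unfolding isomorphic_def isomorphism_def by blast
  obtain \<sigma> where \<sigma>: "f = mor E F G \<sigma>" "natural E F G \<sigma>" using P2_HomE[OF f] by metis
  obtain \<tau> where \<tau>: "g = mor E G F \<tau>" "natural E G F \<tau>" using P2_HomE[OF g] by metis
  have "\<sigma> W (\<tau> W x) = x" if "W \<in> Ob E" "x \<in> carrier (FOb G W)" for W x
    using fg that by (simp add: \<sigma>(1) \<tau>(1) mor_comp[OF \<tau>(2)] mor_Ident mor_eq_iff)
  then show "G \<in> mod_adm E" using mod_adm_retract[OF ic _ F \<tau>(2) \<sigma>(2)] G by simp
next
  fix A B F :: "('o, 'm, 'u) presheaf"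
  assume F: "F \<in> mod_adm E" and "biproduct (P2 E) A B F"
  then obtain i p where A: "A \<in> P2_objects E" and i: "i \<in> Hom (P2 E) A F" and p: "p \<in> Hom (P2 E) F A"
    and pi: "Comp (P2 E) p i = Ident (P2 E) A"
    unfolding biproduct_def by auto
  obtain \<sigma> where \<sigma>: "p = mor E F A \<sigma>" "natural E F A \<sigma>" using P2_HomE[OF p] by metis
  obtain \<tau> where \<tau>: "i = mor E A F \<tau>" "natural E A F \<tau>" using P2_HomE[OF i] by metis
  have "\<sigma> W (\<tau> W x) = x" if "W \<in> Ob E" "x \<in> carrier (FOb A W)" for W x
    using pi that by (simp add: \<sigma>(1) \<tau>(1) mor_comp[OF \<tau>(2)] mor_Ident mor_eq_iff)
  then show "A \<in> mod_adm E" using mod_adm_retract[OF ic A F \<tau>(2) \<sigma>(2)] by simp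
next
  fix F :: "('o, 'm, 'u) presheaf" assume "F \<in> Ob (P2 E)"
  then show "\<exists>p. deflation (P2 E) p \<and> Dom (P2 E) p \<in> mod_adm E \<and> Cod (P2 E) p = F"
    using mod_adm_generating emb by simp
next
  fix ip assume "ip \<in> Conflations (P2 E :: (('o, 'm, 'u) presheaf, _) exact_cat)"
  then obtain i p where ip: "ip = (i, p)" "(i, p) \<in> Conflations (P2 E :: (('o, 'm, 'u) presheaf, _) exact_cat)"
    by (cases ip) auto
  obtain F \<sigma> G \<tau> H where c: "i = mor E F G \<sigma>" "p = mor E G H \<tau>" and S: "short_exact F \<sigma> G \<tau> H"
    and P2: "F \<in> P2_objects E" "G \<in> P2_objects E" "H \<in> P2_objects E"
    using P2_conflationE[OF ip(2)] by metis
  have "G \<in> mod_adm E" if F: "F \<in> mod_adm E" and H: "H \<in> mod_adm E"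
  proof -
    \<comment> \<open>The extension argument is asymmetric: it takes the representing object of
      \<open>F\<close>, but an admissible presentation of \<open>H\<close>.\<close>
    obtain K \<xi> where LF: "locally_iso F K \<xi>" using mod_adm_iff[OF ic P2(1)] F by blast
    obtain p X I m Y \<pi> where h: "H \<in> additive_functors E" "deflation E p" "p \<in> Hom E X I" "inflation E m"
      "m \<in> Hom E I Y" "presents (m \<cdot> p) X Y H \<pi>"
      using mod_admE[OF H] by metis
    obtain Z q where m: "conflation E I m Y q Z" using inflationE[OF h(4,5)] .
    show ?thesis using locally_iso_extension[OF S LF h(6,2,3) m] mod_adm_iff[OF ic P2(2)] by blast
  qed
  then show "case ip of (i, p) \<Rightarrow> Dom (P2 E) i \<in> mod_adm E \<longrightarrow> Cod (P2 E) p \<in> mod_adm E \<longrightarrow> Cod (P2 E) i \<in> mod_adm E"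
    by (simp add: ip(1) c)
  have "F \<in> mod_adm E" if G: "G \<in> mod_adm E" and H: "H \<in> mod_adm E"
  proof -
    obtain Z \<xi> where LG: "locally_iso G Z \<xi>" using mod_adm_iff[OF ic P2(2)] G by blast
    obtain Z' \<xi>' where LH: "locally_iso H Z' \<xi>'" using mod_adm_iff[OF ic P2(3)] H by blast
    show ?thesis using locally_iso_kernel_term[OF ic S LG LH] mod_adm_iff[OF ic P2(1)] by blast
  qed
  then show "case ip of (i, p) \<Rightarrow> Dom (P2 E) p \<in> mod_adm E \<longrightarrow> Cod (P2 E) p \<in> mod_adm E \<longrightarrow> Dom (P2 E) i \<in> mod_adm E"
    by (simp add: ip(1) c)
qed

section \<open>Effaceable functors and minimality\<close>

lemma eff_subset_mod_adm: "eff E \<subseteq> mod_adm E"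
proof
  fix F :: "('o, 'm, 'u) presheaf" assume "F \<in> eff E"
  then obtain f where F: "F \<in> additive_functors E" and f: "deflation E f" "presented_by E f F"
    by (auto simp: eff_def)
  note fH = deflation_Arr[OF f(1)]
  have O: "Cod E f \<in> Ob E" using fH Hom_Ob by auto
  have "admissible E f"
    using admissibleI[OF f(1) fH inflation_Ident[OF O] Ident_Hom[OF O]] Ident_Comp[OF fH] by simp
  then show "F \<in> mod_adm E" using F f(2) by (auto simp: mod_adm_def)
qed

lemma eff_of_presents:
  "F \<in> additive_functors E \<Longrightarrow> presents p X I F \<pi> \<Longrightarrow> deflation E p \<Longrightarrow> F \<in> eff E"
  unfolding eff_def using presented_by_iff[OF presentsD(1)] by blast

text \<open>
  With \<open>q\<close> the cokernel of \<open>m\<close>, the functor \<open>F\<close> is an extension of \<open>Coker \<Upsilon>(m)\<close> by the effaceable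
  functor \<open>Coker \<Upsilon>(p)\<close>, and \<open>Coker \<Upsilon>(m)\<close> is the kernel of \<open>\<Upsilon>(Z) \<rightarrow> Coker \<Upsilon>(q)\<close>. The projective
  \<open>\<Upsilon>(Z)\<close> is a summand of any object that covers it.
\<close>

lemma mod_adm_minimal:
  fixes S :: "('o, 'm, 'u) presheaf set"
  assumes emb: "homs_embed_in E TYPE('u)" and S: "resolving (P2 E) S" and eff: "eff E \<subseteq> S"
  shows "mod_adm E \<subseteq> S"
proof
  fix F :: "('o, 'm, 'u) presheaf" assume FA: "F \<in> mod_adm E"
  then obtain p X I m Y \<pi> where F: "F \<in> additive_functors E" and p: "deflation E p" "p \<in> Hom E X I"
    and m': "inflation E m" "m \<in> Hom E I Y" and P: "presents (m \<cdot> p) X Y F \<pi>"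
    by (rule mod_admE)
  have S_P2: "S \<subseteq> P2_objects E"
    and S_summand: "\<And>A B G. G \<in> S \<Longrightarrow> biproduct (P2 E) A B G \<Longrightarrow> A \<in> S"
    and S_gen: "\<And>G. G \<in> P2_objects E \<Longrightarrow> \<exists>p. deflation (P2 E) p \<and> Dom (P2 E) p \<in> S \<and> Cod (P2 E) p = G"
    using S unfolding resolving_def P2_simps by blast+
  \<comment> \<open>The closure clauses of \<open>resolving\<close> speak of conflations of
    \<open>P2 E\<close>, so the term to be placed in \<open>S\<close> must already be known to lie
    in \<open>P2_objects E\<close>.\<close>
  have S_ext: "G \<in> S" if "short_exact A \<sigma> G \<tau> H" "A \<in> S" "G \<in> P2_objects E" "H \<in> S" for A \<sigma> G \<tau> H
  proof -
    have "(mor E A G \<sigma>, mor E G H \<tau>) \<in> Conflations (P2 E)" using P2_conflationI[OF that(1)] that(2-4) S_P2 by blast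
    then show ?thesis using S that(2,4) unfolding resolving_def by fastforce
  qed
  have S_ker: "A \<in> S" if "short_exact A \<sigma> G \<tau> H" "A \<in> P2_objects E" "G \<in> S" "H \<in> S" for A \<sigma> G \<tau> H
  proof -
    have "(mor E A G \<sigma>, mor E G H \<tau>) \<in> Conflations (P2 E)" using P2_conflationI[OF that(1)] that(2-4) S_P2 by blast
    then show ?thesis using S that(3,4) unfolding resolving_def by fastforce
  qed
  note P1 = presentsD[OF P]
  obtain Z q where c: "conflation E I m Y q Z" using inflationE[OF m'] .
  note m = conflationD[OF c]
  have Ob: "X \<in> Ob E" "Y \<in> Ob E" "I \<in> Ob E" "Z \<in> Ob E" using m p Hom_Ob by auto
  have qm: "q \<cdot> (m \<cdot> u) = Zero E W Z" if u: "u \<in> Hom E W I" for W u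
    using comp_left1[OF u m(1,2,5)] Zero_Comp[OF u Ob(4)] by simp
  obtain U :: "('o, 'm, 'u) presheaf" and \<theta> where U: "U \<in> additive_functors E" "U \<in> mod_adm E"
    and \<theta>: "natural E (\<Upsilon> E Z) U \<theta>"
    and \<theta>_surj: "\<And>W x. W \<in> Ob E \<Longrightarrow> x \<in> carrier (FOb U W) \<Longrightarrow> \<exists>w\<in>Hom E W Z. \<theta> W w = x"
    and \<theta>_ker: "\<And>W w. w \<in> Hom E W Z \<Longrightarrow> \<theta> W w = \<one>\<^bsub>FOb U W\<^esub> \<longleftrightarrow> w = Zero E W Z"
    using representable_model[OF Ob(4) emb] by metis
  have \<theta>_surj': "\<exists>a\<in>carrier (FOb (\<Upsilon> E Z) W). \<theta> W a = x" if "W \<in> Ob E" "x \<in> carrier (FOb U W)" for W x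
    using \<theta>_surj[OF that] by simp
  have UP: "U \<in> P2_objects E" using U(2) mod_adm_subset_P2 by blast
  have "U \<in> S"
  proof -
    obtain t where t: "deflation (P2 E) t" "Dom (P2 E) t \<in> S" "Cod (P2 E) t = U" using S_gen[OF UP] by blast
    then obtain i where "(i, t) \<in> Conflations (P2 E)" by (auto simp: deflation_def)
    then obtain K \<sigma> G \<tau> H where "i = mor E K G \<sigma>" "t = mor E G H \<tau>" and SE: "short_exact K \<sigma> G \<tau> H"
      and KGH: "K \<in> P2_objects E" "G \<in> P2_objects E" "H \<in> P2_objects E"
      by (rule P2_conflationE) (rule that)
    then have HU: "H = U" and G: "G \<in> S" using t by auto
    note SE' = SE[unfolded HU]
    note s = short_exactD[OF SE']
    \<comment> \<open>Projectivity by Yoneda: a lift \<open>x\<close> of the generating section of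
      \<open>U\<close> along \<open>\<tau>\<close> determines the splitting
      \<open>\<mu>\<close>.\<close>
    have "\<theta> Z (Ident E Z) \<in> carrier (FOb U Z)" using natural_closed[OF \<theta> Ob(4)] Ident_Hom[OF Ob(4)] by simp
    then obtain x where x: "x \<in> carrier (FOb G Z)" "\<tau> Z x = \<theta> Z (Ident E Z)" using s(9)[OF Ob(4)] by blast
    note nx = natural_of_element[OF s(2) Ob(4) x(1)]
    obtain \<mu> where \<mu>: "natural E U G \<mu>"
      "\<And>W a. W \<in> Ob E \<Longrightarrow> a \<in> carrier (FOb (\<Upsilon> E Z) W) \<Longrightarrow> \<mu> W (\<theta> W a) = FArr G a x"
    proof (rule natural_factor[OF Yo_functor[OF Ob(4)] U(1) s(2) \<theta> nx])
      show "\<exists>a\<in>carrier (FOb (\<Upsilon> E Z) W). \<theta> W a = x" if "W \<in> Ob E" "x \<in> carrier (FOb U W)" for W x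
        using \<theta>_surj'[OF that] .
      show "FArr G a x = \<one>\<^bsub>FOb G W\<^esub>"
        if "W \<in> Ob E" "a \<in> carrier (FOb (\<Upsilon> E Z) W)" "\<theta> W a = \<one>\<^bsub>FOb U W\<^esub>" for W a
        using that \<theta>_ker[of a W] natural_one[OF nx Yo_functor[OF Ob(4)] s(2) that(1)] by simp
    qed (rule that)
    have "\<tau> W (\<mu> W u) = u" if W: "W \<in> Ob E" and u: "u \<in> carrier (FOb U W)" for W u
    proof -
      obtain w where w: "w \<in> Hom E W Z" "\<theta> W w = u" using \<theta>_surj[OF W u] by blast
      show ?thesis using \<mu>(2)[OF W, of w] w natural_arr[OF s(5) w(1) x(1)] x(2) yoneda[OF \<theta> w(1)] by simp
    qed
    then have "biproduct (P2 E) U K G" using short_exact_split[OF SE' \<mu>(1)] KGH HU by blast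
    then show ?thesis using S_summand[OF G] by blast
  qed
  obtain H :: "('o, 'm, 'u) presheaf" and \<psi> where H: "H \<in> additive_functors E" and PH: "presents q Y Z H \<psi>"
    using exists_presented[OF m(2) emb] .
  note H1 = presentsD[OF PH]
  have HS: "H \<in> S" using eff_of_presents[OF H PH m(4)] eff by blast
  obtain \<upsilon> where \<upsilon>: "natural E U H \<upsilon>"
    "\<And>W a. W \<in> Ob E \<Longrightarrow> a \<in> carrier (FOb (\<Upsilon> E Z) W) \<Longrightarrow> \<upsilon> W (\<theta> W a) = \<psi> W a"
  proof (rule natural_factor[OF Yo_functor[OF Ob(4)] U(1) H \<theta> H1(2)])
    show "\<exists>a\<in>carrier (FOb (\<Upsilon> E Z) W). \<theta> W a = x" if "W \<in> Ob E" "x \<in> carrier (FOb U W)" for W x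
      using \<theta>_surj'[OF that] .
    show "\<psi> W a = \<one>\<^bsub>FOb H W\<^esub>"
      if "W \<in> Ob E" "a \<in> carrier (FOb (\<Upsilon> E Z) W)" "\<theta> W a = \<one>\<^bsub>FOb U W\<^esub>" for W a
      using that \<theta>_ker[of a W] natural_one[OF H1(2) Yo_functor[OF Ob(4)] H that(1)] by simp
  qed (rule that)
  have \<upsilon>\<theta>: "\<upsilon> W (\<theta> W w) = \<psi> W w" if "w \<in> Hom E W Z" for W w
    using \<upsilon>(2)[OF Hom_Ob(1)[OF that]] that by simp
  let ?K = "kernel_functor U H \<upsilon>"
  have SK: "short_exact ?K (\<lambda>W x. x) U \<upsilon> H"
  proof (rule short_exact_kernel[OF \<upsilon>(1) U(1) H])
    fix W z assume W: "W \<in> Ob E" and z: "z \<in> carrier (FOb H W)"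
    obtain w where w: "w \<in> Hom E W Z" "\<psi> W w = z" using H1(3)[OF W z] by blast
    then show "\<exists>y\<in>carrier (FOb U W). \<upsilon> W y = z" using \<upsilon>\<theta>[OF w(1)] natural_closed[OF \<theta> W, of w] by auto
  qed
  note KA = short_exactD(1)[OF SK]
  \<comment> \<open>Composition with \<open>q\<close>, regarded as a map into the kernel of
    \<open>\<upsilon>\<close>. Since \<open>m\<close> is a kernel of \<open>q\<close>, it exhibits
    that kernel as the cokernel of \<open>\<Upsilon>(m)\<close>.\<close>
  define \<kappa> where "\<kappa> = (\<lambda>W a. \<theta> W (Yo_map E q W a))"
  have \<kappa>: "\<kappa> W y = \<one>\<^bsub>FOb ?K W\<^esub> \<longleftrightarrow> (\<exists>u\<in>Hom E W I. y = m \<cdot> u)" if y: "y \<in> Hom E W Y" for W y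
  proof -
    have "q \<cdot> y = Zero E W Z \<longleftrightarrow> (\<exists>u\<in>Hom E W I. y = m \<cdot> u)"
      using conflation_lift[OF c y] qm by metis
    then show ?thesis using \<theta>_ker[OF Comp_Hom[OF y m(2)]] by (simp add: Yo_map_def \<kappa>_def)
  qed
  have PK: "presents m I Y ?K \<kappa>"
    unfolding presents_def
  proof (intro conjI ballI allI m(1) \<kappa>)
    have "\<psi> W (q \<cdot> y) = \<one>\<^bsub>FOb H W\<^esub>" if y: "y \<in> Hom E W Y" for W y
      using H1(4)[OF Comp_Hom[OF y m(2)]] y by blast
    then show "natural E (\<Upsilon> E Y) ?K \<kappa>"
      unfolding \<kappa>_def
      by (intro natural_into_kernel[OF natural_comp[OF natural_Yo_map[OF m(2)] \<theta>]])
        (use \<upsilon>\<theta> Comp_Hom[OF _ m(2)] in \<open>simp add: Yo_map_def\<close>)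
    show "\<exists>w\<in>Hom E W Y. \<kappa> W w = x" if W: "W \<in> Ob E" and x: "x \<in> carrier (FOb ?K W)" for W x
    proof -
      have x': "x \<in> carrier (FOb U W)" "\<upsilon> W x = \<one>\<^bsub>FOb H W\<^esub>" using x by (auto simp: kernel_def)
      obtain w where w: "w \<in> Hom E W Z" "\<theta> W w = x" using \<theta>_surj[OF W x'(1)] by blast
      then show ?thesis using H1(4)[OF w(1)] \<upsilon>\<theta>[OF w(1)] x'(2) by (auto simp: Yo_map_def \<kappa>_def)
    qed
  qed
  note K1 = presentsD[OF PK]
  have "?K \<in> P2_objects E" by (rule P2_objects_of_mono[OF KA PK]) (rule inflation_zero_kernel[OF m'])
  then have KS: "?K \<in> S" using S_ker[OF SK _ \<open>U \<in> S\<close> HS] by blast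
  \<comment> \<open>The surjection from \<open>F\<close> onto the cokernel of
    \<open>\<Upsilon>(m)\<close>, which exists because \<open>m \<cdot> p\<close> factors through
    \<open>m\<close>.\<close>
  obtain \<eta> where \<eta>: "natural E F ?K \<eta>"
    "\<And>W a. W \<in> Ob E \<Longrightarrow> a \<in> carrier (FOb (\<Upsilon> E Y) W) \<Longrightarrow> \<eta> W (\<pi> W a) = \<kappa> W a"
  proof (rule natural_factor[OF Yo_functor[OF Ob(2)] F KA P1(2) K1(2)])
    show "\<exists>a\<in>carrier (FOb (\<Upsilon> E Y) W). \<pi> W a = x" if "W \<in> Ob E" "x \<in> carrier (FOb F W)" for W x
      using P1(3)[OF that] by simp
    show "\<kappa> W a = \<one>\<^bsub>FOb ?K W\<^esub>" if a: "a \<in> carrier (FOb (\<Upsilon> E Y) W)" "\<pi> W a = \<one>\<^bsub>FOb F W\<^esub>" for W a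
    proof -
      have aY: "a \<in> Hom E W Y" using a by simp
      obtain v where v: "v \<in> Hom E W X" "a = (m \<cdot> p) \<cdot> v" using P1(4)[OF aY] a(2) by blast
      then have "a = m \<cdot> (p \<cdot> v)" using Comp_assoc[OF v(1) p(2) m(1)] by simp
      then show ?thesis using \<kappa>[OF aY] Comp_Hom[OF v(1) p(2)] by blast
    qed
  qed (rule that)
  have \<eta>\<pi>: "\<eta> W (\<pi> W y) = \<kappa> W y" if "y \<in> Hom E W Y" for W y
    using \<eta>(2)[OF Hom_Ob(1)[OF that]] that by simp
  let ?T = "kernel_functor F ?K \<eta>"
  have ST: "short_exact ?T (\<lambda>W x. x) F \<eta> ?K"
  proof (rule short_exact_kernel[OF \<eta>(1) F KA])
    fix W z assume W: "W \<in> Ob E" and z: "z \<in> carrier (FOb ?K W)"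
    obtain y where y: "y \<in> Hom E W Y" "\<kappa> W y = z" using K1(3)[OF W z] by blast
    then show "\<exists>y\<in>carrier (FOb F W). \<eta> W y = z" using \<eta>\<pi>[OF y(1)] natural_closed[OF P1(2) W, of y] by auto
  qed
  \<comment> \<open>The kernel of \<open>\<eta>\<close> consists of the classes of arrows through
    \<open>m\<close>. As \<open>m\<close> is monic, such a class is trivial exactly when the arrow
    into \<open>I\<close> factors through \<open>p\<close>, so the deflation \<open>p\<close>
    presents this kernel.\<close>
  define \<epsilon> where "\<epsilon> = (\<lambda>W a. \<pi> W (Yo_map E m W a))"
  have "presents p X I ?T \<epsilon>"
    unfolding presents_def
  proof (intro conjI ballI allI p(2))
    have "\<eta> W (\<pi> W (m \<cdot> u)) = \<one>\<^bsub>FOb ?K W\<^esub>" if u: "u \<in> Hom E W I" for W u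
      using \<eta>\<pi>[OF Comp_Hom[OF u m(1)]] \<kappa>[OF Comp_Hom[OF u m(1)]] u by metis
    then show "natural E (\<Upsilon> E I) ?T \<epsilon>"
      unfolding \<epsilon>_def
      by (intro natural_into_kernel[OF natural_comp[OF natural_Yo_map[OF m(1)] P1(2)]])
        (simp add: Yo_map_def)
    show "\<exists>w\<in>Hom E W I. \<epsilon> W w = x" if W: "W \<in> Ob E" and x: "x \<in> carrier (FOb ?T W)" for W x
    proof -
      have x': "x \<in> carrier (FOb F W)" "\<eta> W x = \<one>\<^bsub>FOb ?K W\<^esub>" using x by (auto simp: kernel_def)
      obtain y where y: "y \<in> Hom E W Y" "\<pi> W y = x" using P1(3)[OF W x'(1)] by blast
      obtain u where u: "u \<in> Hom E W I" "y = m \<cdot> u" using \<kappa>[OF y(1)] \<eta>\<pi>[OF y(1)] y(2) x'(2) by auto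
      then show ?thesis using y(2) by (auto simp: Yo_map_def \<epsilon>_def)
    qed
    show "\<epsilon> W w = \<one>\<^bsub>FOb ?T W\<^esub> \<longleftrightarrow> (\<exists>v\<in>Hom E W X. w = p \<cdot> v)" if w: "w \<in> Hom E W I" for W w
    proof -
      have "m \<cdot> w = (m \<cdot> p) \<cdot> v \<longleftrightarrow> w = p \<cdot> v" if v: "v \<in> Hom E W X" for v
        using Comp_assoc[OF v p(2) m(1)] conflation_mono[OF c w Comp_Hom[OF v p(2)]] by metis
      then show ?thesis using P1(4)[OF Comp_Hom[OF w m(1)]] by (simp add: Yo_map_def \<epsilon>_def)
    qed
  qed
  then have "?T \<in> S" using eff_of_presents[OF short_exactD(1)[OF ST] _ p(1)] eff by blast
  then show "F \<in> S" using S_ext[OF ST _ _ KS] FA mod_adm_subset_P2 by blast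
qed

end

theorem proposition5p4:
  fixes E :: "('o, 'm) exact_cat"
  assumes "exact_category E"
    and "idempotent_complete E"
    and "homs_embed_in E TYPE('u)"
  shows "resolving (P2 E) (mod_adm E :: ('o, 'm, 'u) presheaf set) \<and>
    (eff E :: ('o, 'm, 'u) presheaf set) \<subseteq> mod_adm E \<and>
    (\<forall>S :: ('o, 'm, 'u) presheaf set.
      resolving (P2 E) S \<longrightarrow> eff E \<subseteq> S \<longrightarrow> mod_adm E \<subseteq> S)"
proof -
  interpret exact_category E by (rule assms(1))
  show ?thesis
    using mod_adm_resolving[OF assms(2,3)] eff_subset_mod_adm mod_adm_minimal[OF assms(3)] by blast
qed

end
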